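(* Let $n\ge 1$ be an integer, $\sigma\ge 1$, $0<\delta_1<\sigma/2<\delta_2<\sigma$ with $\delta_1+\delta_2>\sigma$, $j\in\{0,1\}$ and $s\ge 0$. Assume $n>4\delta_1$ and $$(u_0,u_1)\in \big(L^1(\mathbb{R}^n)\cap H^{s+2j\delta_2}(\mathbb{R}^n)\big)\times\big(L^1(\mathbb{R}^n)\cap H^{[s+2(j-1)\delta_2]^+}(\mathbb{R}^n)\big).$$ Let $u$ be the Sobolev solution of $$u_{tt}+(-\Delta)^\sigma u+(-\Delta)^{\delta_1}u_t+(-\Delta)^{\delta_2}u_t=0,\qquad u(0,x)=u_0(x),\quad u_t(0,x)=u_1(x),$$ and let $P_1=\int_{\mathbb{R}^n}u_1(x)\,dx$. Then, as $t\to\infty$, $$\Big\|\partial_t^j |D|^s \Big(u(t,\cdot)- P_1\,\mathfrak{F}^{-1}\Big(\frac{e^{-t|\xi|^{2(\sigma-\delta_1)}}}{|\xi|^{2\delta_1}}\Big)(t,\cdot)\Big)\Big\|_{L^2}= o\Big(t^{-\frac{n}{4(\sigma-\delta_1)}-\frac{s}{2(\sigma-\delta_1)}-j+ \frac{\delta_1}{\sigma-\delta_1}}\Big).$$ Moreover, if $P_1\neq 0$, then there are positive constants $C_1,C_2$ (independent of $t$) such that for all sufficiently large $t\ge 1$ $$C_1\,t^{-\frac{n}{4(\sigma-\delta_1)}-\frac{s}{2(\sigma-\delta_1)}-j+ \frac{\delta_1}{\sigma-\delta_1}}\le \big\|\partial_t^j |D|^s u(t,\cdot)\big\|_{L^2}\le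 C_2\,t^{-\frac{n}{4(\sigma-\delta_1)}-\frac{s}{2(\sigma-\delta_1)}-j+ \frac{\delta_1}{\sigma-\delta_1}}.$$
   Context: $H^a$ ($a\ge0$) is the $L^2$-based Bessel potential (Sobolev) space on $\mathbb{R}^n$; $[r]^+=\max\{r,0\}$. $\widehat{w}=\mathfrak{F}(w)$ is the Fourier transform in $x$, normalized so that $\widehat w(\xi)=\int_{\mathbb{R}^n}e^{-ix\cdot\xi}w(x)\,dx$ for $w \in L^1$, and $\mathfrak{F}^{-1}$ is its inverse. $|D|^s$ and $(-\Delta)^{\alpha}$ are the Fourier multipliers with symbols $|\xi|^s$ and $|\xi|^{2\alpha}$. The Sobolev solution $u$ is the one whose partial Fourier transform solves, for a.e. $\xi$, the ODE $\widehat u_{tt}+(|\xi|^{2\delta_1}+|\xi|^{2\delta_2})\widehat u_t+|\xi|^{2\sigma}\widehat u=0$ with $\widehat u(0,\xi)=\widehat{u_0}(\xi)$, $\widehat u_t(0,\xi)=\widehat{u_1}(\xi)$. *)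

theory Defs
  imports "HOL-Analysis.Analysis" "HOL-Library.Landau_Symbols"
begin

text \<open>
  Elements of \<open>L\<^sup>2\<close> are represented by functions. The operators below that are defined only up to
  null sets pick a representative by \<open>SOME\<close>; every notion built on them is insensitive to the choice.
\<close>

definition L2 :: "('a::euclidean_space \<Rightarrow> complex) set" where
  "L2 = {f. f \<in> borel_measurable lebesgue \<and> integrable lebesgue (\<lambda>x. (cmod (f x))\<^sup>2)}"

definition L2norm :: "('a::euclidean_space \<Rightarrow> complex) \<Rightarrow> real" where
  "L2norm f = sqrt (LINT x|lebesgue. (cmod (f x))\<^sup>2)"

text \<open>The membership conditions matter: \<open>L2norm\<close> is a junk value \<open>0\<close> outside \<open>L2\<close>.\<close>

definition L2_tendsto ::
    "('b \<Rightarrow> 'a::euclidean_space \<Rightarrow> complex) \<Rightarrow> ('a \<Rightarrow> complex) \<Rightarrow> 'b filter \<Rightarrow> bool" where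
  "L2_tendsto U V F \<longleftrightarrow>
     V \<in> L2 \<and> (\<forall>\<^sub>F h in F. U h \<in> L2) \<and> ((\<lambda>h. L2norm (\<lambda>x. U h x - V x)) \<longlongrightarrow> 0) F"

definition fourier_integral ::
    "('a::euclidean_space \<Rightarrow> complex) \<Rightarrow> 'a \<Rightarrow> complex" where
  "fourier_integral f \<xi> = (LINT x|lebesgue. cis (- (x \<bullet> \<xi>)) * f x)"

text \<open>
  The Fourier transform on \<open>L\<^sup>2\<close> in Plancherel's sense: the \<open>L\<^sup>2\<close>-limit, as \<open>R \<rightarrow> \<infinity>\<close>, of the Fourier
  integrals of the (integrable) truncations of \<open>f\<close> to the ball of radius \<open>R\<close>. On \<open>L\<^sup>1 \<inter> L\<^sup>2\<close> it agrees
  almost everywhere with \<open>fourier_integral\<close>.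
\<close>

definition has_fourier ::
    "('a::euclidean_space \<Rightarrow> complex) \<Rightarrow> ('a \<Rightarrow> complex) \<Rightarrow> bool" where
  "has_fourier f g \<longleftrightarrow> f \<in> L2 \<and>
     L2_tendsto (\<lambda>R::real. fourier_integral (\<lambda>x. indicat_real (cball 0 R) x *\<^sub>R f x)) g at_top"

definition fourier :: "('a::euclidean_space \<Rightarrow> complex) \<Rightarrow> 'a \<Rightarrow> complex" where
  "fourier f = (SOME g. has_fourier f g)"

definition inv_fourier :: "('a::euclidean_space \<Rightarrow> complex) \<Rightarrow> 'a \<Rightarrow> complex" where
  "inv_fourier g = (SOME f. has_fourier f g)"

definition sobolev :: "real \<Rightarrow> ('a::euclidean_space \<Rightarrow> complex) set" where
  "sobolev a =
     {f \<in> L2. (\<lambda>\<xi>. complex_of_real ((1 + (norm \<xi>)\<^sup>2) powr (a / 2)) * fourier f \<xi>) \<in> L2}"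

text \<open>
  The multiplier \<open>|D|\<^sup>s\<close>. For \<open>s \<ge> 0\<close> its domain in \<open>L\<^sup>2\<close> is \<open>sobolev s\<close>. That \<open>0 powr 0 = 0\<close> is
  harmless here, since \<open>{0}\<close> is a null set.
\<close>

definition abs_D :: "real \<Rightarrow> ('a::euclidean_space \<Rightarrow> complex) \<Rightarrow> 'a \<Rightarrow> complex" where
  "abs_D s w = inv_fourier (\<lambda>\<xi>. complex_of_real (norm \<xi> powr s) * fourier w \<xi>)"

text \<open>Time derivatives are derivatives of \<open>L\<^sup>2\<close>-valued curves.\<close>

definition has_L2_derivative ::
    "(real \<Rightarrow> 'a::euclidean_space \<Rightarrow> complex) \<Rightarrow> ('a \<Rightarrow> complex) \<Rightarrow> real \<Rightarrow> bool" where
  "has_L2_derivative U V t \<longleftrightarrow>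
     (\<forall>\<^sub>F \<tau> in nhds t. U \<tau> \<in> L2) \<and>
     L2_tendsto (\<lambda>h x. (U (t + h) x - U t x) / complex_of_real h) V (at 0)"

definition L2_differentiable ::
    "(real \<Rightarrow> 'a::euclidean_space \<Rightarrow> complex) \<Rightarrow> real \<Rightarrow> bool" where
  "L2_differentiable U t \<longleftrightarrow> (\<exists>V. has_L2_derivative U V t)"

definition D_t ::
    "(real \<Rightarrow> 'a::euclidean_space \<Rightarrow> complex) \<Rightarrow> real \<Rightarrow> 'a \<Rightarrow> complex" where
  "D_t U t = (SOME V. has_L2_derivative U V t)"

text \<open>
  In the next definition \<open>v t \<xi>\<close> is the partial Fourier transform of \<open>u\<close> and \<open>v' t \<xi>\<close> its time
  derivative (one-sided at \<open>t = 0\<close>). The exceptional null set of frequencies does not depend on \<open>t\<close>.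
\<close>

definition sobolev_solution ::
    "real \<Rightarrow> real \<Rightarrow> real \<Rightarrow> ('a::euclidean_space \<Rightarrow> complex) \<Rightarrow> ('a \<Rightarrow> complex) \<Rightarrow>
     (real \<Rightarrow> 'a \<Rightarrow> complex) \<Rightarrow> bool" where
  "sobolev_solution \<sigma> \<delta>1 \<delta>2 u0 u1 u \<longleftrightarrow>
     (\<exists>v v'.
        (\<forall>t\<ge>0. has_fourier (u t) (v t)) \<and>
        (AE \<xi> in lebesgue.
           v 0 \<xi> = fourier u0 \<xi> \<and> v' 0 \<xi> = fourier u1 \<xi> \<and>
           (\<forall>t\<ge>0.
              ((\<lambda>t. v t \<xi>) has_vector_derivative v' t \<xi>) (at t within {0..}) \<and>
              (\<exists>v''. ((\<lambda>t. v' t \<xi>) has_vector_derivative v'') (at t within {0..}) \<and>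
                 v'' + complex_of_real (norm \<xi> powr (2 * \<delta>1) + norm \<xi> powr (2 * \<delta>2)) * v' t \<xi>
                     + complex_of_real (norm \<xi> powr (2 * \<sigma>)) * v t \<xi> = 0))))"

definition diffusion_profile ::
    "real \<Rightarrow> real \<Rightarrow> real \<Rightarrow> 'a::euclidean_space \<Rightarrow> complex" where
  "diffusion_profile \<sigma> \<delta>1 t =
     inv_fourier (\<lambda>\<xi>. complex_of_real
       (exp (- t * norm \<xi> powr (2 * (\<sigma> - \<delta>1))) / norm \<xi> powr (2 * \<delta>1)))"

end

theory Submission
  imports Defs "HOL-Probability.Characteristic_Functions"
begin

text \<open>
  The theorem is decided on the frequency side. At frequency \<open>\<xi>\<close> the equation is a damped oscillator
  \<open>z'' + b z' + a z = 0\<close> with \<open>a = |\<xi>|^(2\<sigma>)\<close> and \<open>b = |\<xi>|^(2\<delta>1) + |\<xi>|^(2\<delta>2)\<close>, and \<open>a \<le> b\<^sup>2\<close> throughout. Its slow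
  mode decays at a rate comparable with \<open>a / b\<close> and, apart from the contribution of the first datum, has the
  amplitude \<open>z'(0) / b\<close>; its fast mode decays at a rate comparable with \<open>b\<close>. For \<open>|\<xi>| \<ge> 1\<close> the ratio \<open>a / b\<close> is at least \<open>1/2\<close>, so
  these frequencies contribute an exponentially small term. For small \<open>\<xi>\<close> one has \<open>a / b \<approx> |\<xi>|^\<kappa>\<close> with
  \<open>\<kappa> = 2 (\<sigma> - \<delta>1)\<close> and \<open>b \<approx> |\<xi>|^(2\<delta>1)\<close>, and the transform of the second datum at \<open>\<xi>\<close> is close to its value at \<open>0\<close>, which is
  the integral \<open>P1\<close>. This is how \<open>P1 exp (- t |\<xi>|^\<kappa>) / |\<xi>|^(2\<delta>1)\<close> arises.

  Two facts about a single oscillator make this precise. Energy estimates (\<open>position_bound\<close>,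
  \<open>velocity_bound\<close>, \<open>velocity_bound_slow\<close>) hold uniformly in all frequencies, also near those where the characteristic
  roots coincide. The formula with the two roots identifies the limit in the
  overdamped regime (\<open>overdamped_limit\<close>). The substitution \<open>\<xi> = t^(-1/\<kappa>) \<eta>\<close> turns the low-frequency part into a question of
  dominated convergence in \<open>\<eta>\<close> (\<open>low_frequency_bound\<close>, \<open>low_frequency_limit\<close>, \<open>scaled_tendsto\<close>). The
  majorant behaves like \<open>|\<eta>|^(s - 2\<delta>1)\<close> at the origin, which is square integrable because \<open>n > 4\<delta>1\<close>. The
  power of \<open>t\<close> that the substitution produces is the one in the theorem (\<open>rate_dilation\<close>). Since the profile is homogeneous,
  its norm is an exact multiple of that power (\<open>profile_norm\<close>), and the two-sided bounds
  follow from the estimate of the remainder (\<open>remainder_smallo\<close>, \<open>two_sided_bounds\<close>).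

  The frequency side determines the norms on the space side because the Fourier transform is, up to the
  factor \<open>(2\<pi>)^(n/2)\<close>, an isometry of \<open>L\<^sup>2\<close> onto itself (\<open>plancherel\<close>, \<open>has_fourier_exists\<close>,
  \<open>has_fourier_surj\<close>). On \<open>L\<^sup>1 \<inter> L\<^sup>2\<close> this is obtained by testing \<open>|Ff|\<^sup>2\<close>, the transform of
  the autocorrelation of \<open>f\<close>, against spreading Gaussians, and continuity of translation in \<open>L\<^sup>2\<close> gives the limit
  (\<open>plancherel_borel\<close>). Time derivatives are carried across by the isometry
  (\<open>has_L2_derivative_of_fourier\<close>).
\<close>

section \<open>The space \<open>L\<^sup>2\<close>\<close>

lemma L2_measurable [measurable_dest]: "f \<in> L2 \<Longrightarrow> f \<in> borel_measurable lebesgue"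
  by (simp add: L2_def)

lemma L2_integrable: "f \<in> L2 \<Longrightarrow> integrable lebesgue (\<lambda>x. (cmod (f x))\<^sup>2)"
  by (simp add: L2_def)

lemma L2norm_nonneg [simp]: "0 \<le> L2norm f"
  by (simp add: L2norm_def)

lemma L2norm_square: "(L2norm f)\<^sup>2 = (LINT x|lebesgue. (cmod (f x))\<^sup>2)"
  by (simp add: L2norm_def)

lemma L2_iff_nn_integral:
  "f \<in> L2 \<longleftrightarrow> f \<in> borel_measurable lebesgue \<and> (\<integral>\<^sup>+x. ennreal ((cmod (f x))\<^sup>2) \<partial>lebesgue) < \<infinity>"
  unfolding L2_def integrable_iff_bounded by auto

lemma nn_integral_L2norm:
  "f \<in> L2 \<Longrightarrow> (\<integral>\<^sup>+x. ennreal ((cmod (f x))\<^sup>2) \<partial>lebesgue) = ennreal ((L2norm f)\<^sup>2)"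
  unfolding L2norm_square by (rule nn_integral_eq_integral[OF L2_integrable]) auto

text \<open>Membership and the norm bound come together, so that no integrability has to be known beforehand.\<close>

lemma L2norm_le_nn_integral:
  assumes "(\<integral>\<^sup>+x. ennreal ((cmod (f x))\<^sup>2) \<partial>lebesgue) \<le> ennreal (B\<^sup>2)" "B \<ge> 0"
    and "f \<in> borel_measurable lebesgue"
  shows "f \<in> L2" "L2norm f \<le> B"
proof -
  show *: "f \<in> L2"
    using assms by (auto simp: L2_iff_nn_integral intro: le_less_trans)
  show "L2norm f \<le> B"
    using assms(1,2) nn_integral_L2norm[OF *] by (auto simp: power2_le_iff_abs_le)
qed

lemma L2norm_cong_AE:
  assumes "AE x in lebesgue. f x = g x"
    and "f \<in> borel_measurable lebesgue" "g \<in> borel_measurable lebesgue"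
  shows "L2norm f = L2norm g"
  unfolding L2norm_def
  by (intro arg_cong[where f=sqrt] integral_cong_AE) (use assms in auto)


text \<open>Lebesgue measure is complete, so changes on a null set do not affect measurability.\<close>

lemma borel_measurable_lebesgue_cong_AE:
  fixes f g :: "'a::euclidean_space \<Rightarrow> complex"
  assumes [measurable]: "f \<in> borel_measurable lebesgue" and fg: "AE x in lebesgue. f x = g x"
  shows "g \<in> borel_measurable lebesgue"
proof (rule measurableI)
  fix A :: "complex set" assume A: "A \<in> sets borel"
  have "f -` A \<inter> space lebesgue \<in> sets lebesgue"
    using A by measurable
  moreover have "AE x in lebesgue. x \<in> f -` A \<inter> space lebesgue \<longleftrightarrow> x \<in> g -` A \<inter> space lebesgue"
    using fg by eventually_elim auto
  ultimately show "g -` A \<inter> space lebesgue \<in> sets lebesgue"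
    using completion.in_sets_AE by blast
qed auto

lemma L2_cong_AE:
  assumes "f \<in> L2" "AE x in lebesgue. f x = g x"
  shows "g \<in> L2" "L2norm g = L2norm f"
proof -
  have g: "g \<in> borel_measurable lebesgue"
    by (rule borel_measurable_lebesgue_cong_AE[OF _ assms(2)]) (use assms in \<open>auto simp: L2_def\<close>)
  have "(\<integral>\<^sup>+x. ennreal ((cmod (f x))\<^sup>2) \<partial>lebesgue) = (\<integral>\<^sup>+x. ennreal ((cmod (g x))\<^sup>2) \<partial>lebesgue)"
    by (rule nn_integral_cong_AE) (use assms in auto)
  then show "g \<in> L2"
    using assms g by (auto simp: L2_iff_nn_integral)
  show "L2norm g = L2norm f"
    by (rule L2norm_cong_AE) (use assms g in \<open>auto simp: L2_def\<close>)
qed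

lemma L2_dominated:
  assumes g: "g \<in> L2" and f: "f \<in> borel_measurable lebesgue"
    and le: "AE x in lebesgue. cmod (f x) \<le> C * cmod (g x)" and C: "C \<ge> 0"
  shows "f \<in> L2" "L2norm f \<le> C * L2norm g"
proof -
  note [measurable] = f
  have [measurable]: "g \<in> borel_measurable lebesgue" using g by (simp add: L2_def)
  have "(\<integral>\<^sup>+x. ennreal ((cmod (f x))\<^sup>2) \<partial>lebesgue)
      \<le> (\<integral>\<^sup>+x. ennreal (C\<^sup>2) * ennreal ((cmod (g x))\<^sup>2) \<partial>lebesgue)"
  proof (rule nn_integral_mono_AE, use le in eventually_elim)
    case (elim x)
    then have "(cmod (f x))\<^sup>2 \<le> (C * cmod (g x))\<^sup>2"
      by (intro power_mono) auto
    then show ?case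
      by (simp add: ennreal_mult[symmetric] power_mult_distrib ennreal_leI)
  qed
  also have "\<dots> = ennreal (C\<^sup>2) * ennreal ((L2norm g)\<^sup>2)"
    by (subst nn_integral_cmult) (auto simp: nn_integral_L2norm[OF g])
  also have "\<dots> = ennreal ((C * L2norm g)\<^sup>2)"
    by (simp add: ennreal_mult[symmetric] power_mult_distrib)
  finally show "f \<in> L2" "L2norm f \<le> C * L2norm g"
    using L2norm_le_nn_integral[OF _ _ f] C by simp_all
qed

lemma borel_measurable_cnj [measurable]: "cnj \<in> borel_measurable borel"
  by (intro borel_measurable_continuous_onI continuous_intros)

lemma L2_cnj: "f \<in> L2 \<Longrightarrow> (\<lambda>x. cnj (f x)) \<in> L2"
  and L2norm_cnj [simp]: "L2norm (\<lambda>x. cnj (f x)) = L2norm f"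
  by (simp_all add: L2_def L2norm_def measurable_compose[OF _ borel_measurable_cnj])

lemma L2_scale: "f \<in> L2 \<Longrightarrow> (\<lambda>x. c * f x) \<in> L2"
  and L2norm_scale: "L2norm (\<lambda>x. c * f x) = cmod c * L2norm f"
  by (auto simp: L2_def L2norm_def norm_mult power_mult_distrib real_sqrt_mult)

lemma L2norm_minus_commute: "L2norm (\<lambda>x. f x - g x) = L2norm (\<lambda>x. g x - f x)"
  by (simp add: L2norm_def norm_minus_commute)

lemma L2_times_integrable:
  assumes "f \<in> L2" "g \<in> L2"
  shows "integrable lebesgue (\<lambda>x. f x * g x)"
proof (rule Bochner_Integration.integrable_bound)
  show "integrable lebesgue (\<lambda>x. (cmod (f x))\<^sup>2 + (cmod (g x))\<^sup>2)"
    using assms by (intro Bochner_Integration.integrable_add L2_integrable)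
  show "(\<lambda>x. f x * g x) \<in> borel_measurable lebesgue"
    using assms by (auto simp: L2_def)
  have "cmod (f x) * cmod (g x) \<le> (cmod (f x))\<^sup>2 + (cmod (g x))\<^sup>2" for x
    using sum_squares_bound[of "cmod (f x)" "cmod (g x)"]
      mult_nonneg_nonneg[OF norm_ge_zero[of "f x"] norm_ge_zero[of "g x"]] by linarith
  then show "AE x in lebesgue. norm (f x * g x) \<le> norm ((cmod (f x))\<^sup>2 + (cmod (g x))\<^sup>2)"
    by (auto simp: norm_mult)
qed

lemma L2_Cauchy_Schwarz:
  assumes f: "f \<in> L2" and g: "g \<in> L2"
  shows "(LINT x|lebesgue. cmod (f x) * cmod (g x)) \<le> L2norm f * L2norm g"
proof -
  have [measurable]: "f \<in> borel_measurable lebesgue" "g \<in> borel_measurable lebesgue"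
    using f g by (auto simp: L2_def)
  let ?I = "LINT x|lebesgue. cmod (f x) * cmod (g x)"
  have int: "integrable lebesgue (\<lambda>x. cmod (f x) * cmod (g x))"
    using integrable_norm[OF L2_times_integrable[OF f g]] by (simp add: norm_mult)
  have nn: "(\<integral>\<^sup>+x. ennreal (cmod (f x)) * ennreal (cmod (g x)) \<partial>lebesgue) = ennreal ?I"
    using nn_integral_eq_integral[OF int] by (simp add: ennreal_mult)
  have "(ennreal ?I)\<^sup>2 \<le> (\<integral>\<^sup>+x. (ennreal (cmod (f x)))\<^sup>2 \<partial>lebesgue) * (\<integral>\<^sup>+x. (ennreal (cmod (g x)))\<^sup>2 \<partial>lebesgue)"
    unfolding nn[symmetric] by (rule Cauchy_Schwarz_nn_integral) auto
  also have "\<dots> = ennreal ((L2norm f * L2norm g)\<^sup>2)"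
    using nn_integral_L2norm[OF f] nn_integral_L2norm[OF g]
    by (simp add: ennreal_power power_mult_distrib ennreal_mult)
  finally have "?I\<^sup>2 \<le> (L2norm f * L2norm g)\<^sup>2"
    by (simp add: ennreal_power)
  then show ?thesis
    by (rule power2_le_imp_le) simp
qed

lemma L2_inner_le:
  assumes f: "f \<in> L2" and g: "g \<in> L2"
  shows "cmod (LINT x|lebesgue. f x * g x) \<le> L2norm f * L2norm g"
  using integral_norm_bound[of lebesgue "\<lambda>x. f x * g x"] L2_Cauchy_Schwarz[OF assms]
  by (simp add: norm_mult)

lemma L2_add:
  assumes f: "f \<in> L2" and g: "g \<in> L2"
  shows "(\<lambda>x. f x + g x) \<in> L2" "L2norm (\<lambda>x. f x + g x) \<le> L2norm f + L2norm g"
proof -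
  have [measurable]: "f \<in> borel_measurable lebesgue" "g \<in> borel_measurable lebesgue"
    using f g by (auto simp: L2_def)
  let ?h = "\<lambda>x. (cmod (f x))\<^sup>2 + 2 * (cmod (f x) * cmod (g x)) + (cmod (g x))\<^sup>2"
  have ifg: "integrable lebesgue (\<lambda>x. cmod (f x) * cmod (g x))"
    using integrable_norm[OF L2_times_integrable[OF f g]] by (simp add: norm_mult)
  have int: "integrable lebesgue ?h"
    using L2_integrable[OF f] L2_integrable[OF g] ifg by auto
  have le: "(cmod (f x + g x))\<^sup>2 \<le> ?h x" for x
  proof -
    have "(cmod (f x + g x))\<^sup>2 \<le> (cmod (f x) + cmod (g x))\<^sup>2"
      by (intro power_mono norm_triangle_ineq) auto
    then show ?thesis by (simp add: power2_sum algebra_simps)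
  qed
  show *: "(\<lambda>x. f x + g x) \<in> L2"
    unfolding L2_def using le by (auto intro!: Bochner_Integration.integrable_bound[OF int])
  have "(L2norm (\<lambda>x. f x + g x))\<^sup>2 \<le> (LINT x|lebesgue. ?h x)"
    unfolding L2norm_square by (rule integral_mono[OF L2_integrable[OF *] int le])
  also have "\<dots> = (L2norm f)\<^sup>2 + 2 * (LINT x|lebesgue. cmod (f x) * cmod (g x)) + (L2norm g)\<^sup>2"
    unfolding L2norm_square using L2_integrable[OF f] L2_integrable[OF g] ifg by simp
  also have "\<dots> \<le> (L2norm f + L2norm g)\<^sup>2"
    using L2_Cauchy_Schwarz[OF f g] by (simp add: power2_sum algebra_simps)
  finally show "L2norm (\<lambda>x. f x + g x) \<le> L2norm f + L2norm g"
    by (rule power2_le_imp_le) (simp add: add_nonneg_nonneg)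
qed

lemma L2_diff:
  assumes f: "f \<in> L2" and g: "g \<in> L2"
  shows "(\<lambda>x. f x - g x) \<in> L2" "L2norm (\<lambda>x. f x - g x) \<le> L2norm f + L2norm g"
  using L2_add[OF f L2_scale[OF g, of "-1"]] L2norm_scale[of "-1" g] by simp_all

lemma L2norm_triangle_diff:
  assumes "f \<in> L2" "g \<in> L2" "h \<in> L2"
  shows "L2norm (\<lambda>x. f x - h x) \<le> L2norm (\<lambda>x. f x - g x) + L2norm (\<lambda>x. g x - h x)"
  using L2_add(2)[OF L2_diff(1)[OF assms(1,2)] L2_diff(1)[OF assms(2,3)]] by simp

lemma L2norm_diff_ineq:
  assumes f: "f \<in> L2" and g: "g \<in> L2"
  shows "\<bar>L2norm f - L2norm g\<bar> \<le> L2norm (\<lambda>x. f x - g x)"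
  using L2_add(2)[OF L2_diff(1)[OF f g] g] L2_add(2)[OF L2_diff(1)[OF g f] f]
  by (simp add: L2norm_minus_commute[of f g])

lemma L2norm_eq_0:
  assumes "f \<in> L2" "L2norm f = 0"
  shows "AE x in lebesgue. f x = 0"
  using integral_nonneg_eq_0_iff_AE[OF L2_integrable[OF assms(1)]] assms(2)
  by (simp add: L2norm_def)

lemma L2norm_diff_eq_0:
  assumes "f \<in> L2" "g \<in> L2" "L2norm (\<lambda>x. f x - g x) = 0"
  shows "AE x in lebesgue. f x = g x"
  using L2norm_eq_0[OF L2_diff(1)[OF assms(1,2)] assms(3)] by simp

lemma L2_tendsto_unique:
  assumes UV: "L2_tendsto U V F" and UW: "L2_tendsto U W F" and F: "F \<noteq> bot"
  shows "AE x in lebesgue. V x = W x"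
proof (rule L2norm_diff_eq_0)
  show V: "V \<in> L2" and W: "W \<in> L2"
    using UV UW by (auto simp: L2_tendsto_def)
  have "((\<lambda>h. L2norm (\<lambda>x. U h x - V x) + L2norm (\<lambda>x. U h x - W x)) \<longlongrightarrow> 0 + 0) F"
    using UV UW by (intro tendsto_add) (auto simp: L2_tendsto_def)
  moreover have "\<forall>\<^sub>F h in F. U h \<in> L2"
    using UV by (simp add: L2_tendsto_def)
  then have "\<forall>\<^sub>F h in F. L2norm (\<lambda>x. V x - W x) \<le> L2norm (\<lambda>x. U h x - V x) + L2norm (\<lambda>x. U h x - W x)"
    by eventually_elim (use L2norm_triangle_diff[OF V _ W] L2norm_minus_commute[of V] in auto)
  ultimately have "L2norm (\<lambda>x. V x - W x) \<le> 0 + 0"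
    using F by (rule tendsto_lowerbound)
  then show "L2norm (\<lambda>x. V x - W x) = 0"
    using L2norm_nonneg[of "\<lambda>x. V x - W x"] by linarith
qed

lemma L2_tendsto_norm:
  assumes "L2_tendsto U V F"
  shows "((\<lambda>h. L2norm (U h)) \<longlongrightarrow> L2norm V) F"
proof (subst Lim_null)
  have V: "V \<in> L2" and U: "\<forall>\<^sub>F h in F. U h \<in> L2"
    using assms by (auto simp: L2_tendsto_def)
  have "\<forall>\<^sub>F h in F. norm (L2norm (U h) - L2norm V) \<le> L2norm (\<lambda>x. U h x - V x)"
    using U by eventually_elim (subst real_norm_def, rule L2norm_diff_ineq[OF _ V])
  then show "((\<lambda>h. L2norm (U h) - L2norm V) \<longlongrightarrow> 0) F"
    by (rule Lim_null_comparison) (use assms in \<open>auto simp: L2_tendsto_def\<close>)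
qed

lemma L2_tendsto_add:
  assumes U: "L2_tendsto U V F" and W: "L2_tendsto W Y F"
  shows "L2_tendsto (\<lambda>h x. U h x + W h x) (\<lambda>x. V x + Y x) F"
proof -
  have ev: "\<forall>\<^sub>F h in F. U h \<in> L2 \<and> W h \<in> L2"
    using U W by (auto simp: L2_tendsto_def eventually_conj_iff)
  have VY: "V \<in> L2" "Y \<in> L2" using U W by (auto simp: L2_tendsto_def)
  have "\<forall>\<^sub>F h in F. norm (L2norm (\<lambda>x. (U h x + W h x) - (V x + Y x)))
      \<le> L2norm (\<lambda>x. U h x - V x) + L2norm (\<lambda>x. W h x - Y x)"
    using ev
  proof eventually_elim
    case (elim h)
    then show ?case
      using L2_add(2)[OF L2_diff(1)[of "U h" V] L2_diff(1)[of "W h" Y]] VY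
      by (simp add: algebra_simps)
  qed
  moreover have "((\<lambda>h. L2norm (\<lambda>x. U h x - V x) + L2norm (\<lambda>x. W h x - Y x)) \<longlongrightarrow> 0) F"
    using tendsto_add[of _ 0 F _ 0] U W by (auto simp: L2_tendsto_def)
  ultimately have "((\<lambda>h. L2norm (\<lambda>x. (U h x + W h x) - (V x + Y x))) \<longlongrightarrow> 0) F"
    by (rule Lim_null_comparison)
  moreover have "\<forall>\<^sub>F h in F. (\<lambda>x. U h x + W h x) \<in> L2"
    using ev by eventually_elim (auto intro: L2_add)
  ultimately show ?thesis
    using VY by (auto simp: L2_tendsto_def intro: L2_add)
qed

lemma L2_tendsto_scale:
  assumes "L2_tendsto U V F"
  shows "L2_tendsto (\<lambda>h x. c * U h x) (\<lambda>x. c * V x) F"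
proof -
  have "((\<lambda>h. cmod c * L2norm (\<lambda>x. U h x - V x)) \<longlongrightarrow> cmod c * 0) F"
    using assms by (intro tendsto_mult tendsto_const) (auto simp: L2_tendsto_def)
  moreover have "\<forall>\<^sub>F h in F. (\<lambda>x. c * U h x) \<in> L2"
    using assms unfolding L2_tendsto_def by (auto elim!: eventually_mono intro: L2_scale)
  ultimately show ?thesis
    using assms
    by (auto simp: L2_tendsto_def L2_scale L2norm_scale[symmetric] right_diff_distrib)
qed

lemma L2_tendsto_cong_limit:
  assumes "L2_tendsto U V F" "AE x in lebesgue. V x = W x"
  shows "L2_tendsto U W F"
proof -
  have W: "W \<in> L2" using L2_cong_AE(1)[OF _ assms(2)] assms(1) by (auto simp: L2_tendsto_def)
  have *: "\<forall>\<^sub>F h in F. U h \<in> L2" and V: "V \<in> L2"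
    and lim: "((\<lambda>h. L2norm (\<lambda>x. U h x - V x)) \<longlongrightarrow> 0) F"
    using assms(1) by (auto simp: L2_tendsto_def)
  have "\<forall>\<^sub>F h in F. L2norm (\<lambda>x. U h x - V x) = L2norm (\<lambda>x. U h x - W x)"
    using *
  proof eventually_elim
    case (elim h)
    show ?case
      by (rule L2_cong_AE(2)[symmetric]) (use elim V assms(2) in \<open>auto intro: L2_diff\<close>)
  qed
  with lim have "((\<lambda>h. L2norm (\<lambda>x. U h x - W x)) \<longlongrightarrow> 0) F"
    by (rule Lim_transform_eventually)
  then show ?thesis using * W by (auto simp: L2_tendsto_def)
qed

lemma L2_dominated_convergence:
  fixes U :: "nat \<Rightarrow> 'a::euclidean_space \<Rightarrow> complex"
  assumes [measurable]: "\<And>k. U k \<in> borel_measurable lebesgue"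
    and G: "integrable lebesgue G" 
    and bound: "\<And>k. AE x in lebesgue. (cmod (U k x))\<^sup>2 \<le> G x"
    and lim: "AE x in lebesgue. (\<lambda>k. U k x) \<longlonglongrightarrow> 0"
  shows "(\<lambda>k. L2norm (U k)) \<longlonglongrightarrow> 0"
proof -
  have "(\<lambda>k. LINT x|lebesgue. (cmod (U k x))\<^sup>2) \<longlonglongrightarrow> (LINT x|(lebesgue :: 'a measure). 0)"
  proof (rule integral_dominated_convergence[where w=G])
    show "AE x in lebesgue. (\<lambda>k. (cmod (U k x))\<^sup>2) \<longlonglongrightarrow> 0"
      using lim by eventually_elim (auto intro!: tendsto_eq_intros)
  qed (use G bound in auto)
  then have "(\<lambda>k. sqrt (LINT x|lebesgue. (cmod (U k x))\<^sup>2)) \<longlonglongrightarrow> sqrt 0"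
    by (intro tendsto_real_sqrt) simp
  then show ?thesis by (simp add: L2norm_def)
qed

text \<open>The pointwise half of the Riesz--Fischer theorem. The weights \<open>2^k\<close> turn summability of the
  squared increments into geometric decay of the increments at almost every point.\<close>

lemma L2_fast_Cauchy_AE_convergent:
  fixes U :: "nat \<Rightarrow> 'a::euclidean_space \<Rightarrow> complex"
  assumes U: "\<And>k. U k \<in> L2" and inc: "\<And>k. L2norm (\<lambda>x. U (Suc k) x - U k x) \<le> (1/2)^k"
  shows "AE x in lebesgue. convergent (\<lambda>k. U k x)"
proof -
  let ?D = "\<lambda>k x. U (Suc k) x - U k x"
  have [measurable]: "U k \<in> borel_measurable lebesgue" for k
    using U by (simp add: L2_def)
  have D: "?D k \<in> L2" for k using U by (intro L2_diff)
  have "(\<integral>\<^sup>+x. (\<Sum>k. ennreal (2^k * (cmod (?D k x))\<^sup>2)) \<partial>lebesgue)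
      = (\<Sum>k. \<integral>\<^sup>+x. ennreal (2^k) * ennreal ((cmod (?D k x))\<^sup>2) \<partial>lebesgue)"
    by (subst nn_integral_suminf) (auto simp: ennreal_mult)
  also have "\<dots> = (\<Sum>k. ennreal (2^k * (L2norm (?D k))\<^sup>2))"
    by (subst nn_integral_cmult) (auto simp: nn_integral_L2norm[OF D] ennreal_mult)
  also have "\<dots> \<le> (\<Sum>k. ennreal ((1/2)^k))"
  proof (intro suminf_le summableI ennreal_leI)
    fix k
    have "2^k * (L2norm (?D k))\<^sup>2 \<le> 2^k * ((1/2)^k)\<^sup>2"
      using inc[of k] by (intro mult_left_mono power_mono) auto
    also have "\<dots> = (1/2)^k"
      by (simp add: power2_eq_square field_simps)
    finally show "2^k * (L2norm (?D k))\<^sup>2 \<le> (1/2)^k" .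
  qed
  also have "\<dots> < \<infinity>"
    by (subst suminf_ennreal2) auto
  finally have "AE x in lebesgue. (\<Sum>k. ennreal (2^k * (cmod (?D k x))\<^sup>2)) \<noteq> \<infinity>"
    by (intro nn_integral_PInf_AE) auto
  then show ?thesis
  proof eventually_elim
    case (elim x)
    have "summable (\<lambda>k. 2^k * (cmod (?D k x))\<^sup>2)"
      by (rule summable_suminf_not_top) (use elim in auto)
    then have "Bseq (\<lambda>k. 2^k * (cmod (?D k x))\<^sup>2)"
      by (intro convergent_imp_Bseq) (auto dest: summable_LIMSEQ_zero simp: convergent_def)
    then obtain C where C: "C > 0" "\<And>k. 2^k * (cmod (?D k x))\<^sup>2 \<le> C"
      by (auto simp: Bseq_def)
    have le: "cmod (?D k x) \<le> sqrt C * (sqrt (1/2))^k" for k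
    proof -
      have "(cmod (?D k x))\<^sup>2 \<le> C * (1/2)^k"
        using C(2)[of k] by (simp add: field_simps)
      then have "cmod (?D k x) \<le> sqrt (C * (1/2)^k)"
        by (rule real_le_rsqrt)
      then show ?thesis by (simp only: real_sqrt_mult real_sqrt_power)
    qed
    have "summable (\<lambda>k. sqrt C * (sqrt (1/2))^k)"
      by (intro summable_mult summable_geometric) (simp add: real_sqrt_divide)
    then have "summable (\<lambda>k. ?D k x)"
      by (rule summable_comparison_test'[where N=0]) (rule le)
    then have "convergent (\<lambda>k. U k x - U 0 x)"
      unfolding summable_iff_convergent by (simp only: sum_lessThan_telescope[of "\<lambda>k. U k x"])
    then show "convergent (\<lambda>k. U k x)"
      using convergent_add[OF _ convergent_const[of "U 0 x"]] by fastforce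
  qed
qed

text \<open>Fatou's lemma: bounds survive almost everywhere limits.\<close>

lemma L2_Fatou:
  fixes U :: "nat \<Rightarrow> 'a::euclidean_space \<Rightarrow> complex"
  assumes U: "\<And>k. U k \<in> L2" and lim: "AE x in lebesgue. (\<lambda>k. U k x) \<longlonglongrightarrow> V x"
    and V [measurable]: "V \<in> borel_measurable lebesgue"
    and bound: "\<forall>\<^sub>F k in sequentially. L2norm (U k) \<le> B"
  shows "V \<in> L2" "L2norm V \<le> B"
proof -
  have B: "B \<ge> 0"
    using eventually_happens[OF bound] L2norm_nonneg[of "U _"] by (auto intro: order_trans[rotated])
  have [measurable]: "U k \<in> borel_measurable lebesgue" for k
    using U by (simp add: L2_def)
  have "(\<integral>\<^sup>+x. ennreal ((cmod (V x))\<^sup>2) \<partial>lebesgue)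
      = (\<integral>\<^sup>+x. liminf (\<lambda>k. ennreal ((cmod (U k x))\<^sup>2)) \<partial>lebesgue)"
  proof (rule nn_integral_cong_AE, use lim in eventually_elim)
    case (elim x)
    then have "(\<lambda>k. ennreal ((cmod (U k x))\<^sup>2)) \<longlonglongrightarrow> ennreal ((cmod (V x))\<^sup>2)"
      by (intro tendsto_ennrealI tendsto_intros)
    then show ?case
      using lim_imp_Liminf[OF sequentially_bot] by metis
  qed
  also have "\<dots> \<le> liminf (\<lambda>k. \<integral>\<^sup>+x. ennreal ((cmod (U k x))\<^sup>2) \<partial>lebesgue)"
    by (rule nn_integral_liminf) auto
  also have "\<dots> \<le> liminf (\<lambda>k. ennreal (B\<^sup>2))"
    by (rule Liminf_mono, use bound in eventually_elim)
       (auto simp: nn_integral_L2norm[OF U] intro!: ennreal_leI power_mono)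
  also have "\<dots> = ennreal (B\<^sup>2)"
    by (rule Liminf_const) simp
  finally show "V \<in> L2" "L2norm V \<le> B"
    using L2norm_le_nn_integral[OF _ B V] by auto
qed

text \<open>A rapidly converging subsequence has a pointwise limit. Fatou's lemma bounds the distance of that
  limit from every late term of the sequence, not only from those of the subsequence.\<close>

lemma L2_complete:
  fixes U :: "nat \<Rightarrow> 'a::euclidean_space \<Rightarrow> complex"
  assumes U: "\<And>k. U k \<in> L2"
    and Cauchy: "\<And>e. e > 0 \<Longrightarrow> \<exists>N. \<forall>m\<ge>N. \<forall>n\<ge>N. L2norm (\<lambda>x. U m x - U n x) < e"
  shows "\<exists>V. L2_tendsto U V sequentially"
proof -
  have "\<exists>N. \<forall>k. (\<forall>m\<ge>N k. \<forall>n\<ge>N k. L2norm (\<lambda>x. U m x - U n x) < (1/2)^k) \<and> N k < N (Suc k)"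
  proof (rule dependent_nat_choice)
    fix x k
    obtain M where "\<forall>m\<ge>M. \<forall>n\<ge>M. L2norm (\<lambda>x. U m x - U n x) < (1/2)^Suc k"
      using Cauchy[of "(1/2)^Suc k"] by auto
    then show "\<exists>y. (\<forall>m\<ge>y. \<forall>n\<ge>y. L2norm (\<lambda>x. U m x - U n x) < (1/2)^Suc k) \<and> x < y"
      by (intro exI[of _ "max M (Suc x)"]) auto
  qed (use Cauchy[of 1] in auto)
  then obtain N where N: "\<And>k m n. m \<ge> N k \<Longrightarrow> n \<ge> N k \<Longrightarrow> L2norm (\<lambda>x. U m x - U n x) < (1/2)^k"
      and "\<And>k. N k < N (Suc k)"
    by blast
  then have mono: "strict_mono N" by (simp add: strict_mono_Suc_iff)
  have "L2norm (\<lambda>x. U (N (Suc k)) x - U (N k) x) \<le> (1/2)^k" for k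
    using N[of k "N (Suc k)" "N k"] strict_mono_less_eq[OF mono, of k "Suc k"] by auto
  then have conv: "AE x in lebesgue. convergent (\<lambda>k. U (N k) x)"
    using L2_fast_Cauchy_AE_convergent[of "\<lambda>k. U (N k)"] U by auto
  have [measurable]: "U k \<in> borel_measurable lebesgue" for k
    using U by (simp add: L2_def)
  define V where "V x = lim (\<lambda>k. U (N k) x)" for x
  have V [measurable]: "V \<in> borel_measurable lebesgue"
    unfolding V_def by (rule borel_measurable_lim_metric) auto
  have lim: "AE x in lebesgue. (\<lambda>k. U (N k) x) \<longlonglongrightarrow> V x"
    using conv by eventually_elim (simp add: V_def convergent_LIMSEQ_iff)
  have diff: "(\<lambda>x. V x - U m x) \<in> L2 \<and> L2norm (\<lambda>x. V x - U m x) \<le> (1/2)^k" if "m \<ge> N k" for m k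
  proof -
    have "\<forall>\<^sub>F i in sequentially. L2norm (\<lambda>x. U (N i) x - U m x) \<le> (1/2)^k"
      using eventually_ge_at_top[of k]
      by eventually_elim
         (use N[of k] that mono in \<open>auto intro!: less_imp_le simp: strict_mono_less_eq\<close>)
    moreover have "AE x in lebesgue. (\<lambda>i. U (N i) x - U m x) \<longlonglongrightarrow> V x - U m x"
      using lim by eventually_elim (intro tendsto_intros)
    ultimately show ?thesis
      using L2_Fatou[of "\<lambda>i x. U (N i) x - U m x" "\<lambda>x. V x - U m x" "(1/2)^k"] U
      by (auto intro: L2_diff)
  qed
  have "V \<in> L2"
    using L2_add(1)[OF conjunct1[OF diff[OF order_refl, of 0]] U[of "N 0"]] by simp
  moreover have "(\<lambda>m. L2norm (\<lambda>x. U m x - V x)) \<longlonglongrightarrow> 0"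
  proof (rule LIMSEQ_I)
    fix r :: real assume "r > 0"
    then obtain k where k: "(1/2)^k < r"
      using real_arch_pow_inv[of r "1/2"] by auto
    show "\<exists>no. \<forall>m\<ge>no. norm (L2norm (\<lambda>x. U m x - V x) - 0) < r"
      using diff[of k] k by (intro exI[of _ "N k"]) (auto simp: L2norm_minus_commute intro: le_less_trans)
  qed
  ultimately show ?thesis
    using U by (auto simp: L2_tendsto_def)
qed

section \<open>Affine changes of variables\<close>

lemma lborel_integral_affine:
  fixes f :: "'a::euclidean_space \<Rightarrow> 'b::{banach, second_countable_topology}"
  assumes [measurable]: "f \<in> borel_measurable borel" and c: "c \<noteq> 0"
  shows "(LINT x|lborel. f (t + c *\<^sub>R x)) = (1 / \<bar>c\<bar>^DIM('a)) *\<^sub>R (LINT x|lborel. f x)"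
    and "integrable lborel (\<lambda>x. f (t + c *\<^sub>R x)) \<longleftrightarrow> integrable lborel f"
proof -
  have "(LINT x|lborel. f x) = (LINT x|density (distr lborel borel (\<lambda>x. t + c *\<^sub>R x)) (\<lambda>_. ennreal (\<bar>c\<bar>^DIM('a))). f x)"
    by (subst lborel_affine[OF c, of t]) simp
  also have "\<dots> = (\<bar>c\<bar>^DIM('a)) *\<^sub>R (LINT x|lborel. f (t + c *\<^sub>R x))"
    by (subst integral_density) (auto simp: integral_distr)
  finally show "(LINT x|lborel. f (t + c *\<^sub>R x)) = (1 / \<bar>c\<bar>^DIM('a)) *\<^sub>R (LINT x|lborel. f x)"
    using c by simp
  have "integrable lborel f \<longleftrightarrow> integrable (density (distr lborel borel (\<lambda>x. t + c *\<^sub>R x)) (\<lambda>_. ennreal (\<bar>c\<bar>^DIM('a)))) f"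
    by (subst lborel_affine[OF c, of t]) simp
  also have "\<dots> \<longleftrightarrow> integrable lborel (\<lambda>x. f (t + c *\<^sub>R x))"
  proof -
    have "integrable lborel (\<lambda>x. f (t + c *\<^sub>R x))"
      if "integrable lborel (\<lambda>x. \<bar>c\<bar>^DIM('a) *\<^sub>R f (t + c *\<^sub>R x))"
      using integrable_scaleR_right[OF that, of "1 / \<bar>c\<bar>^DIM('a)"] c by simp
    then show ?thesis
      using c by (subst integrable_density) (auto simp: integrable_distr_eq)
  qed
  finally show "integrable lborel (\<lambda>x. f (t + c *\<^sub>R x)) \<longleftrightarrow> integrable lborel f" by simp
qed

lemma borel_measurable_cis [measurable]: "cis \<in> borel_measurable borel"
  by (intro borel_measurable_continuous_onI continuous_intros)

section \<open>The Gaussian\<close>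

definition gaussian :: "'a::euclidean_space \<Rightarrow> real" where
  "gaussian x = exp (- (norm x)\<^sup>2 / 2)"

lemma gaussian_measurable [measurable]: "gaussian \<in> borel_measurable borel"
  unfolding gaussian_def by measurable

lemma gaussian_bounds: "0 < gaussian x" "0 \<le> gaussian x" "gaussian x \<le> 1"
  by (auto simp: gaussian_def)

text \<open>The Gaussian and the character are products over the coordinates, so the integral is a product of
  values of the characteristic function of the standard normal distribution.\<close>

lemma integral_cis_gaussian:
  fixes \<xi> :: "'a::euclidean_space"
  shows "integrable lborel (\<lambda>x. cis (x \<bullet> \<xi>) * complex_of_real (gaussian x))" (is ?I)
    and "(LINT x|lborel. cis (x \<bullet> \<xi>) * complex_of_real (gaussian x))
           = complex_of_real (sqrt (2 * pi) ^ DIM('a) * gaussian \<xi>)" (is "?L = ?R")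
proof -
  define g where "g b y = cis (y * (\<xi> \<bullet> b)) * complex_of_real (exp (- y\<^sup>2 / 2))" for b :: 'a and y :: real
  have g_eq: "g b y = sqrt (2 * pi) * (std_normal_density y *\<^sub>R iexp ((\<xi> \<bullet> b) * y))" for b y
    unfolding g_def std_normal_density_def cis_conv_exp
    by (simp add: scaleR_conv_of_real mult_ac)
  have int1: "integrable lborel (g b)" for b
  proof -
    have "integrable lborel (\<lambda>y. std_normal_density y *\<^sub>R iexp ((\<xi> \<bullet> b) * y))"
      by (rule Bochner_Integration.integrable_bound[OF integrable_normal_density[of 1 0]])
         (auto simp: norm_mult)
    then show ?thesis unfolding g_eq[abs_def] by (rule integrable_mult_right)
  qed
  have val1: "(LINT y|lborel. g b y) = complex_of_real (sqrt (2 * pi) * exp (- (\<xi> \<bullet> b)\<^sup>2 / 2))" for b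
  proof -
    have "char std_normal_distribution (\<xi> \<bullet> b) = (LINT y|lborel. std_normal_density y *\<^sub>R iexp ((\<xi> \<bullet> b) * y))"
      unfolding char_def by (subst integral_density) auto
    then show ?thesis
      unfolding g_eq[abs_def] integral_mult_right_zero char_std_normal_distribution
      by (metis of_real_mult)
  qed
  interpret product_sigma_finite "\<lambda>_::'a. lborel :: real measure"
    by standard
  let ?P = "\<Pi>\<^sub>M b\<in>(Basis::'a set). (lborel :: real measure)"
  let ?T = "\<lambda>f. \<Sum>b\<in>Basis. f b *\<^sub>R (b::'a)"
  have T [measurable]: "?T \<in> ?P \<rightarrow>\<^sub>M borel"
    by measurable
  have comp: "cis (?T f \<bullet> \<xi>) * complex_of_real (gaussian (?T f)) = (\<Prod>b\<in>Basis. g b (f b))" for f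
  proof -
    have 1: "?T f \<bullet> \<xi> = (\<Sum>b\<in>Basis. f b * (\<xi> \<bullet> b))"
      by (simp only: inner_sum_left inner_scaleR_left) (simp add: inner_commute)
    have 2: "- (norm (?T f))\<^sup>2 / 2 = (\<Sum>b\<in>Basis. - (f b)\<^sup>2 / 2)"
    proof -
      have "(norm (?T f))\<^sup>2 = (\<Sum>b\<in>Basis. (f b)\<^sup>2)"
        by (subst power2_norm_eq_inner, subst euclidean_inner)
           (simp add: power2_eq_square inner_sum_left_Basis)
      then show ?thesis by (simp add: sum_divide_distrib sum_negf)
    qed
    have "cis (\<Sum>b\<in>Basis. f b * (\<xi> \<bullet> b)) = (\<Prod>b\<in>Basis. cis (f b * (\<xi> \<bullet> b)))"
      unfolding cis_conv_exp by (simp add: sum_distrib_left exp_sum)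
    then show ?thesis
      unfolding 1 gaussian_def 2 g_def
      by (simp add: exp_sum prod.distrib)
  qed
  have int2: "integrable ?P (\<lambda>f. \<Prod>b\<in>Basis. g b (f b))"
    by (rule product_integrable_prod) (auto intro: int1)
  show ?I
    by (subst lborel_eq, subst integrable_distr_eq) (auto simp: comp int2)
  have "?L = (\<integral>f. (\<Prod>b\<in>Basis. g b (f b)) \<partial>?P)"
    by (subst lborel_eq, subst integral_distr) (auto simp: comp)
  also have "\<dots> = (\<Prod>b\<in>Basis. (LINT y|lborel. g b y))"
    by (rule product_integral_prod) (auto intro: int1)
  also have "\<dots> = complex_of_real (\<Prod>b\<in>(Basis::'a set). sqrt (2 * pi) * exp (- (\<xi> \<bullet> b)\<^sup>2 / 2))"
    by (simp add: val1)
  also have "(\<Prod>b\<in>(Basis::'a set). sqrt (2 * pi) * exp (- (\<xi> \<bullet> b)\<^sup>2 / 2)) = sqrt (2 * pi) ^ DIM('a) * gaussian \<xi>"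
  proof -
    have "- (norm \<xi>)\<^sup>2 / 2 = (\<Sum>b\<in>Basis. - (\<xi> \<bullet> b)\<^sup>2 / 2)"
    proof -
      have "(norm \<xi>)\<^sup>2 = (\<Sum>b\<in>Basis. (\<xi> \<bullet> b)\<^sup>2)"
        by (subst power2_norm_eq_inner, subst euclidean_inner) (simp add: power2_eq_square)
      then show ?thesis by (simp add: sum_divide_distrib sum_negf)
    qed
    then show ?thesis by (simp add: prod.distrib gaussian_def exp_sum)
  qed
  finally show "?L = ?R" .
qed

lemma integrable_gaussian: "integrable lborel (gaussian :: 'a::euclidean_space \<Rightarrow> real)"
  and integral_gaussian: "(LINT x|lborel. gaussian (x::'a)) = sqrt (2 * pi) ^ DIM('a)"
proof -
  have "integrable lborel (\<lambda>x::'a. complex_of_real (gaussian x))"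
    using integral_cis_gaussian(1)[of "0::'a"] by simp
  then show *: "integrable lborel (gaussian :: 'a \<Rightarrow> real)"
    using integrable_Re by fastforce
  have "complex_of_real (LINT x|lborel. gaussian (x::'a)) = complex_of_real (sqrt (2 * pi) ^ DIM('a))"
    using integral_cis_gaussian(2)[of "0::'a"] by (simp add: gaussian_def)
  then show "(LINT x|lborel. gaussian (x::'a)) = sqrt (2 * pi) ^ DIM('a)"
    using of_real_eq_iff by blast
qed

section \<open>Continuity of translation in the mean square\<close>

text \<open>Borel functions are used because their translates are measurable for trivial reasons; sequences of
  translations suffice for dominated convergence.\<close>

definition translation_continuous :: "('a::euclidean_space \<Rightarrow> complex) \<Rightarrow> bool" where
  "translation_continuous f \<longleftrightarrow> f \<in> borel_measurable borel \<and> f \<in> L2 \<and>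
     (\<forall>z. z \<longlonglongrightarrow> 0 \<longrightarrow> (\<lambda>k. L2norm (\<lambda>x. f (x - z k) - f x)) \<longlonglongrightarrow> 0)"

lemma borel_imp_lebesgue: "f \<in> borel_measurable borel \<Longrightarrow> f \<in> borel_measurable lebesgue"
  by (rule measurable_completion) simp

lemma L2_borel_iff:
  assumes "f \<in> borel_measurable borel"
  shows "f \<in> L2 \<longleftrightarrow> integrable lborel (\<lambda>x. (cmod (f x))\<^sup>2)"
  using assms by (auto simp: L2_def borel_imp_lebesgue integrable_completion)

lemma L2norm_borel:
  assumes "f \<in> borel_measurable borel"
  shows "L2norm f = sqrt (LINT x|lborel. (cmod (f x))\<^sup>2)"
  unfolding L2norm_def using assms by (subst integral_completion) auto

lemma L2norm_square_borel:
  assumes "f \<in> borel_measurable borel"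
  shows "(L2norm f)\<^sup>2 = (LINT x|lborel. (cmod (f x))\<^sup>2)"
  unfolding L2norm_square using assms by (subst integral_completion) auto

lemma L2_translate:
  fixes f :: "'a::euclidean_space \<Rightarrow> complex"
  assumes f [measurable]: "f \<in> borel_measurable borel" and L2: "f \<in> L2"
  shows "(\<lambda>x. f (x - z)) \<in> L2" "L2norm (\<lambda>x. f (x - z)) = L2norm f"
  using L2 lborel_integral_affine[of "\<lambda>x. (cmod (f x))\<^sup>2" 1 "- z"]
  by (simp_all add: L2_borel_iff L2norm_borel)

lemma translation_continuous_add:
  assumes f: "translation_continuous f" and g: "translation_continuous g"
  shows "translation_continuous (\<lambda>x. f x + g x)"
  unfolding translation_continuous_def
proof (intro conjI allI impI)
  note fg = f[unfolded translation_continuous_def] g[unfolded translation_continuous_def]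
  have [measurable]: "f \<in> borel_measurable borel" "g \<in> borel_measurable borel" using fg by auto
  show "(\<lambda>x. f x + g x) \<in> borel_measurable borel" by measurable
  show "(\<lambda>x. f x + g x) \<in> L2" using fg by (auto intro: L2_add)
  fix z :: "nat \<Rightarrow> 'a" assume z: "z \<longlonglongrightarrow> 0"
  show "(\<lambda>k. L2norm (\<lambda>x. f (x - z k) + g (x - z k) - (f x + g x))) \<longlonglongrightarrow> 0"
  proof (rule Lim_null_comparison)
    have "L2norm (\<lambda>x. f (x - z k) + g (x - z k) - (f x + g x))
        \<le> L2norm (\<lambda>x. f (x - z k) - f x) + L2norm (\<lambda>x. g (x - z k) - g x)" for k
      using L2_add(2)[OF L2_diff(1)[OF L2_translate(1)[of f] , of f "z k"]
          L2_diff(1)[OF L2_translate(1)[of g] , of g "z k"]] fg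
      by (simp add: algebra_simps)
    then show "\<forall>\<^sub>F k in sequentially. norm (L2norm (\<lambda>x. f (x - z k) + g (x - z k) - (f x + g x)))
        \<le> L2norm (\<lambda>x. f (x - z k) - f x) + L2norm (\<lambda>x. g (x - z k) - g x)"
      by simp
    show "(\<lambda>k. L2norm (\<lambda>x. f (x - z k) - f x) + L2norm (\<lambda>x. g (x - z k) - g x)) \<longlonglongrightarrow> 0"
      using tendsto_add[of _ 0 sequentially _ 0] fg z by auto
  qed
qed

lemma translation_continuous_scale:
  assumes "translation_continuous f"
  shows "translation_continuous (\<lambda>x. c * f x)"
proof -
  have "(\<lambda>k. cmod c * L2norm (\<lambda>x. f (x - z k) - f x)) \<longlonglongrightarrow> cmod c * 0" if "z \<longlonglongrightarrow> 0" for z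
    using assms that by (intro tendsto_mult tendsto_const) (auto simp: translation_continuous_def)
  then show ?thesis
    using assms by (auto simp: translation_continuous_def L2_scale L2norm_scale[symmetric] right_diff_distrib)
qed

text \<open>Translations are isometries, so an approximation of a function approximates its translates equally well.\<close>

lemma translation_continuous_approx:
  assumes f [measurable]: "f \<in> borel_measurable borel" and L2: "f \<in> L2"
    and approx: "\<And>e. e > 0 \<Longrightarrow> \<exists>g. translation_continuous g \<and> L2norm (\<lambda>x. f x - g x) < e"
  shows "translation_continuous f"
  unfolding translation_continuous_def
proof (intro conjI allI impI f L2)
  fix z :: "nat \<Rightarrow> 'a" assume z: "z \<longlonglongrightarrow> 0"
  show "(\<lambda>k. L2norm (\<lambda>x. f (x - z k) - f x)) \<longlonglongrightarrow> 0"
  proof (rule LIMSEQ_I)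
    fix r :: real assume r: "r > 0"
    obtain g where g: "translation_continuous g" and fg: "L2norm (\<lambda>x. f x - g x) < r / 3"
      using approx[of "r/3"] r by auto
    have [measurable]: "g \<in> borel_measurable borel" and gL: "g \<in> L2"
      using g by (auto simp: translation_continuous_def)
    have "(\<lambda>k. L2norm (\<lambda>x. g (x - z k) - g x)) \<longlonglongrightarrow> 0"
      using g z by (auto simp: translation_continuous_def)
    from LIMSEQ_D[OF this, of "r/3"] r obtain N
      where N: "\<And>k. k \<ge> N \<Longrightarrow> L2norm (\<lambda>x. g (x - z k) - g x) < r / 3"
      by auto
    have "L2norm (\<lambda>x. f (x - z k) - f x) < r" if "k \<ge> N" for k
    proof -
      have "L2norm (\<lambda>x. f (x - z k) - f x) \<le> L2norm (\<lambda>x. f (x - z k) - g (x - z k)) + L2norm (\<lambda>x. g (x - z k) - f x)"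
        by (rule L2norm_triangle_diff) (auto intro: L2_translate L2 gL)
      also have "L2norm (\<lambda>x. g (x - z k) - f x) \<le> L2norm (\<lambda>x. g (x - z k) - g x) + L2norm (\<lambda>x. g x - f x)"
        by (rule L2norm_triangle_diff) (auto intro: L2_translate L2 gL)
      also have "L2norm (\<lambda>x. f (x - z k) - g (x - z k)) = L2norm (\<lambda>x. f x - g x)"
        using L2_translate(2)[of "\<lambda>x. f x - g x" "z k"] L2_diff(1)[OF L2 gL] by simp
      finally show ?thesis
        using N[OF that] fg by (simp add: L2norm_minus_commute[of g f])
    qed
    then show "\<exists>no. \<forall>k\<ge>no. norm (L2norm (\<lambda>x. f (x - z k) - f x) - 0) < r"
      by auto
  qed
qed

lemma L2_indicator:
  fixes A :: "'a::euclidean_space set"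
  assumes A: "A \<in> sets borel" "emeasure lborel A < \<infinity>"
  shows "(\<lambda>x. complex_of_real (indicat_real A x)) \<in> L2"
    and "(L2norm (\<lambda>x. complex_of_real (indicat_real A x)))\<^sup>2 = measure lborel A"
proof -
  have [measurable]: "A \<in> sets borel" by fact
  have sq: "(indicat_real A x)\<^sup>2 = indicat_real A x" for x
    by (simp add: indicator_def)
  have "integrable lborel (indicat_real A)"
    using A by (simp add: integrable_indicator_iff)
  then show "(\<lambda>x. complex_of_real (indicat_real A x)) \<in> L2"
    by (subst L2_borel_iff) (auto simp: sq)
  show "(L2norm (\<lambda>x. complex_of_real (indicat_real A x)))\<^sup>2 = measure lborel A"
    by (subst L2norm_borel) (auto simp: sq)
qed

text \<open>For an open set \<open>U\<close> the product \<open>1\<^sub>U(x - z) 1\<^sub>U(x)\<close> converges to \<open>1\<^sub>U(x)\<close> at every point as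
  \<open>z \<rightarrow> 0\<close>, even if the boundary of \<open>U\<close> has positive measure; the squared distance between the two
  indicators is twice the integral of the difference of these functions.\<close>

lemma translation_continuous_open:
  fixes U :: "'a::euclidean_space set"
  assumes U: "open U" and fin: "emeasure lborel U < \<infinity>"
  shows "translation_continuous (\<lambda>x. complex_of_real (indicat_real U x))"
  unfolding translation_continuous_def
proof (intro conjI allI impI)
  have [measurable]: "U \<in> sets borel" using U by auto
  show "(\<lambda>x. complex_of_real (indicat_real U x)) \<in> borel_measurable borel" by measurable
  show "(\<lambda>x. complex_of_real (indicat_real U x)) \<in> L2"
    using fin by (intro L2_indicator) auto
  fix z :: "nat \<Rightarrow> 'a" assume z: "z \<longlonglongrightarrow> 0"
  have iU: "integrable lborel (indicat_real U)"
    using fin by (simp add: integrable_indicator_iff)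
  have iUz: "integrable lborel (\<lambda>x. indicat_real U (x - w))"
      "(LINT x|lborel. indicat_real U (x - w)) = (LINT x|lborel. indicat_real U x)" for w
    using lborel_integral_affine[of "indicat_real U" 1 "-w"] iU by (simp_all del: integral_indicator)
  have lim: "(\<lambda>k. LINT x|lborel. indicat_real U (x - z k) * indicat_real U x) \<longlonglongrightarrow> (LINT x|lborel. indicat_real U x)"
  proof (rule integral_dominated_convergence[where w="indicat_real U"])
    show "AE x in lborel. (\<lambda>k. indicat_real U (x - z k) * indicat_real U x) \<longlonglongrightarrow> indicat_real U x"
    proof (rule AE_I2)
      fix x :: 'a
      show "(\<lambda>k. indicat_real U (x - z k) * indicat_real U x) \<longlonglongrightarrow> indicat_real U x"
      proof (cases "x \<in> U")
        case True
        have "(\<lambda>k. x - z k) \<longlonglongrightarrow> x - 0" by (intro tendsto_intros z)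
        then have "\<forall>\<^sub>F k in sequentially. x - z k \<in> U"
          using U True by (simp add: topological_tendstoD)
        then have "\<forall>\<^sub>F k in sequentially. indicat_real U (x - z k) * indicat_real U x = indicat_real U x"
          by eventually_elim (use True in auto)
        then show ?thesis by (rule tendsto_eventually)
      qed auto
    qed
  qed (use iU in \<open>auto simp: indicator_def\<close>)
  have int: "integrable lborel (\<lambda>x. indicat_real U (x - w) * indicat_real U x)" for w
    by (rule Bochner_Integration.integrable_bound[OF iU]) (auto simp: indicator_def)
  have sq: "(L2norm (\<lambda>x. complex_of_real (indicat_real U (x - w)) - complex_of_real (indicat_real U x)))\<^sup>2
     = 2 * (LINT x|lborel. indicat_real U x) - 2 * (LINT x|lborel. indicat_real U (x - w) * indicat_real U x)" for w
  proof -
    have "(cmod (complex_of_real (indicat_real U (x - w)) - complex_of_real (indicat_real U x)))\<^sup>2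
      = indicat_real U (x - w) + indicat_real U x - 2 * (indicat_real U (x - w) * indicat_real U x)" for x
      by (auto simp: indicator_def)
    then show ?thesis
      using iU iUz int
      by (subst L2norm_square_borel) (auto simp del: integral_indicator)
  qed
  have "(\<lambda>k. 2 * (LINT x|lborel. indicat_real U x) - 2 * (LINT x|lborel. indicat_real U (x - z k) * indicat_real U x))
     \<longlonglongrightarrow> 2 * (LINT x|lborel. indicat_real U x) - 2 * (LINT x|lborel. indicat_real U x)"
    by (intro tendsto_intros lim)
  then have "(\<lambda>k. sqrt ((L2norm (\<lambda>x. complex_of_real (indicat_real U (x - z k)) - complex_of_real (indicat_real U x)))\<^sup>2)) \<longlonglongrightarrow> sqrt 0"
    unfolding sq by (intro tendsto_real_sqrt) simp
  then show "(\<lambda>k. L2norm (\<lambda>x. complex_of_real (indicat_real U (x - z k)) - complex_of_real (indicat_real U x))) \<longlonglongrightarrow> 0"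
    by simp
qed

text \<open>Outer regularity reduces the claim to open sets.\<close>

lemma translation_continuous_indicator:
  fixes A :: "'a::euclidean_space set"
  assumes A: "A \<in> sets borel" and fin: "emeasure lborel A < \<infinity>"
  shows "translation_continuous (\<lambda>x. complex_of_real (indicat_real A x))"
proof (rule translation_continuous_approx)
  have [measurable]: "A \<in> sets borel" by fact
  show "(\<lambda>x. complex_of_real (indicat_real A x)) \<in> borel_measurable borel" by measurable
  show "(\<lambda>x. complex_of_real (indicat_real A x)) \<in> L2"
    by (intro L2_indicator assms)
  fix e :: real assume e: "e > 0"
  obtain U where U: "open U" "A \<subseteq> U" "emeasure lborel (U - A) < ennreal (e\<^sup>2)"
    using outer_regular_lborel[OF A, of "e\<^sup>2"] e by auto
  have [measurable]: "U \<in> sets borel" using U by auto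
  have "emeasure lborel U = emeasure lborel A + emeasure lborel (U - A)"
    using U by (subst plus_emeasure) (auto intro!: arg_cong[where f="emeasure lborel"])
  also have "\<dots> < \<infinity>"
    using fin U(3) by (auto simp: less_top[symmetric])
  finally have finU: "emeasure lborel U < \<infinity>" .
  have "L2norm (\<lambda>x. complex_of_real (indicat_real A x) - complex_of_real (indicat_real U x))
      = L2norm (\<lambda>x. complex_of_real (indicat_real (U - A) x))"
    by (subst L2norm_minus_commute, rule arg_cong[where f=L2norm]) (use U(2) in \<open>auto simp: indicator_def fun_eq_iff\<close>)
  moreover have "(L2norm (\<lambda>x. complex_of_real (indicat_real (U - A) x)))\<^sup>2 < e\<^sup>2"
  proof -
    have "ennreal (measure lborel (U - A)) < ennreal (e\<^sup>2)"
      using U(3) by (subst emeasure_eq_ennreal_measure[symmetric]) auto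
    then show ?thesis
      using U(3) by (subst L2_indicator(2)) (auto simp: ennreal_less_iff less_top[symmetric])
  qed
  ultimately have "L2norm (\<lambda>x. complex_of_real (indicat_real A x) - complex_of_real (indicat_real U x)) < e"
    using e by (metis less_imp_le power_less_imp_less_base)
  then show "\<exists>g. translation_continuous g \<and> L2norm (\<lambda>x. complex_of_real (indicat_real A x) - g x) < e"
    using translation_continuous_open[OF U(1) finU] by blast
qed

lemma translation_continuous_simple:
  fixes s :: "'a::euclidean_space \<Rightarrow> complex"
  assumes s: "simple_function lborel s" and L2: "s \<in> L2"
  shows "translation_continuous s"
proof -
  have [measurable]: "s \<in> borel_measurable borel"
    using borel_measurable_simple_function[OF s] by simp
  have fin: "finite (range s)" using s by (auto simp: simple_function_def)
  have 0: "translation_continuous (\<lambda>x::'a. 0)"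
    using translation_continuous_scale[OF translation_continuous_indicator[of "{}::'a set"], of 0] by simp
  have summand: "translation_continuous (\<lambda>x. y * complex_of_real (indicat_real (s -` {y}) x))" for y
  proof (cases "y = 0")
    case False
    have "s -` {y} \<inter> space borel \<in> sets borel" by measurable
    then have S [measurable]: "s -` {y} \<in> sets borel" by simp
    have "integrable lborel (indicat_real (s -` {y}))"
    proof (rule Bochner_Integration.integrable_bound)
      show "integrable lborel (\<lambda>x. (1 / (cmod y)\<^sup>2) * (cmod (s x))\<^sup>2)"
        using L2 by (intro integrable_mult_right) (simp add: L2_borel_iff)
    qed (use False in \<open>auto simp: indicator_def\<close>)
    then have "emeasure lborel (s -` {y}) < \<infinity>"
      by (simp add: integrable_indicator_iff)
    then show ?thesis
      by (intro translation_continuous_scale translation_continuous_indicator S)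
  qed (use 0 in simp)
  have "translation_continuous (\<lambda>x. \<Sum>y\<in>Y. y * complex_of_real (indicat_real (s -` {y}) x))" if "finite Y" for Y
    using that by induction (auto intro: 0 summand translation_continuous_add)
  moreover have "(\<Sum>y\<in>range s. y * complex_of_real (indicat_real (s -` {y}) x)) = s x" for x
    by (rule trans[OF _ simple_function_indicator_representation_banach[OF s, of x, symmetric]])
       (auto simp: scaleR_conv_of_real mult.commute intro!: sum.cong)
  ultimately show ?thesis
    using fin by (metis (no_types, lifting) ext)
qed

text \<open>Simple functions \<open>s\<close> with \<open>|s| \<le> 2 |f|\<close> converge to \<open>f\<close> pointwise, hence in \<open>L\<^sup>2\<close> by domination.\<close>

lemma translation_continuous_L2:
  fixes f :: "'a::euclidean_space \<Rightarrow> complex"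
  assumes f [measurable]: "f \<in> borel_measurable borel" and L2: "f \<in> L2"
  shows "translation_continuous f"
proof (rule translation_continuous_approx[OF f L2])
  obtain s where s: "\<And>i. simple_function lborel (s i)" and lim: "\<And>x. (\<lambda>i. s i x) \<longlonglongrightarrow> f x"
    and bound: "\<And>i x. cmod (s i x) \<le> 2 * cmod (f x)"
    using borel_measurable_implies_sequence_metric[of f lborel 0] by auto
  have [measurable]: "s i \<in> borel_measurable borel" for i
    using borel_measurable_simple_function[OF s] by simp
  have sL2: "s i \<in> L2" for i
    by (rule L2_dominated[OF L2, where C=2]) (auto simp: bound borel_imp_lebesgue)
  have "(\<lambda>i. L2norm (\<lambda>x. f x - s i x)) \<longlonglongrightarrow> 0"
  proof (rule L2_dominated_convergence[where G="\<lambda>x. 9 * (cmod (f x))\<^sup>2"])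
    show "AE x in lebesgue. (cmod (f x - s k x))\<^sup>2 \<le> 9 * (cmod (f x))\<^sup>2" for k
    proof (rule AE_I2)
      fix x
      have "cmod (f x - s k x) \<le> 3 * cmod (f x)"
        using norm_triangle_ineq4[of "f x" "s k x"] bound[of k x] by simp
      then have "(cmod (f x - s k x))\<^sup>2 \<le> (3 * cmod (f x))\<^sup>2"
        by (intro power_mono) auto
      then show "(cmod (f x - s k x))\<^sup>2 \<le> 9 * (cmod (f x))\<^sup>2" by (simp add: power_mult_distrib)
    qed
    show "AE x in lebesgue. (\<lambda>k. f x - s k x) \<longlonglongrightarrow> 0"
    proof (rule AE_I2)
      fix x show "(\<lambda>k. f x - s k x) \<longlonglongrightarrow> 0"
        using tendsto_diff[OF tendsto_const lim[of x], of "f x"] by simp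
    qed
  qed (auto simp: borel_imp_lebesgue L2_integrable[OF L2])
  note lim0 = this
  fix e :: real assume "e > 0"
  from LIMSEQ_D[OF lim0 this] obtain i where "L2norm (\<lambda>x. f x - s i x) < e" by auto
  then show "\<exists>g. translation_continuous g \<and> L2norm (\<lambda>x. f x - g x) < e"
    using translation_continuous_simple[OF s sL2] by blast
qed

section \<open>Fourier integrals of integrable functions\<close>

text \<open>Fubini's theorem on the product of two Borel-Lebesgue measures needs functions that are Borel; every
  function in \<open>L\<^sup>1\<close> or \<open>L\<^sup>2\<close> is replaced by such a representative first.\<close>

lemma borel_representative:
  fixes f :: "'a::euclidean_space \<Rightarrow> complex"
  assumes "f \<in> borel_measurable lebesgue"
  obtains g where "g \<in> borel_measurable borel" "AE x in lebesgue. f x = g x"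
proof -
  have [measurable]: "f \<in> borel_measurable lebesgue" by fact
  have "(\<lambda>x. Re (f x)) \<in> borel_measurable lebesgue" "(\<lambda>x. Im (f x)) \<in> borel_measurable lebesgue"
    by measurable
  from this[THEN completion_ex_borel_measurable_real]
  obtain a b where [measurable]: "a \<in> borel_measurable lborel" "b \<in> borel_measurable lborel"
    and ab: "AE x in lborel. Re (f x) = a x" "AE x in lborel. Im (f x) = b x"
    by auto
  have "AE x in lborel. f x = complex_of_real (a x) + \<i> * complex_of_real (b x)"
    using ab by eventually_elim (simp add: complex_eq_iff)
  then show ?thesis
    by (intro that[of "\<lambda>x. complex_of_real (a x) + \<i> * complex_of_real (b x)"] AE_completion) auto
qed

lemma fourier_integral_borel:
  assumes [measurable]: "f \<in> borel_measurable borel"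
  shows "fourier_integral f \<xi> = (LINT x|lborel. cis (- (x \<bullet> \<xi>)) * f x)"
  unfolding fourier_integral_def by (rule integral_completion) simp

lemma cis_inner_lebesgue [measurable]: "(\<lambda>x. cis (- (x \<bullet> \<xi>))) \<in> borel_measurable lebesgue"
  by (rule measurable_completion) simp

lemma fourier_integral_cong_AE:
  assumes [measurable]: "f \<in> borel_measurable lebesgue" "g \<in> borel_measurable lebesgue"
    and "AE x in lebesgue. f x = g x"
  shows "fourier_integral f = fourier_integral g"
  unfolding fourier_integral_def
  by (intro ext integral_cong_AE) (use assms in auto)

lemma fourier_integral_integrable:
  assumes "integrable lebesgue f"
  shows "integrable lebesgue (\<lambda>x. cis (- (x \<bullet> \<xi>)) * f x)"
  by (rule Bochner_Integration.integrable_bound[OF assms]) (use assms in \<open>auto simp: norm_mult\<close>)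

lemma fourier_integral_diff:
  assumes "integrable lebesgue f" "integrable lebesgue g"
  shows "fourier_integral (\<lambda>x. f x - g x) = (\<lambda>\<xi>. fourier_integral f \<xi> - fourier_integral g \<xi>)"
  unfolding fourier_integral_def
  using fourier_integral_integrable[OF assms(1)] fourier_integral_integrable[OF assms(2)]
  by (auto simp: right_diff_distrib)

lemma fourier_integral_bound:
  assumes "integrable lebesgue f"
  shows "cmod (fourier_integral f \<xi>) \<le> (LINT x|lebesgue. cmod (f x))"
  unfolding fourier_integral_def
  using integral_norm_bound[of lebesgue "\<lambda>x. cis (- (x \<bullet> \<xi>)) * f x"] by (simp add: norm_mult)

lemma fourier_integral_tendsto:
  fixes \<xi> :: "nat \<Rightarrow> 'a::euclidean_space"
  assumes f: "integrable lebesgue f" and lim: "\<xi> \<longlonglongrightarrow> \<eta>"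
  shows "(\<lambda>k. fourier_integral f (\<xi> k)) \<longlonglongrightarrow> fourier_integral f \<eta>"
  unfolding fourier_integral_def
proof (rule integral_dominated_convergence[where w="\<lambda>x. cmod (f x)"])
  show "AE x in lebesgue. (\<lambda>k. cis (- (x \<bullet> \<xi> k)) * f x) \<longlonglongrightarrow> cis (- (x \<bullet> \<eta>)) * f x"
    unfolding cis_conv_exp by (intro AE_I2 tendsto_intros lim)
qed (use f in \<open>auto simp: norm_mult\<close>)

lemma fourier_integral_measurable [measurable]:
  assumes "integrable lebesgue f"
  shows "fourier_integral f \<in> borel_measurable borel"
proof (rule borel_measurable_continuous_onI)
  show "continuous_on UNIV (fourier_integral f)"
    unfolding continuous_on_sequentially comp_def using fourier_integral_tendsto[OF assms] by blast
qed

text \<open>The bounded factor will be a character; this is the integrability that Fubini asks for.\<close>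

lemma integrable_tensor:
  fixes f g :: "'a::euclidean_space \<Rightarrow> complex"
  assumes f: "integrable lborel f" and g: "integrable lborel g"
    and u [measurable]: "u \<in> borel_measurable (lborel \<Otimes>\<^sub>M lborel)" and le: "\<And>p. cmod (u p) \<le> 1"
  shows "integrable (lborel \<Otimes>\<^sub>M lborel) (\<lambda>p. f (fst p) * g (snd p) * u p)"
proof -
  have [measurable]: "f \<in> borel_measurable borel" "g \<in> borel_measurable borel"
    using f g by auto
  have *: "integrable (lborel \<Otimes>\<^sub>M lborel) (\<lambda>p. f (fst p) * g (snd p))"
  proof (rule lborel_pair.Fubini_integrable)
    show "integrable lborel (\<lambda>x. LBINT y. norm (f (fst (x, y)) * g (snd (x, y))))"
      using f by (simp add: norm_mult)
    show "AE x in lborel. integrable lborel (\<lambda>y. f (fst (x, y)) * g (snd (x, y)))"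
      using g by simp
  qed simp
  show ?thesis
  proof (rule Bochner_Integration.integrable_bound[OF *])
    show "AE p in lborel \<Otimes>\<^sub>M lborel. norm (f (fst p) * g (snd p) * u p) \<le> norm (f (fst p) * g (snd p))"
      using le by (auto simp: norm_mult mult_left_le)
  qed simp
qed

text \<open>The kernel of the Fourier integral is symmetric in its two arguments.\<close>

lemma fourier_integral_symmetric:
  fixes f g :: "'a::euclidean_space \<Rightarrow> complex"
  assumes f: "integrable lborel f" and g: "integrable lborel g"
  shows "(LINT \<xi>|lborel. fourier_integral f \<xi> * g \<xi>) = (LINT x|lborel. f x * fourier_integral g x)"
proof -
  have [measurable]: "f \<in> borel_measurable borel" "g \<in> borel_measurable borel"
    using f g by auto
  let ?h = "\<lambda>x \<xi>. f x * g \<xi> * cis (- (x \<bullet> \<xi>))"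
  have "integrable (lborel \<Otimes>\<^sub>M lborel) (\<lambda>p. ?h (fst p) (snd p))"
    by (intro integrable_tensor f g) auto
  then have "integrable (lborel \<Otimes>\<^sub>M lborel) (\<lambda>(x, \<xi>). ?h x \<xi>)"
    by (simp add: case_prod_beta')
  from lborel_pair.Fubini_integral[OF this]
  have "(LINT \<xi>|lborel. LINT x|lborel. ?h x \<xi>) = (LINT x|lborel. LINT \<xi>|lborel. ?h x \<xi>)" .
  moreover have "(LINT x|lborel. ?h x \<xi>) = fourier_integral f \<xi> * g \<xi>" for \<xi>
    unfolding fourier_integral_borel[OF \<open>f \<in> _\<close>] integral_mult_left_zero[symmetric]
    by (simp add: mult_ac)
  moreover have "(LINT \<xi>|lborel. ?h x \<xi>) = f x * fourier_integral g x" for x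
    unfolding fourier_integral_borel[OF \<open>g \<in> _\<close>] integral_mult_right_zero[symmetric]
    by (simp add: mult_ac inner_commute)
  ultimately show ?thesis by simp
qed

section \<open>Plancherel's identity on \<open>L\<^sup>1 \<inter> L\<^sup>2\<close>\<close>

text \<open>The convolution of \<open>f\<close> with \<open>x \<mapsto> cnj (f (- x))\<close>.\<close>

definition autocorrelation :: "('a::euclidean_space \<Rightarrow> complex) \<Rightarrow> 'a \<Rightarrow> complex" where
  "autocorrelation f z = (LINT x|lborel. f x * cnj (f (x - z)))"

lemma lborel_reflect:
  fixes g :: "'a::euclidean_space \<Rightarrow> 'b::{banach, second_countable_topology}"
  assumes "g \<in> borel_measurable borel"
  shows "(LINT z|lborel. g (x - z)) = (LINT y|lborel. g y)"
    and "integrable lborel (\<lambda>z. g (x - z)) \<longleftrightarrow> integrable lborel g"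
  using lborel_integral_affine[OF assms, of "-1" x] by simp_all

lemma autocorrelation_pair_integrable:
  fixes f :: "'a::euclidean_space \<Rightarrow> complex"
  assumes f: "integrable lborel f"
  shows "integrable (lborel \<Otimes>\<^sub>M lborel) (\<lambda>(x, z). f x * cnj (f (x - z)) * cis (- (z \<bullet> \<xi>)))"
proof (rule lborel_pair.Fubini_integrable)
  have [measurable]: "f \<in> borel_measurable borel" using f by auto
  have [measurable]: "(\<lambda>x. cnj (f x)) \<in> borel_measurable borel" by measurable
  show "(\<lambda>(x, z). f x * cnj (f (x - z)) * cis (- (z \<bullet> \<xi>))) \<in> borel_measurable (lborel \<Otimes>\<^sub>M lborel)"
    by measurable
  have 1: "(LINT z|lborel. cmod (f (x - z))) = (LINT y|lborel. cmod (f y))" for x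
    by (rule lborel_reflect(1)[of "\<lambda>y. cmod (f y)"]) simp
  show "integrable lborel (\<lambda>x. LBINT z. norm (case (x, z) of (x, z) \<Rightarrow> f x * cnj (f (x - z)) * cis (- (z \<bullet> \<xi>))))"
    using f by (simp add: norm_mult 1)
  have 2: "integrable lborel (\<lambda>z. cnj (f (x - z)))" for x
    using lborel_reflect(2)[of "\<lambda>y. cnj (f y)" x] f by simp
  have "integrable lborel (\<lambda>z. f x * (cnj (f (x - z)) * cis (- (z \<bullet> \<xi>))))" for x
    by (intro integrable_mult_right Bochner_Integration.integrable_bound[OF 2]) (auto simp: norm_mult)
  then show "AE x in lborel. integrable lborel (\<lambda>z. case (x, z) of (x, z) \<Rightarrow> f x * cnj (f (x - z)) * cis (- (z \<bullet> \<xi>)))"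
    by (simp add: mult_ac)
qed

lemma autocorrelation_measurable [measurable]:
  assumes [measurable]: "f \<in> borel_measurable borel"
  shows "autocorrelation f \<in> borel_measurable borel"
proof -
  have "(\<lambda>z. LINT x|lborel. f x * cnj (f (x - z))) \<in> borel_measurable lborel"
    by measurable
  then show ?thesis unfolding autocorrelation_def[abs_def] by simp
qed

lemma autocorrelation_integrable:
  assumes f: "integrable lborel f"
  shows "integrable lborel (autocorrelation f)"
proof -
  have "integrable lborel (\<lambda>z. LINT x|lborel. f x * cnj (f (x - z)) * cis (- (z \<bullet> 0)))"
    by (rule lborel_pair.integrable_snd) (rule autocorrelation_pair_integrable[OF f])
  then show ?thesis unfolding autocorrelation_def[abs_def] by simp
qed

text \<open>The convolution theorem, for the convolution of \<open>f\<close> with its conjugate reflection.\<close>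

lemma fourier_autocorrelation:
  fixes f :: "'a::euclidean_space \<Rightarrow> complex"
  assumes f: "integrable lborel f"
  shows "fourier_integral (autocorrelation f) \<xi> = complex_of_real ((cmod (fourier_integral f \<xi>))\<^sup>2)"
proof -
  have [measurable]: "f \<in> borel_measurable borel" using f by auto
  have fb: "fourier_integral (autocorrelation f) \<xi> = (LINT z|lborel. LINT x|lborel. f x * cnj (f (x - z)) * cis (- (z \<bullet> \<xi>)))"
    by (subst fourier_integral_borel) (auto simp: autocorrelation_def mult.commute)
  also have "\<dots> = (LINT x|lborel. LINT z|lborel. f x * cnj (f (x - z)) * cis (- (z \<bullet> \<xi>)))"
    by (rule lborel_pair.Fubini_integral[OF autocorrelation_pair_integrable[OF f]])
  also have "\<dots> = (LINT x|lborel. (cis (- (x \<bullet> \<xi>)) * f x) * cnj (fourier_integral f \<xi>))"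
  proof (rule Bochner_Integration.integral_cong[OF refl])
    fix x :: 'a
    have "(LINT z|lborel. f x * cnj (f (x - z)) * cis (- (z \<bullet> \<xi>)))
        = (LINT z|lborel. (\<lambda>y. f x * cnj (f y) * cis (- ((x - y) \<bullet> \<xi>))) (x - z))"
      by simp
    also have "\<dots> = (LINT y|lborel. f x * cnj (f y) * cis (- ((x - y) \<bullet> \<xi>)))"
      by (rule lborel_reflect) simp
    also have "\<dots> = (LINT y|lborel. (cis (- (x \<bullet> \<xi>)) * f x) * cnj (cis (- (y \<bullet> \<xi>)) * f y))"
      by (intro Bochner_Integration.integral_cong refl)
         (simp add: inner_diff_left cis_cnj cis_mult[symmetric] cis_mult mult_ac)
    also have "\<dots> = (cis (- (x \<bullet> \<xi>)) * f x) * cnj (fourier_integral f \<xi>)"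
      unfolding integral_mult_right_zero fourier_integral_borel[OF \<open>f \<in> _\<close>]
    by (subst Bochner_Integration.integral_cnj) (rule refl)
    finally show "(LINT z|lborel. f x * cnj (f (x - z)) * cis (- (z \<bullet> \<xi>)))
        = (cis (- (x \<bullet> \<xi>)) * f x) * cnj (fourier_integral f \<xi>)" .
  qed
  also have "\<dots> = fourier_integral f \<xi> * cnj (fourier_integral f \<xi>)"
    unfolding integral_mult_left_zero fourier_integral_borel[OF \<open>f \<in> _\<close>] ..
  finally show ?thesis
    by (simp only: complex_norm_square)
qed

lemma integral_lborel_lebesgue:
  fixes g :: "'a::euclidean_space \<Rightarrow> complex"
  assumes "g \<in> borel_measurable borel"
  shows "(LINT x|lborel. g x) = (LINT x|lebesgue. g x)"
  using assms by (intro integral_completion[symmetric]) simp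

text \<open>The last bound reduces continuity of the autocorrelation at \<open>0\<close> to continuity of translation.\<close>

lemma autocorrelation_bounds:
  fixes f :: "'a::euclidean_space \<Rightarrow> complex"
  assumes f [measurable]: "f \<in> borel_measurable borel" and L2: "f \<in> L2"
  shows "cmod (autocorrelation f z) \<le> (L2norm f)\<^sup>2"
    and "autocorrelation f 0 = complex_of_real ((L2norm f)\<^sup>2)"
    and "cmod (autocorrelation f z - autocorrelation f 0) \<le> L2norm f * L2norm (\<lambda>x. f (x - z) - f x)"
proof -
  have [measurable]: "(\<lambda>x. cnj (f x)) \<in> borel_measurable borel" by measurable
  have fz: "(\<lambda>x. cnj (f (x - z))) \<in> L2" for z
    by (intro L2_cnj L2_translate L2 f)
  have eq: "autocorrelation f z = (LINT x|lebesgue. f x * cnj (f (x - z)))" for z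
    unfolding autocorrelation_def by (rule integral_lborel_lebesgue) simp
  show "cmod (autocorrelation f z) \<le> (L2norm f)\<^sup>2"
    unfolding eq using L2_inner_le[OF L2 fz[of z]] L2_translate(2)[OF f L2, of z]
    by (simp add: power2_eq_square)
  show "autocorrelation f 0 = complex_of_real ((L2norm f)\<^sup>2)"
    unfolding eq L2norm_square by (simp only: diff_zero complex_norm_square[symmetric] integral_complex_of_real)
  have "autocorrelation f z - autocorrelation f 0 = (LINT x|lebesgue. f x * cnj (f (x - z) - f x))"
    unfolding eq using L2_times_integrable[OF L2 fz[of z]] L2_times_integrable[OF L2 fz[of 0]]
    by (simp add: right_diff_distrib)
  also have "cmod \<dots> \<le> L2norm f * L2norm (\<lambda>x. cnj (f (x - z) - f x))"
    by (intro L2_inner_le L2 L2_cnj L2_diff L2_translate f)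
  finally show "cmod (autocorrelation f z - autocorrelation f 0) \<le> L2norm f * L2norm (\<lambda>x. f (x - z) - f x)"
    using L2norm_cnj[of "\<lambda>x. f (x - z) - f x"] by simp
qed

lemma fourier_gaussian_scaled:
  fixes z :: "'a::euclidean_space"
  assumes e: "e > 0"
  shows "integrable lborel (\<lambda>\<xi>::'a. complex_of_real (gaussian (e *\<^sub>R \<xi>)))"
    and "fourier_integral (\<lambda>\<xi>. complex_of_real (gaussian (e *\<^sub>R \<xi>))) z
           = complex_of_real ((1 / e) ^ DIM('a) * sqrt (2 * pi) ^ DIM('a) * gaussian ((1 / e) *\<^sub>R z))"
proof -
  show "integrable lborel (\<lambda>\<xi>::'a. complex_of_real (gaussian (e *\<^sub>R \<xi>)))"
    using lborel_integral_affine(2)[of "\<lambda>x::'a. complex_of_real (gaussian x)" e 0] e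
      integrable_gaussian[where 'a='a] by simp
  have "fourier_integral (\<lambda>\<xi>. complex_of_real (gaussian (e *\<^sub>R \<xi>))) z
      = (LINT \<xi>|lborel. (\<lambda>x. cis (x \<bullet> (- (1 / e) *\<^sub>R z)) * complex_of_real (gaussian x)) (0 + e *\<^sub>R \<xi>))"
    using e by (subst fourier_integral_borel) (auto simp: field_simps)
  also have "\<dots> = (1 / \<bar>e\<bar>^DIM('a)) *\<^sub>R (LINT x|lborel. cis (x \<bullet> (- (1 / e) *\<^sub>R z)) * complex_of_real (gaussian x))"
    using e by (intro lborel_integral_affine) auto
  also have "\<dots> = complex_of_real ((1 / e) ^ DIM('a) * sqrt (2 * pi) ^ DIM('a) * gaussian ((1 / e) *\<^sub>R z))"
    unfolding integral_cis_gaussian using e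
    by (simp add: gaussian_def scaleR_conv_of_real power_divide)
  finally show "fourier_integral (\<lambda>\<xi>. complex_of_real (gaussian (e *\<^sub>R \<xi>))) z
           = complex_of_real ((1 / e) ^ DIM('a) * sqrt (2 * pi) ^ DIM('a) * gaussian ((1 / e) *\<^sub>R z))" .
qed

text \<open>Symmetry moves the transform from the autocorrelation to the Gaussian, whose transform is a Gaussian of
  reciprocal width; the substitution \<open>z = e w\<close> then makes the width appear in the argument of the
  autocorrelation.\<close>

lemma fourier_square_gaussian:
  fixes f :: "'a::euclidean_space \<Rightarrow> complex"
  assumes f: "integrable lborel f" and e: "e > 0"
  shows "complex_of_real (LINT \<xi>|lborel. (cmod (fourier_integral f \<xi>))\<^sup>2 * gaussian (e *\<^sub>R \<xi>))
    = complex_of_real (sqrt (2 * pi) ^ DIM('a)) * (LINT w|lborel. autocorrelation f (e *\<^sub>R w) * complex_of_real (gaussian w))"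
proof -
  have [measurable]: "f \<in> borel_measurable borel" using f by auto
  have "complex_of_real (LINT \<xi>|lborel. (cmod (fourier_integral f \<xi>))\<^sup>2 * gaussian (e *\<^sub>R \<xi>))
     = (LINT \<xi>|lborel. fourier_integral (autocorrelation f) \<xi> * complex_of_real (gaussian (e *\<^sub>R \<xi>)))"
    unfolding fourier_autocorrelation[OF f] by (simp flip: integral_complex_of_real)
  also have "\<dots> = (LINT z|lborel. autocorrelation f z * fourier_integral (\<lambda>\<xi>. complex_of_real (gaussian (e *\<^sub>R \<xi>))) z)"
    by (intro fourier_integral_symmetric autocorrelation_integrable f fourier_gaussian_scaled e)
  also have "\<dots> = (LINT z|lborel. complex_of_real (sqrt (2 * pi) ^ DIM('a)) * ((1 / e)^DIM('a) *\<^sub>R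
        (autocorrelation f z * complex_of_real (gaussian ((1 / e) *\<^sub>R z)))))"
    unfolding fourier_gaussian_scaled(2)[OF e] by (simp add: scaleR_conv_of_real mult_ac)
  also have "\<dots> = complex_of_real (sqrt (2 * pi) ^ DIM('a)) * ((1 / e)^DIM('a) *\<^sub>R
        (LINT z|lborel. autocorrelation f z * complex_of_real (gaussian ((1 / e) *\<^sub>R z))))"
    unfolding integral_mult_right_zero integral_scaleR_right ..
  also have "(1 / e)^DIM('a) *\<^sub>R (LINT z|lborel. autocorrelation f z * complex_of_real (gaussian ((1 / e) *\<^sub>R z)))
      = (LINT w|lborel. autocorrelation f (e *\<^sub>R w) * complex_of_real (gaussian w))"
    using lborel_integral_affine(1)[of "\<lambda>z. autocorrelation f z * complex_of_real (gaussian ((1 / e) *\<^sub>R z))" e 0] e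
    by (simp add: power_divide)
  finally show ?thesis .
qed

lemma sqrt_pow_square: "sqrt (2 * pi) ^ n * sqrt (2 * pi) ^ n = (2 * pi) ^ n"
  by (subst power_mult_distrib[symmetric]) simp

text \<open>\<open>|Ff|\<^sup>2\<close> is the transform of the autocorrelation. Tested against the Gaussians \<open>gaussian (e \<xi>)\<close>, it
  increases to its full integral as \<open>e\<close> decreases to \<open>0\<close>, while the other side of the preceding
  identity only sees the autocorrelation near \<open>0\<close>, where its value is \<open>\<parallel>f\<parallel>\<^sup>2\<close>.\<close>

lemma plancherel_borel:
  fixes f :: "'a::euclidean_space \<Rightarrow> complex"
  assumes f: "integrable lborel f" and L2: "f \<in> L2"
  shows "(\<integral>\<^sup>+\<xi>. ennreal ((cmod (fourier_integral f \<xi>))\<^sup>2) \<partial>lborel) = ennreal ((2 * pi) ^ DIM('a) * (L2norm f)\<^sup>2)"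
proof -
  have fm [measurable]: "f \<in> borel_measurable borel" using f by auto
  have "integrable lebesgue f" using f by (subst integrable_completion) auto
  then have [measurable]: "fourier_integral f \<in> borel_measurable borel" by measurable
  define e where "e k = 1 / real (Suc k)" for k
  have e: "e k > 0" for k by (simp add: e_def)
  have e0: "e \<longlonglongrightarrow> 0"
    using LIMSEQ_Suc[OF lim_1_over_n] by (simp add: e_def[abs_def])
  let ?I = "\<lambda>k. LINT \<xi>|lborel. (cmod (fourier_integral f \<xi>))\<^sup>2 * gaussian (e k *\<^sub>R \<xi>)"
  have "(\<lambda>k. LINT w|lborel. autocorrelation f (e k *\<^sub>R w) * complex_of_real (gaussian w))
     \<longlonglongrightarrow> (LINT w|lborel. autocorrelation f 0 * complex_of_real (gaussian (w::'a)))"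
  proof (rule integral_dominated_convergence[where w="\<lambda>w. (L2norm f)\<^sup>2 * gaussian w"])
    show "integrable lborel (\<lambda>w::'a. (L2norm f)\<^sup>2 * gaussian w)"
      by (intro integrable_mult_right integrable_gaussian)
    show "AE w in lborel. norm (autocorrelation f (e k *\<^sub>R w) * complex_of_real (gaussian w)) \<le> (L2norm f)\<^sup>2 * gaussian w" for k
      using autocorrelation_bounds(1)[OF fm L2] by (auto simp: norm_mult gaussian_bounds intro!: mult_right_mono)
    show "AE w in lborel. (\<lambda>k. autocorrelation f (e k *\<^sub>R w) * complex_of_real (gaussian w))
        \<longlonglongrightarrow> autocorrelation f 0 * complex_of_real (gaussian w)"
    proof (intro AE_I2 tendsto_mult tendsto_const)
      fix w :: 'a
      have "(\<lambda>k. e k *\<^sub>R w) \<longlonglongrightarrow> 0 *\<^sub>R w" by (intro tendsto_intros e0)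
      then have "(\<lambda>k. L2norm (\<lambda>x. f (x - e k *\<^sub>R w) - f x)) \<longlonglongrightarrow> 0"
        using translation_continuous_L2[OF fm L2] by (simp add: translation_continuous_def)
      from tendsto_mult[OF tendsto_const[of "L2norm f"] this]
      have "(\<lambda>k. L2norm f * L2norm (\<lambda>x. f (x - e k *\<^sub>R w) - f x)) \<longlonglongrightarrow> 0" by simp
      then have "(\<lambda>k. autocorrelation f (e k *\<^sub>R w) - autocorrelation f 0) \<longlonglongrightarrow> 0"
        by (rule Lim_null_comparison[rotated]) (use autocorrelation_bounds(3)[OF fm L2] in auto)
      then show "(\<lambda>k. autocorrelation f (e k *\<^sub>R w)) \<longlonglongrightarrow> autocorrelation f 0"
        by (simp flip: Lim_null)
    qed
  qed auto
  then have "(\<lambda>k. complex_of_real (?I k)) \<longlonglongrightarrow> complex_of_real (sqrt (2 * pi) ^ DIM('a)) *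
       (LINT w|lborel. autocorrelation f 0 * complex_of_real (gaussian (w::'a)))"
    unfolding fourier_square_gaussian[OF f e] by (intro tendsto_mult tendsto_const)
  also have "complex_of_real (sqrt (2 * pi) ^ DIM('a)) * (LINT w|lborel. autocorrelation f 0 * complex_of_real (gaussian (w::'a)))
      = complex_of_real ((2 * pi) ^ DIM('a) * (L2norm f)\<^sup>2)"
    unfolding integral_mult_right_zero integral_complex_of_real integral_gaussian autocorrelation_bounds(2)[OF fm L2]
      sqrt_pow_square[symmetric] by simp
  finally have limI: "?I \<longlonglongrightarrow> (2 * pi) ^ DIM('a) * (L2norm f)\<^sup>2"
    unfolding tendsto_of_real_iff .
  let ?N = "\<lambda>k. \<integral>\<^sup>+\<xi>. ennreal ((cmod (fourier_integral f \<xi>))\<^sup>2 * gaussian (e k *\<^sub>R \<xi>)) \<partial>lborel"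
  have "?N \<longlonglongrightarrow> (\<integral>\<^sup>+\<xi>. ennreal ((cmod (fourier_integral f \<xi>))\<^sup>2) \<partial>lborel)"
  proof (rule nn_integral_LIMSEQ)
    show "mono (\<lambda>k \<xi>. ennreal ((cmod (fourier_integral f \<xi>))\<^sup>2 * gaussian (e k *\<^sub>R \<xi>)))"
    proof (intro incseq_SucI le_funI ennreal_leI mult_left_mono)
      fix k and \<xi> :: 'a
      have "e (Suc k) \<le> e k" by (simp add: e_def frac_le)
      then have "norm (e (Suc k) *\<^sub>R \<xi>) \<le> norm (e k *\<^sub>R \<xi>)"
        using e[of k] e[of "Suc k"] by (auto intro!: mult_right_mono)
      then have "(norm (e (Suc k) *\<^sub>R \<xi>))\<^sup>2 \<le> (norm (e k *\<^sub>R \<xi>))\<^sup>2"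
        by (intro power_mono) auto
      then show "gaussian (e k *\<^sub>R \<xi>) \<le> gaussian (e (Suc k) *\<^sub>R \<xi>)"
        by (simp add: gaussian_def)
    qed auto
    show "(\<lambda>k. ennreal ((cmod (fourier_integral f \<xi>))\<^sup>2 * gaussian (e k *\<^sub>R \<xi>)))
        \<longlonglongrightarrow> ennreal ((cmod (fourier_integral f \<xi>))\<^sup>2)" for \<xi>
    proof (rule tendsto_ennrealI)
      have "(\<lambda>k. (cmod (fourier_integral f \<xi>))\<^sup>2 * exp (- (norm (e k *\<^sub>R \<xi>))\<^sup>2 / 2))
          \<longlonglongrightarrow> (cmod (fourier_integral f \<xi>))\<^sup>2 * exp (- (norm (0 *\<^sub>R \<xi>))\<^sup>2 / 2)"
        by (intro tendsto_intros e0) auto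
      then show "(\<lambda>k. (cmod (fourier_integral f \<xi>))\<^sup>2 * gaussian (e k *\<^sub>R \<xi>)) \<longlonglongrightarrow> (cmod (fourier_integral f \<xi>))\<^sup>2"
        by (simp add: gaussian_def)
    qed
  qed auto
  moreover have "?N k = ennreal (?I k)" for k
  proof (rule nn_integral_eq_integral)
    have "integrable lborel (\<lambda>\<xi>::'a. gaussian (e k *\<^sub>R \<xi>))"
      using lborel_integral_affine(2)[of "gaussian :: 'a \<Rightarrow> real" "e k" 0] e[of k] integrable_gaussian[where 'a='a] by simp
    then have "integrable lborel (\<lambda>\<xi>::'a. (LINT x|lebesgue. cmod (f x))\<^sup>2 * gaussian (e k *\<^sub>R \<xi>))"
      by (rule integrable_mult_right)
    then show "integrable lborel (\<lambda>\<xi>. (cmod (fourier_integral f \<xi>))\<^sup>2 * gaussian (e k *\<^sub>R \<xi>))"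
    proof (rule Bochner_Integration.integrable_bound)
      have "(cmod (fourier_integral f \<xi>))\<^sup>2 \<le> (LINT x|lebesgue. cmod (f x))\<^sup>2" for \<xi>
        using fourier_integral_bound[OF \<open>integrable lebesgue f\<close>] by (intro power_mono) auto
      then show "AE \<xi> in lborel. norm ((cmod (fourier_integral f \<xi>))\<^sup>2 * gaussian (e k *\<^sub>R \<xi>))
         \<le> norm ((LINT x|lebesgue. cmod (f x))\<^sup>2 * gaussian (e k *\<^sub>R \<xi>))"
        by (auto simp: abs_mult gaussian_bounds intro!: mult_right_mono)
    qed measurable
  qed (auto simp: gaussian_bounds)
  ultimately have "(\<lambda>k. ennreal (?I k)) \<longlonglongrightarrow> (\<integral>\<^sup>+\<xi>. ennreal ((cmod (fourier_integral f \<xi>))\<^sup>2) \<partial>lborel)"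
    by simp
  moreover have "(\<lambda>k. ennreal (?I k)) \<longlonglongrightarrow> ennreal ((2 * pi) ^ DIM('a) * (L2norm f)\<^sup>2)"
    by (intro tendsto_ennrealI limI)
  ultimately show ?thesis by (rule LIMSEQ_unique)
qed

lemma plancherel_L1_L2:
  fixes f :: "'a::euclidean_space \<Rightarrow> complex"
  assumes f: "integrable lebesgue f" and L2: "f \<in> L2"
  shows "fourier_integral f \<in> L2"
    and "L2norm (fourier_integral f) = sqrt (2 * pi) ^ DIM('a) * L2norm f"
proof -
  have fm: "f \<in> borel_measurable lebesgue" using f by auto
  obtain g where g [measurable]: "g \<in> borel_measurable borel" and fg: "AE x in lebesgue. f x = g x"
    using borel_representative[OF fm] .
  have gm: "g \<in> borel_measurable lebesgue" by (rule borel_imp_lebesgue) simp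
  have "integrable lebesgue g"
    using integrable_cong_AE_imp[OF f gm] fg by (auto simp: eq_commute)
  then have gi: "integrable lborel g" by (simp add: integrable_completion)
  have gL: "g \<in> L2" "L2norm g = L2norm f" using L2_cong_AE[OF L2 fg] by auto
  have Feq: "fourier_integral f = fourier_integral g"
    by (rule fourier_integral_cong_AE[OF fm gm fg])
  have m: "fourier_integral f \<in> borel_measurable lebesgue"
    by (rule borel_imp_lebesgue) (use f in measurable)
  have c: "(sqrt (2 * pi) ^ DIM('a) * L2norm f)\<^sup>2 = (2 * pi) ^ DIM('a) * (L2norm f)\<^sup>2"
    unfolding sqrt_pow_square[symmetric] by (simp add: power2_eq_square mult_ac)
  have "(\<integral>\<^sup>+\<xi>. ennreal ((cmod (fourier_integral f \<xi>))\<^sup>2) \<partial>lebesgue) = ennreal ((sqrt (2 * pi) ^ DIM('a) * L2norm f)\<^sup>2)"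
    unfolding nn_integral_completion c Feq using plancherel_borel[OF gi gL(1)] gL(2) by simp
  then show *: "fourier_integral f \<in> L2" and "L2norm (fourier_integral f) = sqrt (2 * pi) ^ DIM('a) * L2norm f"
    using m nn_integral_L2norm[of "fourier_integral f"] by (auto simp: L2_iff_nn_integral)
qed

section \<open>The Fourier transform on \<open>L\<^sup>2\<close>\<close>

abbreviation truncation :: "real \<Rightarrow> ('a::euclidean_space \<Rightarrow> complex) \<Rightarrow> 'a \<Rightarrow> complex" where
  "truncation R f \<equiv> (\<lambda>x. indicat_real (cball 0 R) x *\<^sub>R f x)"

lemma truncation_L2:
  fixes f :: "'a::euclidean_space \<Rightarrow> complex"
  assumes "f \<in> L2"
  shows "truncation R f \<in> L2"
proof (rule L2_dominated[OF assms, where C=1])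
  have [measurable]: "f \<in> borel_measurable lebesgue" using assms by (simp add: L2_def)
  have [measurable]: "indicat_real (cball 0 R) \<in> borel_measurable (lebesgue :: 'a measure)"
    by (rule borel_measurable_indicator) simp
  show "truncation R f \<in> borel_measurable lebesgue" by measurable
qed (auto simp: indicator_def)

lemma truncation_integrable:
  fixes f :: "'a::euclidean_space \<Rightarrow> complex"
  assumes "f \<in> L2"
  shows "integrable lebesgue (truncation R f)"
proof -
  have "(\<lambda>x::'a. complex_of_real (indicat_real (cball 0 R) x)) \<in> L2"
    by (rule L2_indicator) (use emeasure_bounded_finite[OF bounded_cball] in simp_all)
  from L2_times_integrable[OF this assms] show ?thesis
    by (simp add: scaleR_conv_of_real)
qed

lemma truncation_tendsto:
  fixes f :: "'a::euclidean_space \<Rightarrow> complex"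
  assumes f: "f \<in> L2"
  shows "L2_tendsto (\<lambda>R. truncation R f) f at_top"
  unfolding L2_tendsto_def
proof (intro conjI f always_eventually allI truncation_L2 tendsto_at_topI_sequentially)
  fix X :: "nat \<Rightarrow> real" assume X: "filterlim X at_top sequentially"
  show "(\<lambda>n. L2norm (\<lambda>x. truncation (X n) f x - f x)) \<longlonglongrightarrow> 0"
  proof (rule L2_dominated_convergence[OF _ L2_integrable[OF f]])
    show "(\<lambda>x. truncation (X k) f x - f x) \<in> borel_measurable lebesgue" for k
      using L2_diff(1)[OF truncation_L2[OF f] f] by (simp add: L2_def)
    show "AE x in lebesgue. (\<lambda>k. truncation (X k) f x - f x) \<longlonglongrightarrow> 0"
    proof (rule AE_I2)
      fix x :: 'a
      have "\<forall>\<^sub>F k in sequentially. norm x \<le> X k"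
        using X by (simp add: filterlim_at_top)
      then have "\<forall>\<^sub>F k in sequentially. truncation (X k) f x - f x = 0"
        by eventually_elim simp
      then show "(\<lambda>k. truncation (X k) f x - f x) \<longlonglongrightarrow> 0" by (rule tendsto_eventually)
    qed
  qed (auto simp: indicator_def)
qed

lemma fourier_truncation_diff:
  fixes f g :: "'a::euclidean_space \<Rightarrow> complex"
  assumes "f \<in> L2" "g \<in> L2" "integrable lebesgue f" "integrable lebesgue g"
  shows "L2norm (\<lambda>\<xi>. fourier_integral f \<xi> - fourier_integral g \<xi>) = sqrt (2 * pi) ^ DIM('a) * L2norm (\<lambda>x. f x - g x)"
  using plancherel_L1_L2(2)[of "\<lambda>x. f x - g x"] assms
  by (simp add: fourier_integral_diff L2_diff)

text \<open>On \<open>L\<^sup>1 \<inter> L\<^sup>2\<close> the transform is the Fourier integral, because the error of the truncated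
  integral is the transform of the error of the truncation.\<close>

lemma has_fourier_fourier_integral:
  fixes f :: "'a::euclidean_space \<Rightarrow> complex"
  assumes f: "f \<in> L2" "integrable lebesgue f"
  shows "has_fourier f (fourier_integral f)"
  unfolding has_fourier_def L2_tendsto_def
proof (intro conjI f always_eventually allI plancherel_L1_L2 truncation_L2 truncation_integrable)
  have "((\<lambda>R. sqrt (2 * pi) ^ DIM('a) * L2norm (\<lambda>x. truncation R f x - f x)) \<longlongrightarrow> sqrt (2 * pi) ^ DIM('a) * 0) at_top"
    using truncation_tendsto[OF f(1)] by (intro tendsto_intros) (simp add: L2_tendsto_def)
  then show "((\<lambda>R. L2norm (\<lambda>\<xi>. fourier_integral (truncation R f) \<xi> - fourier_integral f \<xi>)) \<longlongrightarrow> 0) at_top"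
    by (simp add: fourier_truncation_diff f truncation_L2 truncation_integrable)
qed

text \<open>The transforms of the truncations inherit the Cauchy property from the truncations.\<close>

lemma has_fourier_exists:
  fixes f :: "'a::euclidean_space \<Rightarrow> complex"
  assumes f: "f \<in> L2"
  shows "\<exists>g. has_fourier f g"
proof -
  let ?c = "sqrt (2 * pi) ^ DIM('a)"
  let ?F = "\<lambda>R. fourier_integral (truncation R f)"
  have FL: "?F R \<in> L2" for R
    by (intro plancherel_L1_L2 truncation_L2 truncation_integrable f)
  have Fdiff: "L2norm (\<lambda>x. ?F R x - ?F S x) = ?c * L2norm (\<lambda>x. truncation R f x - truncation S f x)" for R S
    by (intro fourier_truncation_diff truncation_L2 truncation_integrable f)
  have lim: "((\<lambda>R. L2norm (\<lambda>x. truncation R f x - f x)) \<longlongrightarrow> 0) at_top"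
    using truncation_tendsto[OF f] by (simp add: L2_tendsto_def)
  have seq: "(\<lambda>k. L2norm (\<lambda>x. truncation (real k) f x - f x)) \<longlonglongrightarrow> 0"
    by (rule filterlim_compose[OF lim filterlim_real_sequentially])
  have tri: "L2norm (\<lambda>x. truncation R f x - truncation S f x)
      \<le> L2norm (\<lambda>x. truncation R f x - f x) + L2norm (\<lambda>x. truncation S f x - f x)" for R S
    using L2norm_triangle_diff[OF truncation_L2[OF f, of R] f truncation_L2[OF f, of S]]
    by (simp add: L2norm_minus_commute[of f])
  have "\<exists>g. L2_tendsto (\<lambda>k. ?F (real k)) g sequentially"
  proof (rule L2_complete)
    fix e :: real assume e: "e > 0"
    have c: "?c > 0" by simp
    with e have "e / (2 * ?c) > 0" by simp
    from LIMSEQ_D[OF seq this] obtain N where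
      N: "\<And>k. k \<ge> N \<Longrightarrow> L2norm (\<lambda>x. truncation (real k) f x - f x) < e / (2 * ?c)" by auto
    have "L2norm (\<lambda>x. ?F (real m) x - ?F (real n) x) < e" if "m \<ge> N" "n \<ge> N" for m n
    proof -
      have "L2norm (\<lambda>x. truncation (real m) f x - truncation (real n) f x) < e / (2 * ?c) + e / (2 * ?c)"
        using tri[of "real m" "real n"] N[OF that(1)] N[OF that(2)] by linarith
      also have "\<dots> = e / ?c" by simp
      finally show ?thesis
        unfolding Fdiff using c by (simp add: pos_less_divide_eq mult.commute)
    qed
    then show "\<exists>N. \<forall>m\<ge>N. \<forall>n\<ge>N. L2norm (\<lambda>x. ?F (real m) x - ?F (real n) x) < e" by blast
  qed (rule FL)
  then obtain g where g: "L2_tendsto (\<lambda>k. ?F (real k)) g sequentially" ..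
  have gL: "g \<in> L2" and g0: "(\<lambda>k. L2norm (\<lambda>x. ?F (real k) x - g x)) \<longlonglongrightarrow> 0"
    using g by (auto simp: L2_tendsto_def)
  \<comment> \<open>passing to the limit along the integers bounds the distance to \<open>g\<close> for every real radius\<close>
  have "L2norm (\<lambda>x. ?F R x - g x) \<le> ?c * L2norm (\<lambda>x. truncation R f x - f x)" for R
  proof -
    have "(\<lambda>k. ?c * (L2norm (\<lambda>x. truncation R f x - f x) + L2norm (\<lambda>x. truncation (real k) f x - f x))
              + L2norm (\<lambda>x. ?F (real k) x - g x))
        \<longlonglongrightarrow> ?c * (L2norm (\<lambda>x. truncation R f x - f x) + 0) + 0"
      by (intro tendsto_intros seq g0)
    moreover have "L2norm (\<lambda>x. ?F R x - g x)
       \<le> ?c * (L2norm (\<lambda>x. truncation R f x - f x) + L2norm (\<lambda>x. truncation (real k) f x - f x))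
              + L2norm (\<lambda>x. ?F (real k) x - g x)" for k
    proof -
      have "L2norm (\<lambda>x. ?F R x - ?F (real k) x)
        \<le> ?c * (L2norm (\<lambda>x. truncation R f x - f x) + L2norm (\<lambda>x. truncation (real k) f x - f x))"
        unfolding Fdiff by (intro mult_left_mono tri) auto
      then show ?thesis
        using L2norm_triangle_diff[OF FL[of R] FL[of "real k"] gL] by linarith
    qed
    ultimately show ?thesis
      using LIMSEQ_le_const by (metis (no_types, lifting) add.right_neutral)
  qed
  then have bound: "\<forall>\<^sub>F R in at_top. norm (L2norm (\<lambda>x. ?F R x - g x)) \<le> ?c * L2norm (\<lambda>x. truncation R f x - f x)"
    by simp
  have "((\<lambda>R. ?c * L2norm (\<lambda>x. truncation R f x - f x)) \<longlongrightarrow> ?c * 0) at_top"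
    by (intro tendsto_intros lim)
  then have "((\<lambda>R. L2norm (\<lambda>x. ?F R x - g x)) \<longlongrightarrow> 0) at_top"
    by (intro Lim_null_comparison[OF bound]) simp
  then show ?thesis
    unfolding has_fourier_def L2_tendsto_def using f gL FL by auto
qed

lemma has_fourier_L2: "has_fourier f g \<Longrightarrow> f \<in> L2" "has_fourier f g \<Longrightarrow> g \<in> L2"
  by (auto simp: has_fourier_def L2_tendsto_def)

lemma has_fourier_unique:
  "has_fourier f g \<Longrightarrow> has_fourier f h \<Longrightarrow> AE \<xi> in lebesgue. g \<xi> = h \<xi>"
  using L2_tendsto_unique[OF _ _ trivial_limit_at_top_linorder] by (auto simp: has_fourier_def)

lemma has_fourier_cong_transform:
  "has_fourier f g \<Longrightarrow> AE \<xi> in lebesgue. g \<xi> = h \<xi> \<Longrightarrow> has_fourier f h"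
  using L2_tendsto_cong_limit by (auto simp: has_fourier_def)

lemma plancherel:
  fixes f :: "'a::euclidean_space \<Rightarrow> complex"
  assumes "has_fourier f g"
  shows "L2norm g = sqrt (2 * pi) ^ DIM('a) * L2norm f"
proof -
  have f: "f \<in> L2" and g: "L2_tendsto (\<lambda>R. fourier_integral (truncation R f)) g at_top"
    using assms by (auto simp: has_fourier_def)
  have "((\<lambda>R. L2norm (fourier_integral (truncation R f))) \<longlongrightarrow> L2norm g) at_top"
    by (rule L2_tendsto_norm[OF g])
  moreover have "((\<lambda>R. L2norm (fourier_integral (truncation R f))) \<longlongrightarrow> sqrt (2 * pi) ^ DIM('a) * L2norm f) at_top"
    using plancherel_L1_L2(2)[OF truncation_integrable[OF f] truncation_L2[OF f]]
    by (auto intro!: tendsto_intros L2_tendsto_norm truncation_tendsto f)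
  ultimately show ?thesis
    by (rule tendsto_unique[OF trivial_limit_at_top_linorder])
qed

lemma has_fourier_add:
  assumes "has_fourier f g" "has_fourier h k"
  shows "has_fourier (\<lambda>x. f x + h x) (\<lambda>\<xi>. g \<xi> + k \<xi>)"
proof -
  have fh: "f \<in> L2" "h \<in> L2" using assms by (auto dest: has_fourier_L2)
  have "fourier_integral (truncation R (\<lambda>x. f x + h x))
      = (\<lambda>\<xi>. fourier_integral (truncation R f) \<xi> + fourier_integral (truncation R h) \<xi>)" for R
    unfolding fourier_integral_def
    using fourier_integral_integrable[OF truncation_integrable[OF fh(1)]]
      fourier_integral_integrable[OF truncation_integrable[OF fh(2)]]
    by (auto simp: algebra_simps scaleR_add_right)
  then show ?thesis
    using L2_tendsto_add[of _ g at_top _ k] assms fh by (auto simp: has_fourier_def intro: L2_add)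
qed

lemma has_fourier_scale:
  assumes "has_fourier f g"
  shows "has_fourier (\<lambda>x. c * f x) (\<lambda>\<xi>. c * g \<xi>)"
proof -
  have "fourier_integral (truncation R (\<lambda>x. c * f x)) = (\<lambda>\<xi>. c * fourier_integral (truncation R f) \<xi>)" for R
    unfolding fourier_integral_def
    by (simp flip: integral_mult_right_zero mult_scaleR_right) (simp add: mult.left_commute)
  then show ?thesis
    using L2_tendsto_scale[of _ g at_top c] assms by (auto simp: has_fourier_def intro: L2_scale)
qed

lemma has_fourier_diff:
  assumes "has_fourier f g" "has_fourier h k"
  shows "has_fourier (\<lambda>x. f x - h x) (\<lambda>\<xi>. g \<xi> - k \<xi>)"
  using has_fourier_add[OF assms(1) has_fourier_scale[OF assms(2), of "-1"]] by simp

lemma has_fourier_cong_function: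
  assumes "has_fourier f g" "AE x in lebesgue. f x = h x"
  shows "has_fourier h g"
proof -
  have f: "f \<in> L2" and h: "h \<in> L2"
    using assms L2_cong_AE(1) by (auto dest: has_fourier_L2)
  have "fourier_integral (truncation R f) = fourier_integral (truncation R h)" for R
  proof (rule fourier_integral_cong_AE)
    show "AE x in lebesgue. truncation R f x = truncation R h x"
      using assms(2) by eventually_elim simp
  qed (use truncation_L2[OF f] truncation_L2[OF h] in \<open>auto simp: L2_def\<close>)
  then show ?thesis using assms(1) h by (simp add: has_fourier_def)
qed

lemma L2_inner_tendsto:
  assumes U: "L2_tendsto U V F" and W: "L2_tendsto W Y F"
  shows "((\<lambda>h. LINT x|lebesgue. U h x * W h x) \<longlongrightarrow> (LINT x|lebesgue. V x * Y x)) F"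
proof (subst Lim_null)
  have V: "V \<in> L2" and Y: "Y \<in> L2" and ev: "\<forall>\<^sub>F h in F. U h \<in> L2 \<and> W h \<in> L2"
    using assms by (auto simp: L2_tendsto_def eventually_conj_iff)
  have "\<forall>\<^sub>F h in F. norm ((LINT x|lebesgue. U h x * W h x) - (LINT x|lebesgue. V x * Y x))
      \<le> L2norm (\<lambda>x. U h x - V x) * L2norm (W h) + L2norm V * L2norm (\<lambda>x. W h x - Y x)"
    using ev
  proof eventually_elim
    case (elim h)
    have "(LINT x|lebesgue. U h x * W h x) - (LINT x|lebesgue. V x * Y x)
        = (LINT x|lebesgue. (U h x - V x) * W h x) + (LINT x|lebesgue. V x * (W h x - Y x))"
      using elim V Y by (simp add: left_diff_distrib right_diff_distrib L2_times_integrable)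
    also have "norm \<dots> \<le> norm (LINT x|lebesgue. (U h x - V x) * W h x) + norm (LINT x|lebesgue. V x * (W h x - Y x))"
      by (rule norm_triangle_ineq)
    also have "\<dots> \<le> L2norm (\<lambda>x. U h x - V x) * L2norm (W h) + L2norm V * L2norm (\<lambda>x. W h x - Y x)"
      using elim V Y by (intro add_mono L2_inner_le L2_diff) auto
    finally show ?case .
  qed
  moreover have "((\<lambda>h. L2norm (\<lambda>x. U h x - V x) * L2norm (W h) + L2norm V * L2norm (\<lambda>x. W h x - Y x)) \<longlongrightarrow> 0) F"
  proof -
    have "((\<lambda>h. L2norm (\<lambda>x. U h x - V x) * L2norm (W h) + L2norm V * L2norm (\<lambda>x. W h x - Y x))
      \<longlongrightarrow> 0 * L2norm Y + L2norm V * 0) F"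
      using U W by (intro tendsto_intros L2_tendsto_norm) (auto simp: L2_tendsto_def)
    then show ?thesis by (simp only: mult_zero_left mult_zero_right add_0)
  qed
  ultimately show "((\<lambda>h. (LINT x|lebesgue. U h x * W h x) - (LINT x|lebesgue. V x * Y x)) \<longlongrightarrow> 0) F"
    by (rule Lim_null_comparison)
qed

lemma fourier_integral_symmetric_lebesgue:
  fixes f g :: "'a::euclidean_space \<Rightarrow> complex"
  assumes f: "integrable lebesgue f" and g: "integrable lebesgue g"
  shows "(LINT \<xi>|lebesgue. fourier_integral f \<xi> * g \<xi>) = (LINT x|lebesgue. f x * fourier_integral g x)"
proof -
  have fm: "f \<in> borel_measurable lebesgue" and gm: "g \<in> borel_measurable lebesgue" using f g by auto
  obtain f' g' where [measurable]: "f' \<in> borel_measurable borel" "g' \<in> borel_measurable borel"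
    and ae: "AE x in lebesgue. f x = f' x" "AE x in lebesgue. g x = g' x"
    using borel_representative[OF fm] borel_representative[OF gm] by metis
  have m: "f' \<in> borel_measurable lebesgue" "g' \<in> borel_measurable lebesgue"
    by (rule borel_imp_lebesgue, simp)+
  have i: "integrable lebesgue f'" "integrable lebesgue g'"
    using integrable_cong_AE_imp[OF f m(1)] integrable_cong_AE_imp[OF g m(2)] ae by (auto simp: eq_commute)
  then have i': "integrable lborel f'" "integrable lborel g'" by (simp_all add: integrable_completion)
  have F: "fourier_integral f = fourier_integral f'" "fourier_integral g = fourier_integral g'"
    by (intro fourier_integral_cong_AE fm gm m ae)+
  have [measurable]: "fourier_integral f' \<in> borel_measurable borel" "fourier_integral g' \<in> borel_measurable borel"
    using i by (auto intro: fourier_integral_measurable)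
  have [measurable]: "fourier_integral f' \<in> borel_measurable lebesgue" "fourier_integral g' \<in> borel_measurable lebesgue"
    by (rule borel_imp_lebesgue, simp)+
  note [measurable] = fm gm m
  have "(LINT \<xi>|lebesgue. fourier_integral f \<xi> * g \<xi>) = (LINT \<xi>|lebesgue. fourier_integral f' \<xi> * g' \<xi>)"
    unfolding F by (rule integral_cong_AE) (use ae in auto)
  also have "\<dots> = (LINT \<xi>|lborel. fourier_integral f' \<xi> * g' \<xi>)"
    by (rule integral_completion) simp
  also have "\<dots> = (LINT x|lborel. f' x * fourier_integral g' x)"
    by (rule fourier_integral_symmetric[OF i'])
  also have "\<dots> = (LINT x|lebesgue. f' x * fourier_integral g' x)"
    by (rule integral_completion[symmetric]) simp
  also have "\<dots> = (LINT x|lebesgue. f x * fourier_integral g x)"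
    unfolding F by (rule integral_cong_AE) (use ae in auto)
  finally show ?thesis .
qed

text \<open>The symmetry of the Fourier integral passes to the limit along the truncations.\<close>

lemma has_fourier_symmetric:
  fixes f h :: "'a::euclidean_space \<Rightarrow> complex"
  assumes f: "has_fourier f g" and h: "has_fourier h k"
  shows "(LINT \<xi>|lebesgue. g \<xi> * h \<xi>) = (LINT x|lebesgue. f x * k x)"
proof (rule tendsto_unique[OF trivial_limit_at_top_linorder])
  have L: "f \<in> L2" "h \<in> L2" using f h by (auto dest: has_fourier_L2)
  show "((\<lambda>R. LINT \<xi>|lebesgue. fourier_integral (truncation R f) \<xi> * truncation R h \<xi>)
     \<longlongrightarrow> (LINT \<xi>|lebesgue. g \<xi> * h \<xi>)) at_top"
    using f truncation_tendsto[OF L(2)] by (intro L2_inner_tendsto) (auto simp: has_fourier_def)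
  have "((\<lambda>R. LINT x|lebesgue. truncation R f x * fourier_integral (truncation R h) x)
     \<longlongrightarrow> (LINT x|lebesgue. f x * k x)) at_top"
    using h truncation_tendsto[OF L(1)] by (intro L2_inner_tendsto) (auto simp: has_fourier_def)
  then show "((\<lambda>R. LINT \<xi>|lebesgue. fourier_integral (truncation R f) \<xi> * truncation R h \<xi>)
     \<longlongrightarrow> (LINT x|lebesgue. f x * k x)) at_top"
    using fourier_integral_symmetric_lebesgue[OF truncation_integrable[OF L(1)] truncation_integrable[OF L(2)]]
    by simp
qed

text \<open>Surjectivity follows without an inversion formula. \<open>F\<close> is symmetric for the bilinear pairing and
  isometric up to a factor; for \<open>f = (2\<pi>)^(-n) cnj (F (cnj g))\<close> these two facts evaluate all three
  terms in the expansion of \<open>\<parallel>F f - g\<parallel>\<^sup>2\<close>, and they cancel.\<close>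

lemma has_fourier_surj:
  fixes g :: "'a::euclidean_space \<Rightarrow> complex"
  assumes g: "g \<in> L2"
  shows "\<exists>f. has_fourier f g"
proof -
  define c where "c = sqrt (2 * pi) ^ DIM('a)"
  have c: "c > 0" by (simp add: c_def)
  obtain k where k: "has_fourier (\<lambda>x. cnj (g x)) k"
    using has_fourier_exists[OF L2_cnj[OF g]] ..
  define f where "f x = complex_of_real (1 / c\<^sup>2) * cnj (k x)" for x
  have kL: "k \<in> L2" using k by (rule has_fourier_L2)
  have fL: "f \<in> L2" unfolding f_def by (intro L2_scale L2_cnj kL)
  obtain G where G: "has_fourier f G" using has_fourier_exists[OF fL] ..
  have GL: "G \<in> L2" using G by (rule has_fourier_L2)
  have nk: "L2norm k = c * L2norm g"
    using plancherel[OF k] by (simp add: c_def)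
  have "L2norm f = (1 / c\<^sup>2) * L2norm k"
    unfolding f_def using L2norm_scale[of "complex_of_real (1 / c\<^sup>2)" "\<lambda>x. cnj (k x)"]
    by (simp add: norm_divide norm_power)
  then have nG: "L2norm G = L2norm g"
    using plancherel[OF G, folded c_def] c by (simp add: nk power2_eq_square field_simps)
  have "(LINT \<xi>|lebesgue. G \<xi> * cnj (g \<xi>)) = (LINT x|lebesgue. f x * k x)"
    by (rule has_fourier_symmetric[OF G k])
  also have "\<dots> = (LINT x|lebesgue. complex_of_real (1 / c\<^sup>2 * (cmod (k x))\<^sup>2))"
    unfolding f_def of_real_mult complex_norm_square by (simp add: mult_ac)
  also have "\<dots> = complex_of_real (1 / c\<^sup>2 * (L2norm k)\<^sup>2)"
    unfolding integral_complex_of_real L2norm_square integral_mult_right_zero ..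
  also have "1 / c\<^sup>2 * (L2norm k)\<^sup>2 = (L2norm g)\<^sup>2"
    using c by (simp add: nk power_mult_distrib)
  finally have inner: "(LINT \<xi>|lebesgue. G \<xi> * cnj (g \<xi>)) = complex_of_real ((L2norm g)\<^sup>2)" .
  have "(L2norm (\<lambda>x. G x - g x))\<^sup>2
      = (LINT x|lebesgue. (cmod (G x))\<^sup>2 + (cmod (g x))\<^sup>2 - 2 * Re (G x * cnj (g x)))"
    unfolding L2norm_square by (rule Bochner_Integration.integral_cong[OF refl])
      (simp add: cmod_power2, simp add: power2_eq_square algebra_simps)
  also have "\<dots> = (L2norm G)\<^sup>2 + (L2norm g)\<^sup>2 - 2 * Re (LINT \<xi>|lebesgue. G \<xi> * cnj (g \<xi>))"
    unfolding L2norm_square using L2_integrable[OF GL] L2_integrable[OF g] L2_times_integrable[OF GL L2_cnj[OF g]]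
    by (simp del: times_complex.sel)
  also have "\<dots> = 0" unfolding inner nG by simp
  finally have "AE x in lebesgue. G x = g x"
    by (intro L2norm_diff_eq_0 GL g) simp
  then show ?thesis using has_fourier_cong_transform[OF G] by blast
qed

lemma has_fourier_fourier: "f \<in> L2 \<Longrightarrow> has_fourier f (fourier f)"
  unfolding fourier_def using has_fourier_exists[of f] someI_ex[of "has_fourier f"] by blast

lemma has_fourier_inv_fourier: "g \<in> L2 \<Longrightarrow> has_fourier (inv_fourier g) g"
  unfolding inv_fourier_def using has_fourier_surj[of g] someI_ex[of "\<lambda>f. has_fourier f g"] by blast

lemma fourier_eq_AE: "has_fourier f g \<Longrightarrow> AE \<xi> in lebesgue. fourier f \<xi> = g \<xi>"
  using has_fourier_unique[OF has_fourier_fourier] has_fourier_L2(1) by blast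

section \<open>The damped oscillator\<close>

lemma has_vector_derivative_scaleR_const:
  "(f has_vector_derivative f') F \<Longrightarrow> ((\<lambda>t. c *\<^sub>R f t) has_vector_derivative c *\<^sub>R f') F"
  by (rule bounded_linear.has_vector_derivative[OF bounded_linear_scaleR_right])

text \<open>The condition \<open>a \<le> b\<^sup>2\<close> admits complex and double characteristic roots, so the uniform bounds below are
  derived from an energy and not from the roots.\<close>

locale damped_oscillator =
  fixes a b :: real and z z' z'' :: "real \<Rightarrow> complex"
  assumes a_pos: "a > 0" and b_pos: "b > 0" and a_le: "a \<le> b\<^sup>2"
    and deriv: "t \<ge> 0 \<Longrightarrow> (z has_vector_derivative z' t) (at t within {0..})"
    and deriv': "t \<ge> 0 \<Longrightarrow> (z' has_vector_derivative z'' t) (at t within {0..})"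
    and equation: "t \<ge> 0 \<Longrightarrow> z'' t + b *\<^sub>R z' t + a *\<^sub>R z t = 0"
begin

lemma z''_eq: "t \<ge> 0 \<Longrightarrow> z'' t = - (b *\<^sub>R z' t) - a *\<^sub>R z t"
  using equation[of t] by (simp add: eq_neg_iff_add_eq_0 algebra_simps)

text \<open>The square \<open>|z' + b z|\<^sup>2\<close> contributes the cross term of \<open>z\<close> and \<open>z'\<close> that makes the derivative a sum
  of negative squares: it equals \<open>- b |z'|\<^sup>2 - a b |z|\<^sup>2\<close>.\<close>

definition lyapunov :: "real \<Rightarrow> real" where
  "lyapunov t = (norm (z' t))\<^sup>2 / 2 + (norm (z' t + b *\<^sub>R z t))\<^sup>2 / 2 + a * (norm (z t))\<^sup>2"

lemma lyapunov_deriv: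
  assumes t: "t \<ge> 0"
  shows "(lyapunov has_real_derivative - (b * (norm (z' t))\<^sup>2 + a * b * (norm (z t))\<^sup>2)) (at t within {0..})"
proof -
  have sq: "((\<lambda>t. (norm (f t))\<^sup>2) has_real_derivative 2 * (f t \<bullet> f')) (at t within {0..})"
    if "(f has_vector_derivative f') (at t within {0..})" for f :: "real \<Rightarrow> complex" and f'
  proof -
    have "((\<lambda>t. f t \<bullet> f t) has_vector_derivative f t \<bullet> f' + f' \<bullet> f t) (at t within {0..})"
      by (rule bounded_bilinear.has_vector_derivative[OF bounded_bilinear_inner that that])
    then show ?thesis
      by (simp add: has_real_derivative_iff_has_vector_derivative power2_norm_eq_inner inner_commute)
  qed
  have d: "((\<lambda>t. z' t + b *\<^sub>R z t) has_vector_derivative z'' t + b *\<^sub>R z' t) (at t within {0..})"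
    by (intro has_vector_derivative_add has_vector_derivative_scaleR_const deriv deriv' t)
  have eq: "z'' t + b *\<^sub>R z' t = - (a *\<^sub>R z t)"
    using equation[OF t] by (simp add: eq_neg_iff_add_eq_0)
  have "(lyapunov has_real_derivative
      (2 * (z' t \<bullet> z'' t)) / 2 + (2 * ((z' t + b *\<^sub>R z t) \<bullet> (z'' t + b *\<^sub>R z' t))) / 2
        + a * (2 * (z t \<bullet> z' t))) (at t within {0..})"
    unfolding lyapunov_def[abs_def]
    by (intro DERIV_add DERIV_cdivide DERIV_cmult sq deriv deriv' d t)
  also have "(2 * (z' t \<bullet> z'' t)) / 2 + (2 * ((z' t + b *\<^sub>R z t) \<bullet> (z'' t + b *\<^sub>R z' t))) / 2
        + a * (2 * (z t \<bullet> z' t)) = - (b * (norm (z' t))\<^sup>2 + a * b * (norm (z t))\<^sup>2)"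
    unfolding eq z''_eq[OF t] power2_norm_eq_inner
    by (simp add: inner_diff_right inner_add_left inner_commute algebra_simps add_divide_distrib diff_divide_distrib)
  finally show ?thesis .
qed

text \<open>The slow mode decays at the rate \<open>a / b\<close> when \<open>a\<close> is small compared with \<open>b\<^sup>2\<close>; the hypothesis
  \<open>a \<le> b\<^sup>2\<close> is what lets the energy keep up with a fixed fraction of this rate.\<close>

lemma lyapunov_rate: "a / (2 * b) * lyapunov t \<le> b * (norm (z' t))\<^sup>2 + a * b * (norm (z t))\<^sup>2"
proof -
  let ?x = "norm (z' t)" and ?y = "norm (z t)"
  have "norm (z' t + b *\<^sub>R z t) \<le> ?x + b * ?y"
    using norm_triangle_ineq[of "z' t" "b *\<^sub>R z t"] b_pos by simp
  then have "(norm (z' t + b *\<^sub>R z t))\<^sup>2 \<le> (?x + b * ?y)\<^sup>2"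
    by (intro power_mono) auto
  also have "\<dots> \<le> 2 * ?x\<^sup>2 + 2 * (b * ?y)\<^sup>2"
    using sum_squares_bound[of ?x "b * ?y"] by (simp add: power2_sum)
  finally have "lyapunov t \<le> (3/2) * ?x\<^sup>2 + (b\<^sup>2 + a) * ?y\<^sup>2"
    unfolding lyapunov_def by (simp add: algebra_simps power_mult_distrib)
  also have "\<dots> \<le> 2 * ?x\<^sup>2 + (2 * b\<^sup>2) * ?y\<^sup>2"
    using a_le by (intro add_mono mult_right_mono) auto
  finally have "a / (2 * b) * lyapunov t \<le> a / (2 * b) * (2 * ?x\<^sup>2 + (2 * b\<^sup>2) * ?y\<^sup>2)"
    using a_pos b_pos by (intro mult_left_mono) auto
  also have "\<dots> = (a / b) * ?x\<^sup>2 + a * b * ?y\<^sup>2"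
    using b_pos by (simp add: field_simps power2_eq_square)
  also have "\<dots> \<le> b * ?x\<^sup>2 + a * b * ?y\<^sup>2"
    using a_le b_pos by (intro add_mono mult_right_mono) (auto simp: field_simps power2_eq_square)
  finally show ?thesis .
qed

text \<open>Gronwall's argument: the energy multiplied by the reciprocal of the claimed bound is decreasing.\<close>

lemma lyapunov_decay:
  assumes t: "t \<ge> 0"
  shows "lyapunov t \<le> exp (- (a / (2 * b)) * t) * lyapunov 0"
proof (cases "t = 0")
  case False
  with t have t0: "0 < t" by simp
  let ?c = "a / (2 * b)"
  let ?f = "\<lambda>t. exp (?c * t) * lyapunov t"
  have d: "(?f has_real_derivative exp (?c * x) * ?c * lyapunov x
      + (- (b * (norm (z' x))\<^sup>2 + a * b * (norm (z x))\<^sup>2)) * exp (?c * x)) (at x within {0..})" if "x \<ge> 0" for x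
    by (rule DERIV_mult lyapunov_deriv that | rule derivative_eq_intros refl | simp)+
  have "?f t \<le> ?f 0"
  proof (rule DERIV_nonpos_imp_decreasing_open[OF t])
    fix x assume x: "0 < x" "x < t"
    have "at x within {0..} = at x"
      using x by (intro at_within_interior) (auto simp: interior_Ici)
    moreover have "exp (?c * x) * ?c * lyapunov x
      + (- (b * (norm (z' x))\<^sup>2 + a * b * (norm (z x))\<^sup>2)) * exp (?c * x) \<le> 0"
    proof -
      have "exp (?c * x) * ?c * lyapunov x
      + (- (b * (norm (z' x))\<^sup>2 + a * b * (norm (z x))\<^sup>2)) * exp (?c * x)
        = exp (?c * x) * (?c * lyapunov x - (b * (norm (z' x))\<^sup>2 + a * b * (norm (z x))\<^sup>2))"
        by (simp add: algebra_simps)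
      also have "\<dots> \<le> 0"
        using lyapunov_rate[of x] by (intro mult_nonneg_nonpos) auto
      finally show ?thesis .
    qed
    ultimately show "\<exists>y. (?f has_real_derivative y) (at x) \<and> y \<le> 0"
      using d[of x] x by auto
  next
    have "continuous_on {0..} ?f"
      using d by (intro DERIV_continuous_on) auto
    then show "continuous_on {0..t} ?f"
      by (rule continuous_on_subset) auto
  qed
  then have "lyapunov t \<le> exp (- (?c * t)) * lyapunov 0"
    by (simp add: exp_minus field_simps)
  then show ?thesis by simp
qed simp

text \<open>The initial energy is bounded by a multiple of the square of this quantity.\<close>

definition data :: real where
  "data = norm (z' 0) + b * norm (z 0)"

lemma data_nonneg: "data \<ge> 0"
  unfolding data_def using b_pos by simp

lemma lyapunov_bound:
  assumes t: "t \<ge> 0"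
  shows "lyapunov t \<le> 2 * (data * exp (- (a / (4 * b)) * t))\<^sup>2"
proof -
  let ?x = "norm (z' 0)" and ?y = "norm (z 0)"
  have "norm (z' 0 + b *\<^sub>R z 0) \<le> data"
    using norm_triangle_ineq[of "z' 0" "b *\<^sub>R z 0"] b_pos by (simp add: data_def)
  then have "(norm (z' 0 + b *\<^sub>R z 0))\<^sup>2 \<le> data\<^sup>2"
    by (intro power_mono) auto
  moreover have "a * ?y\<^sup>2 \<le> b\<^sup>2 * ?y\<^sup>2"
    using a_le by (intro mult_right_mono) auto
  moreover have "?x\<^sup>2 + (b\<^sup>2 * ?y\<^sup>2) \<le> data\<^sup>2"
    unfolding data_def using b_pos by (simp add: power2_sum power_mult_distrib)
  moreover have "0 \<le> b\<^sup>2 * ?y\<^sup>2" "0 \<le> ?x\<^sup>2" by auto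
  ultimately have L0: "lyapunov 0 \<le> 2 * data\<^sup>2"
    unfolding lyapunov_def by linarith
  have e: "exp (- (a / (2 * b)) * t) = (exp (- (a / (4 * b)) * t))\<^sup>2"
    unfolding exp_double[symmetric] by (simp add: field_simps)
  have "lyapunov t \<le> exp (- (a / (2 * b)) * t) * lyapunov 0"
    by (rule lyapunov_decay[OF t])
  also have "\<dots> \<le> exp (- (a / (2 * b)) * t) * (2 * data\<^sup>2)"
    using L0 by (intro mult_left_mono) auto
  also have "\<dots> = 2 * (data * exp (- (a / (4 * b)) * t))\<^sup>2"
    unfolding e by (simp add: power_mult_distrib)
  finally show ?thesis .
qed

lemma position_bound:
  assumes t: "t \<ge> 0"
  shows "b * norm (z t) \<le> 3 * data * exp (- (a / (4 * b)) * t)"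
proof (rule power2_le_imp_le)
  let ?E = "data * exp (- (a / (4 * b)) * t)"
  have "b * norm (z t) = norm ((z' t + b *\<^sub>R z t) - z' t)" using b_pos by simp
  also have "\<dots> \<le> norm (z' t + b *\<^sub>R z t) + norm (z' t)" by (rule norm_triangle_ineq4)
  finally have "(b * norm (z t))\<^sup>2 \<le> (norm (z' t + b *\<^sub>R z t) + norm (z' t))\<^sup>2"
    using b_pos by (intro power_mono) auto
  also have "\<dots> \<le> 2 * (norm (z' t + b *\<^sub>R z t))\<^sup>2 + 2 * (norm (z' t))\<^sup>2"
    using sum_squares_bound[of "norm (z' t + b *\<^sub>R z t)" "norm (z' t)"] by (simp add: power2_sum)
  also have "\<dots> \<le> 4 * lyapunov t"
    unfolding lyapunov_def using a_pos by simp
  also have "\<dots> \<le> 9 * ?E\<^sup>2"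
    using lyapunov_bound[OF t] zero_le_power2[of ?E] by linarith
  finally show "(b * norm (z t))\<^sup>2 \<le> (3 * data * exp (- (a / (4 * b)) * t))\<^sup>2"
    by (simp add: power_mult_distrib)
qed (use data_nonneg in auto)

lemma velocity_bound:
  assumes t: "t \<ge> 0"
  shows "norm (z' t) \<le> 2 * data * exp (- (a / (4 * b)) * t)"
proof (rule power2_le_imp_le)
  have "(norm (z' t))\<^sup>2 \<le> 2 * lyapunov t"
    unfolding lyapunov_def using a_pos by simp
  also have "\<dots> \<le> 4 * (data * exp (- (a / (4 * b)) * t))\<^sup>2"
    using lyapunov_bound[OF t] by simp
  finally show "(norm (z' t))\<^sup>2 \<le> (2 * data * exp (- (a / (4 * b)) * t))\<^sup>2"
    by (simp add: power_mult_distrib)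
qed (use data_nonneg in auto)

text \<open>Duhamel's principle for the fast mode: \<open>(e^(b t) z')' = - a e^(b t) z\<close>, where \<open>z\<close> decays at the slow
  rate. Where \<open>a\<close> is small compared with \<open>b\<^sup>2\<close>, the second term is smaller than the preceding bound by
  the factor \<open>a / b\<^sup>2\<close>, and the first one decays fast.\<close>

lemma velocity_bound_slow:
  assumes t: "t \<ge> 0"
  shows "norm (z' t) \<le> exp (- b * t) * norm (z' 0) + 4 * (a / b\<^sup>2) * data * exp (- (a / (4 * b)) * t)"
proof (cases "t = 0")
  case True
  then show ?thesis using a_pos b_pos data_nonneg by simp
next
  case False
  with t have t0: "0 < t" by simp
  let ?m = "b - a / (4 * b)"
  have m: "?m \<ge> 3 / 4 * b"
    using a_le b_pos by (simp add: field_simps power2_eq_square)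
  then have m0: "?m > 0" using b_pos by (smt (verit) mult_pos_pos zero_less_divide_iff)
  let ?w = "\<lambda>t. exp (b * t) *\<^sub>R z' t"
  let ?C = "3 * (a / b) * data"
  let ?\<phi> = "\<lambda>t. ?C / ?m * exp (?m * t)"
  have dw: "(?w has_vector_derivative - ((a * exp (b * x)) *\<^sub>R z x)) (at x within {0..})" if x: "x \<ge> 0" for x
  proof -
    have "(?w has_vector_derivative exp (b * x) *\<^sub>R z'' x + (exp (b * x) * b) *\<^sub>R z' x) (at x within {0..})"
      by (rule has_vector_derivative_scaleR deriv' x derivative_eq_intros refl | simp)+
    then show ?thesis
      using x by (simp add: z''_eq scaleR_diff_right algebra_simps)
  qed
  have "norm (?w t - ?w 0) \<le> ?\<phi> t - ?\<phi> 0"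
  proof (rule differentiable_bound_general[OF t0])
    have "continuous_on {0..} ?w"
      using dw by (intro continuous_on_vector_derivative) auto
    then show "continuous_on {0..t} ?w"
      by (rule continuous_on_subset) auto
    show "continuous_on {0..t} ?\<phi>" by (intro continuous_intros)
    fix x assume x: "0 < x" "x < t"
    have "at x within {0..} = at x"
      using x by (intro at_within_interior) (auto simp: interior_Ici)
    then show "(?w has_vector_derivative - ((a * exp (b * x)) *\<^sub>R z x)) (at x)"
      using dw[of x] x by simp
    show "(?\<phi> has_vector_derivative ?C * exp (?m * x)) (at x)"
      unfolding has_real_derivative_iff_has_vector_derivative[symmetric]
      using m0 by (auto intro!: derivative_eq_intros)
    have "norm (- ((a * exp (b * x)) *\<^sub>R z x)) = (a / b) * exp (b * x) * (b * norm (z x))"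
      using a_pos b_pos by simp
    also have "\<dots> \<le> (a / b) * exp (b * x) * (3 * data * exp (- (a / (4 * b)) * x))"
      using position_bound[of x] x a_pos b_pos by (intro mult_left_mono) auto
    also have "\<dots> = ?C * (exp (b * x) * exp (- (a / (4 * b)) * x))"
      by simp
    also have "exp (b * x) * exp (- (a / (4 * b)) * x) = exp (?m * x)"
      unfolding exp_add[symmetric] by (simp add: algebra_simps)
    finally show "norm (- ((a * exp (b * x)) *\<^sub>R z x)) \<le> ?C * exp (?m * x)" .
  qed
  moreover have "?\<phi> 0 \<ge> 0" using m0 a_pos b_pos data_nonneg by simp
  ultimately have "norm (?w t) \<le> norm (z' 0) + ?\<phi> t"
    using norm_triangle_sub[of "?w t" "?w 0"] by simp
  then have "exp (- b * t) * norm (?w t) \<le> exp (- b * t) * (norm (z' 0) + ?\<phi> t)"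
    by (intro mult_left_mono) auto
  then have "exp (- b * t) * norm (?w t) \<le> exp (- b * t) * norm (z' 0) + exp (- b * t) * ?\<phi> t"
    by (simp only: distrib_left)
  moreover have "exp (- b * t) * norm (?w t) = norm (z' t)"
    by (simp add: exp_minus field_simps)
  moreover have "exp (- b * t) * ?\<phi> t \<le> 4 * (a / b\<^sup>2) * data * exp (- (a / (4 * b)) * t)"
  proof -
    have "exp (- b * t) * ?\<phi> t = ?C / ?m * (exp (- b * t) * exp (?m * t))" by simp
    also have "exp (- b * t) * exp (?m * t) = exp (- (a / (4 * b)) * t)"
      unfolding exp_add[symmetric] by (simp add: algebra_simps)
    also have "?C / ?m \<le> ?C / (3 / 4 * b)"
      using m m0 b_pos a_pos data_nonneg by (intro divide_left_mono) auto
    also have "?C / (3 / 4 * b) = 4 * (a / b\<^sup>2) * data"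
      using b_pos by (simp add: field_simps power2_eq_square)
    finally show ?thesis by (simp add: mult_right_mono)
  qed
  ultimately show ?thesis by linarith
qed

text \<open>If \<open>\<rho>\<close> and \<open>\<mu>\<close> are the two characteristic roots, \<open>z' - \<rho> z\<close> is a pure exponential with rate \<open>\<mu>\<close>.\<close>

lemma root_exponential:
  assumes sum: "\<rho> + \<mu> = - b" and prod: "\<rho> * \<mu> = a" and t: "t \<ge> 0"
  shows "z' t - \<rho> *\<^sub>R z t = exp (\<mu> * t) *\<^sub>R (z' 0 - \<rho> *\<^sub>R z 0)"
proof -
  let ?p = "\<lambda>t. exp (- \<mu> * t) *\<^sub>R (z' t - \<rho> *\<^sub>R z t)"
  have "(?p has_vector_derivative 0) (at x within {0..})" if x: "x \<in> {0..}" for x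
  proof -
    have x: "x \<ge> 0" using that by simp
    have d: "((\<lambda>t. z' t - \<rho> *\<^sub>R z t) has_vector_derivative z'' x - \<rho> *\<^sub>R z' x) (at x within {0..})"
      by (intro has_vector_derivative_diff has_vector_derivative_scaleR_const deriv deriv' x)
    have "(?p has_vector_derivative exp (- \<mu> * x) *\<^sub>R (z'' x - \<rho> *\<^sub>R z' x)
        + (exp (- \<mu> * x) * (- \<mu>)) *\<^sub>R (z' x - \<rho> *\<^sub>R z x)) (at x within {0..})"
      by (rule has_vector_derivative_scaleR d derivative_eq_intros refl | simp)+
    also have "exp (- \<mu> * x) *\<^sub>R (z'' x - \<rho> *\<^sub>R z' x) + (exp (- \<mu> * x) * (- \<mu>)) *\<^sub>R (z' x - \<rho> *\<^sub>R z x)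
      = exp (- \<mu> * x) *\<^sub>R (z'' x - (\<rho> + \<mu>) *\<^sub>R z' x + (\<rho> * \<mu>) *\<^sub>R z x)"
      by (simp add: algebra_simps)
    also have "\<dots> = 0"
      unfolding sum prod using equation[OF x] by simp
    finally show ?thesis .
  qed
  then obtain c where "\<And>x. x \<in> {0..} \<Longrightarrow> ?p x = c"
    using has_vector_derivative_zero_constant[of "{0..}" ?p] by auto
  from this[of t] this[of 0] t have "?p t = ?p 0" by auto
  then have "exp (\<mu> * t) *\<^sub>R ?p t = exp (\<mu> * t) *\<^sub>R ?p 0" by simp
  then show ?thesis by (simp add: exp_minus)
qed

lemma root_representation:
  assumes D: "4 * a < b\<^sup>2" and t: "t \<ge> 0"
  defines "d \<equiv> sqrt (b\<^sup>2 - 4 * a)"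
  defines "\<rho> \<equiv> (- b + d) / 2" and "\<mu> \<equiv> (- b - d) / 2"
  shows "d *\<^sub>R z t = exp (\<rho> * t) *\<^sub>R (z' 0 - \<mu> *\<^sub>R z 0) - exp (\<mu> * t) *\<^sub>R (z' 0 - \<rho> *\<^sub>R z 0)"
    and "d *\<^sub>R z' t = (\<rho> * exp (\<rho> * t)) *\<^sub>R (z' 0 - \<mu> *\<^sub>R z 0) - (\<mu> * exp (\<mu> * t)) *\<^sub>R (z' 0 - \<rho> *\<^sub>R z 0)"
proof -
  have d2: "d\<^sup>2 = b\<^sup>2 - 4 * a" using D by (simp add: d_def)
  have sum: "\<rho> + \<mu> = - b" "\<mu> + \<rho> = - b" by (simp_all add: \<rho>_def \<mu>_def field_simps)
  have prod: "\<rho> * \<mu> = a" "\<mu> * \<rho> = a"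
    using d2 by (simp_all add: \<rho>_def \<mu>_def field_simps power2_eq_square)
  have dd: "d = \<rho> - \<mu>" by (simp add: \<rho>_def \<mu>_def field_simps)
  note p = root_exponential[OF sum(1) prod(1) t] root_exponential[OF sum(2) prod(2) t]
  show "d *\<^sub>R z t = exp (\<rho> * t) *\<^sub>R (z' 0 - \<mu> *\<^sub>R z 0) - exp (\<mu> * t) *\<^sub>R (z' 0 - \<rho> *\<^sub>R z 0)"
    unfolding p[symmetric] dd by (simp add: algebra_simps)
  show "d *\<^sub>R z' t = (\<rho> * exp (\<rho> * t)) *\<^sub>R (z' 0 - \<mu> *\<^sub>R z 0) - (\<mu> * exp (\<mu> * t)) *\<^sub>R (z' 0 - \<rho> *\<^sub>R z 0)"
    unfolding scaleR_scaleR[symmetric] p[symmetric] dd by (simp add: algebra_simps)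
qed

end

section \<open>The slow mode in the overdamped limit\<close>

text \<open>Oscillators whose coefficients tend to \<open>0\<close> with \<open>a\<close> much smaller than \<open>b\<^sup>2\<close>, observed at times
  comparable with \<open>b / a\<close>. The slow root is \<open>- a / b\<close> to leading order, and the fast mode has died
  out because \<open>b T \<rightarrow> \<infinity>\<close>. In the velocity the fast mode carries the large factor \<open>b\<^sup>2 / a\<close>, which
  is comparable with \<open>b T\<close> and is beaten by \<open>exp (- b T / 2)\<close>.\<close>

lemma overdamped_limit:
  fixes A B T :: "nat \<Rightarrow> real" and Z0 Z1 Z Z' :: "nat \<Rightarrow> complex"
  assumes pos: "\<And>k. A k > 0" "\<And>k. B k > 0"
    and osc: "\<forall>\<^sub>F k in sequentially. T k > 0 \<and> (\<exists>z z' z''. damped_oscillator (A k) (B k) z z' z'' \<and>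
        z 0 = Z0 k \<and> z' 0 = Z1 k \<and> z (T k) = Z k \<and> z' (T k) = Z' k)"
    and B0: "B \<longlonglongrightarrow> 0" and AB: "(\<lambda>k. A k / (B k)\<^sup>2) \<longlonglongrightarrow> 0"
    and slow: "(\<lambda>k. A k / B k * T k) \<longlonglongrightarrow> \<tau>" and \<tau>: "\<tau> > 0"
    and fast: "filterlim (\<lambda>k. B k * T k) at_top sequentially"
    and Z0: "\<And>k. cmod (Z0 k) \<le> M" and Z1: "Z1 \<longlonglongrightarrow> P"
  shows "(\<lambda>k. B k *\<^sub>R Z k) \<longlonglongrightarrow> exp (- \<tau>) *\<^sub>R P"
    and "(\<lambda>k. ((B k)\<^sup>2 / A k) *\<^sub>R Z' k) \<longlonglongrightarrow> - (exp (- \<tau>) *\<^sub>R P)"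
proof -
  \<comment> \<open>\<open>B x\<close> is the difference of the roots \<open>\<rho>\<close> and \<open>\<mu>\<close>\<close>
  define x where "x k = sqrt (1 - 4 * (A k / (B k)\<^sup>2))" for k
  define \<rho> where "\<rho> k = (- B k + B k * x k) / 2" for k
  define \<mu> where "\<mu> k = (- B k - B k * x k) / 2" for k
  have x1: "x \<longlonglongrightarrow> 1"
  proof -
    have "(\<lambda>k. sqrt (1 - 4 * (A k / (B k)\<^sup>2))) \<longlonglongrightarrow> sqrt (1 - 4 * 0)"
      by (intro tendsto_intros AB)
    then show ?thesis by (simp add: x_def[abs_def])
  qed
  have "\<forall>\<^sub>F k in sequentially. A k / (B k)\<^sup>2 < 1 / 4"
    using AB by (rule order_tendstoD) simp
  moreover have "\<forall>\<^sub>F k in sequentially. B k * T k \<ge> 1"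
    using fast by (simp add: filterlim_at_top)
  moreover have "\<forall>\<^sub>F k in sequentially. x k > 0"
    using x1 by (rule order_tendstoD) simp
  ultimately have ev: "\<forall>\<^sub>F k in sequentially. T k > 0 \<and> x k > 0 \<and> 4 * A k < (B k)\<^sup>2 \<and>
      x k *\<^sub>R (B k *\<^sub>R Z k) = exp (\<rho> k * T k) *\<^sub>R (Z1 k - \<mu> k *\<^sub>R Z0 k) - exp (\<mu> k * T k) *\<^sub>R (Z1 k - \<rho> k *\<^sub>R Z0 k) \<and>
      x k *\<^sub>R (B k *\<^sub>R Z' k) = (\<rho> k * exp (\<rho> k * T k)) *\<^sub>R (Z1 k - \<mu> k *\<^sub>R Z0 k)
          - (\<mu> k * exp (\<mu> k * T k)) *\<^sub>R (Z1 k - \<rho> k *\<^sub>R Z0 k)"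
    using osc
  proof eventually_elim
    case (elim k)
    have D: "4 * A k < (B k)\<^sup>2" using elim(1) pos[of k] by (simp add: field_simps)
    have "sqrt ((B k)\<^sup>2 - 4 * A k) = sqrt ((B k)\<^sup>2 * (1 - 4 * (A k / (B k)\<^sup>2)))"
      using pos(2)[of k] by (simp add: field_simps)
    also have "\<dots> = B k * x k"
      using pos(2)[of k] by (simp add: real_sqrt_mult x_def)
    finally have d: "sqrt ((B k)\<^sup>2 - 4 * A k) = B k * x k" .
    obtain z z' z'' where osc: "damped_oscillator (A k) (B k) z z' z''"
      and zs: "z 0 = Z0 k" "z' 0 = Z1 k" "z (T k) = Z k" "z' (T k) = Z' k" and Tk: "T k > 0"
      using elim by blast
    note rep = damped_oscillator.root_representation[OF osc D less_imp_le[OF Tk], unfolded d zs]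
    show ?case
      using elim(3) D Tk rep by (simp add: \<rho>_def \<mu>_def mult.commute)
  qed
  have \<rho>eq: "\<forall>\<^sub>F k in sequentially. \<rho> k = - 2 * (A k / B k) / (1 + x k)"
    using ev
  proof eventually_elim
    case (elim k)
    have "(x k)\<^sup>2 = 1 - 4 * (A k / (B k)\<^sup>2)"
      unfolding x_def using elim pos(2)[of k] by (subst real_sqrt_pow2) (auto simp: field_simps)
    then have "(1 - x k) * (1 + x k) = 4 * (A k / (B k)\<^sup>2)"
      by (simp add: power2_eq_square algebra_simps)
    then have eq: "B k * ((1 - x k) * (1 + x k)) = 4 * (A k / B k)"
      using pos(2)[of k] by (simp add: power2_eq_square)
    have "1 + x k \<noteq> 0" using elim by auto
    then have "B k * (1 - x k) = B k * ((1 - x k) * (1 + x k)) / (1 + x k)"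
      by simp
    then have "B k * (1 - x k) = 4 * (A k / B k) / (1 + x k)"
      unfolding eq .
    moreover have "\<rho> k = - (B k * (1 - x k)) / 2"
      unfolding \<rho>_def by (simp add: algebra_simps)
    ultimately show ?case by simp
  qed
  have \<mu>0: "\<mu> \<longlonglongrightarrow> 0"
  proof -
    have "(\<lambda>k. (- B k - B k * x k) / 2) \<longlonglongrightarrow> (- 0 - 0 * 1) / 2"
      by (intro tendsto_intros B0 x1) simp
    then show ?thesis by (simp add: \<mu>_def[abs_def])
  qed
  have \<rho>0: "\<rho> \<longlonglongrightarrow> 0"
  proof -
    have "(\<lambda>k. (- B k + B k * x k) / 2) \<longlonglongrightarrow> (- 0 + 0 * 1) / 2"
      by (intro tendsto_intros B0 x1) simp
    then show ?thesis by (simp add: \<rho>_def[abs_def])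
  qed
  have \<rho>T: "(\<lambda>k. \<rho> k * T k) \<longlonglongrightarrow> - \<tau>"
  proof (rule Lim_transform_eventually)
    have "(\<lambda>k. - 2 * (A k / B k * T k) / (1 + x k)) \<longlonglongrightarrow> - 2 * \<tau> / (1 + 1)"
      by (intro tendsto_intros slow x1) simp
    then show "(\<lambda>k. - 2 * (A k / B k * T k) / (1 + x k)) \<longlonglongrightarrow> - \<tau>" by simp
    show "\<forall>\<^sub>F k in sequentially. - 2 * (A k / B k * T k) / (1 + x k) = \<rho> k * T k"
      using \<rho>eq by eventually_elim simp
  qed
  have expB: "(\<lambda>k. (B k * T k) * exp (- ((B k * T k) / 2))) \<longlonglongrightarrow> 0"
  proof -
    have "filterlim (\<lambda>k. (1 / 2) * (B k * T k)) at_top sequentially"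
      by (rule filterlim_tendsto_pos_mult_at_top[OF tendsto_const _ fast]) simp
    from filterlim_compose[OF tendsto_power_div_exp_0[of 1] this]
    have "(\<lambda>k. 2 * (((1 / 2) * (B k * T k)) ^ 1 / exp ((1 / 2) * (B k * T k)))) \<longlonglongrightarrow> 2 * 0"
      by (intro tendsto_mult tendsto_const)
    then show ?thesis by (simp add: exp_minus field_simps)
  qed
  have \<mu>T: "\<forall>\<^sub>F k in sequentially. exp (\<mu> k * T k) \<le> exp (- ((B k * T k) / 2))"
    using ev
  proof eventually_elim
    case (elim k)
    have "\<mu> k * T k \<le> - (B k / 2) * T k"
      using elim pos(2)[of k] unfolding \<mu>_def by (intro mult_right_mono) (auto simp: field_simps)
    then show ?case by simp
  qed
  have e\<mu>: "(\<lambda>k. exp (\<mu> k * T k)) \<longlonglongrightarrow> 0"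
  proof (rule Lim_null_comparison)
    show "\<forall>\<^sub>F k in sequentially. norm (exp (\<mu> k * T k)) \<le> exp (- ((B k * T k) / 2))"
      using \<mu>T by simp
    have "filterlim (\<lambda>k. (1 / 2) * (B k * T k)) at_top sequentially"
      by (rule filterlim_tendsto_pos_mult_at_top[OF tendsto_const _ fast]) simp
    then have "filterlim (\<lambda>k. - ((1 / 2) * (B k * T k))) at_bot sequentially"
      by (rule filterlim_uminus_at_bot_at_top[THEN filterlim_compose])
    from filterlim_compose[OF exp_at_bot this]
    show "(\<lambda>k. exp (- ((B k * T k) / 2))) \<longlonglongrightarrow> 0" by simp
  qed
  have Zlim: "(\<lambda>k. y k *\<^sub>R Z0 k) \<longlonglongrightarrow> 0" if "y \<longlonglongrightarrow> 0" for y :: "nat \<Rightarrow> real"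
  proof (rule Lim_null_comparison)
    show "\<forall>\<^sub>F k in sequentially. norm (y k *\<^sub>R Z0 k) \<le> \<bar>y k\<bar> * M"
      using Z0 by (auto intro!: always_eventually mult_left_mono)
    have "(\<lambda>k. \<bar>y k\<bar> * M) \<longlonglongrightarrow> \<bar>0\<bar> * M" by (intro tendsto_intros that)
    then show "(\<lambda>k. \<bar>y k\<bar> * M) \<longlonglongrightarrow> 0" by simp
  qed
  have W1: "(\<lambda>k. Z1 k - \<mu> k *\<^sub>R Z0 k) \<longlonglongrightarrow> P" and W2: "(\<lambda>k. Z1 k - \<rho> k *\<^sub>R Z0 k) \<longlonglongrightarrow> P"
    using tendsto_diff[OF Z1 Zlim[OF \<mu>0]] tendsto_diff[OF Z1 Zlim[OF \<rho>0]] by simp_all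
  show "(\<lambda>k. B k *\<^sub>R Z k) \<longlonglongrightarrow> exp (- \<tau>) *\<^sub>R P"
  proof (rule Lim_transform_eventually)
    have "(\<lambda>k. (1 / x k) *\<^sub>R (exp (\<rho> k * T k) *\<^sub>R (Z1 k - \<mu> k *\<^sub>R Z0 k) - exp (\<mu> k * T k) *\<^sub>R (Z1 k - \<rho> k *\<^sub>R Z0 k)))
      \<longlonglongrightarrow> (1 / 1) *\<^sub>R (exp (- \<tau>) *\<^sub>R P - 0 *\<^sub>R P)"
      by (intro tendsto_intros x1 \<rho>T e\<mu> W1 W2) simp
    then show "(\<lambda>k. (1 / x k) *\<^sub>R (exp (\<rho> k * T k) *\<^sub>R (Z1 k - \<mu> k *\<^sub>R Z0 k) - exp (\<mu> k * T k) *\<^sub>R (Z1 k - \<rho> k *\<^sub>R Z0 k)))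
      \<longlonglongrightarrow> exp (- \<tau>) *\<^sub>R P" by simp
    show "\<forall>\<^sub>F k in sequentially. (1 / x k) *\<^sub>R (exp (\<rho> k * T k) *\<^sub>R (Z1 k - \<mu> k *\<^sub>R Z0 k) - exp (\<mu> k * T k) *\<^sub>R (Z1 k - \<rho> k *\<^sub>R Z0 k)) = B k *\<^sub>R Z k"
      using ev
    proof eventually_elim
      case (elim k)
      then have xk: "x k > 0"
        and e: "x k *\<^sub>R (B k *\<^sub>R Z k) = exp (\<rho> k * T k) *\<^sub>R (Z1 k - \<mu> k *\<^sub>R Z0 k) - exp (\<mu> k * T k) *\<^sub>R (Z1 k - \<rho> k *\<^sub>R Z0 k)"
        by blast+
      show ?case unfolding e[symmetric] using xk by simp
    qed
  qed
  have c1: "(\<lambda>k. (B k / A k) * \<rho> k) \<longlonglongrightarrow> - 1"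
  proof (rule Lim_transform_eventually)
    have "(\<lambda>k. - 2 / (1 + x k)) \<longlonglongrightarrow> - 2 / (1 + 1)" by (intro tendsto_intros x1) simp
    then show "(\<lambda>k. - 2 / (1 + x k)) \<longlonglongrightarrow> - 1" by simp
    show "\<forall>\<^sub>F k in sequentially. - 2 / (1 + x k) = (B k / A k) * \<rho> k"
      using \<rho>eq by eventually_elim (use pos in \<open>simp add: less_imp_neq[symmetric]\<close>)
  qed
  have c2: "(\<lambda>k. (B k / A k) * \<mu> k * exp (\<mu> k * T k)) \<longlonglongrightarrow> 0"
  proof (rule Lim_null_comparison)
    show "\<forall>\<^sub>F k in sequentially. norm ((B k / A k) * \<mu> k * exp (\<mu> k * T k))
        \<le> (1 + x k) / 2 / (A k / B k * T k) * ((B k * T k) * exp (- ((B k * T k) / 2)))"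
      using ev \<mu>T
    proof eventually_elim
      case (elim k)
      have "norm ((B k / A k) * \<mu> k * exp (\<mu> k * T k)) = (1 + x k) / 2 / (A k / B k * T k) * ((B k * T k) * exp (\<mu> k * T k))"
      proof -
        have m: "\<bar>\<mu> k\<bar> = B k * (1 + x k) / 2"
        proof -
          have "B k * (1 + x k) / 2 > 0"
            using elim pos(2)[of k] by (intro divide_pos_pos mult_pos_pos add_pos_pos) auto
          moreover have "\<mu> k = - (B k * (1 + x k) / 2)"
            unfolding \<mu>_def by (simp add: algebra_simps)
          ultimately show ?thesis by linarith
        qed
        have n: "norm ((B k / A k) * \<mu> k * exp (\<mu> k * T k)) = (B k / A k) * \<bar>\<mu> k\<bar> * exp (\<mu> k * T k)"
          using pos[of k] by (simp add: abs_mult)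
        have "T k > 0" using elim by blast
        then show ?thesis
          unfolding n m using pos[of k] by (simp add: field_simps)
      qed
      also have "\<dots> \<le> (1 + x k) / 2 / (A k / B k * T k) * ((B k * T k) * exp (- ((B k * T k) / 2)))"
        using elim pos[of k] by (intro mult_left_mono mult_nonneg_nonneg divide_nonneg_nonneg) auto
      finally show ?case .
    qed
    have "(\<lambda>k. (1 + x k) / 2 / (A k / B k * T k) * ((B k * T k) * exp (- ((B k * T k) / 2))))
        \<longlonglongrightarrow> (1 + 1) / 2 / \<tau> * 0"
      using \<tau> by (intro tendsto_mult tendsto_divide tendsto_add tendsto_const x1 slow expB) auto
    then show "(\<lambda>k. (1 + x k) / 2 / (A k / B k * T k) * ((B k * T k) * exp (- ((B k * T k) / 2)))) \<longlonglongrightarrow> 0"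
      by simp
  qed
  show "(\<lambda>k. ((B k)\<^sup>2 / A k) *\<^sub>R Z' k) \<longlonglongrightarrow> - (exp (- \<tau>) *\<^sub>R P)"
  proof (rule Lim_transform_eventually)
    let ?F = "\<lambda>k. (1 / x k) *\<^sub>R (((B k / A k) * \<rho> k * exp (\<rho> k * T k)) *\<^sub>R (Z1 k - \<mu> k *\<^sub>R Z0 k)
        - ((B k / A k) * \<mu> k * exp (\<mu> k * T k)) *\<^sub>R (Z1 k - \<rho> k *\<^sub>R Z0 k))"
    have "?F \<longlonglongrightarrow> (1 / 1) *\<^sub>R ((- 1 * exp (- \<tau>)) *\<^sub>R P - 0 *\<^sub>R P)"
      by (intro tendsto_scaleR tendsto_diff tendsto_divide tendsto_const x1 c2 W1 W2 tendsto_mult[OF c1] tendsto_exp \<rho>T) simp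
    then show "?F \<longlonglongrightarrow> - (exp (- \<tau>) *\<^sub>R P)" by simp
    show "\<forall>\<^sub>F k in sequentially. ?F k = ((B k)\<^sup>2 / A k) *\<^sub>R Z' k"
      using ev
    proof eventually_elim
      case (elim k)
      then have xk: "x k > 0"
        and e: "x k *\<^sub>R (B k *\<^sub>R Z' k) = (\<rho> k * exp (\<rho> k * T k)) *\<^sub>R (Z1 k - \<mu> k *\<^sub>R Z0 k)
          - (\<mu> k * exp (\<mu> k * T k)) *\<^sub>R (Z1 k - \<rho> k *\<^sub>R Z0 k)"
        by blast+
      have "?F k = (1 / x k) *\<^sub>R ((B k / A k) *\<^sub>R ((\<rho> k * exp (\<rho> k * T k)) *\<^sub>R (Z1 k - \<mu> k *\<^sub>R Z0 k)
          - (\<mu> k * exp (\<mu> k * T k)) *\<^sub>R (Z1 k - \<rho> k *\<^sub>R Z0 k)))"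
        by (simp add: scaleR_diff_right mult.assoc)
      also have "\<dots> = (1 / x k) *\<^sub>R ((B k / A k) *\<^sub>R (x k *\<^sub>R (B k *\<^sub>R Z' k)))"
        unfolding e ..
      also have "\<dots> = ((B k)\<^sup>2 / A k) *\<^sub>R Z' k"
        using xk by (simp add: power2_eq_square)
      finally show ?case .
    qed
  qed
qed

section \<open>Multipliers and time derivatives\<close>

text \<open>A multiplier may be applied to any representative of the transform.\<close>

lemma has_fourier_abs_D:
  assumes w: "has_fourier w W" and L2: "(\<lambda>\<xi>. complex_of_real (norm \<xi> powr s) * W \<xi>) \<in> L2"
  shows "has_fourier (abs_D s w) (\<lambda>\<xi>. complex_of_real (norm \<xi> powr s) * W \<xi>)"
proof -
  have ae: "AE \<xi> in lebesgue. complex_of_real (norm \<xi> powr s) * W \<xi> = complex_of_real (norm \<xi> powr s) * fourier w \<xi>"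
    using fourier_eq_AE[OF w] by eventually_elim simp
  have "has_fourier (abs_D s w) (\<lambda>\<xi>. complex_of_real (norm \<xi> powr s) * fourier w \<xi>)"
    unfolding abs_D_def by (rule has_fourier_inv_fourier) (rule L2_cong_AE(1)[OF L2 ae])
  then show ?thesis
    by (rule has_fourier_cong_transform) (rule eventually_mono[OF ae], rule sym)
qed

lemma sobolev_iff:
  assumes w: "has_fourier w W"
  shows "w \<in> sobolev a \<longleftrightarrow> (\<lambda>\<xi>. complex_of_real ((1 + (norm \<xi>)\<^sup>2) powr (a / 2)) * W \<xi>) \<in> L2"
proof -
  have ae: "AE \<xi> in lebesgue. complex_of_real ((1 + (norm \<xi>)\<^sup>2) powr (a / 2)) * W \<xi>
      = complex_of_real ((1 + (norm \<xi>)\<^sup>2) powr (a / 2)) * fourier w \<xi>"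
    using fourier_eq_AE[OF w] by eventually_elim simp
  then have ae': "AE \<xi> in lebesgue. complex_of_real ((1 + (norm \<xi>)\<^sup>2) powr (a / 2)) * fourier w \<xi>
      = complex_of_real ((1 + (norm \<xi>)\<^sup>2) powr (a / 2)) * W \<xi>"
    by (rule eventually_mono) (rule sym)
  have "w \<in> L2" using w by (rule has_fourier_L2)
  then show ?thesis
    unfolding sobolev_def using L2_cong_AE(1)[OF _ ae] L2_cong_AE(1)[OF _ ae'] by blast
qed

lemma L2_dominated_convergence_eventually:
  fixes U :: "nat \<Rightarrow> 'a::euclidean_space \<Rightarrow> complex"
  assumes m: "\<And>k. U k \<in> borel_measurable lebesgue" and g: "g \<in> L2"
    and bound: "\<forall>\<^sub>F k in sequentially. AE x in lebesgue. cmod (U k x) \<le> cmod (g x)"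
    and lim: "AE x in lebesgue. (\<lambda>k. U k x) \<longlonglongrightarrow> 0"
  shows "(\<lambda>k. L2norm (U k)) \<longlonglongrightarrow> 0"
proof -
  obtain N where N: "\<And>k. k \<ge> N \<Longrightarrow> AE x in lebesgue. cmod (U k x) \<le> cmod (g x)"
    using bound by (auto simp: eventually_sequentially)
  have "(\<lambda>k. L2norm (U (k + N))) \<longlonglongrightarrow> 0"
  proof (rule L2_dominated_convergence[OF m L2_integrable[OF g]])
    show "AE x in lebesgue. (cmod (U (k + N) x))\<^sup>2 \<le> (cmod (g x))\<^sup>2" for k
      using N[of "k + N"] by (auto elim!: eventually_mono intro!: power_mono)
    show "AE x in lebesgue. (\<lambda>k. U (k + N) x) \<longlonglongrightarrow> 0"
      using lim by eventually_elim (rule LIMSEQ_ignore_initial_segment)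
  qed
  then show ?thesis by (rule LIMSEQ_offset)
qed

text \<open>By the mean value inequality \<open>H\<close> also bounds the difference quotients, which therefore converge in
  \<open>L\<^sup>2\<close> by domination.\<close>

lemma has_L2_derivative_dominated:
  fixes U W :: "real \<Rightarrow> 'a::euclidean_space \<Rightarrow> complex"
  assumes d: "d > 0" and H: "H \<in> L2" and UL: "\<And>\<tau>. \<bar>\<tau> - t\<bar> < d \<Longrightarrow> U \<tau> \<in> L2"
    and ae: "AE x in lebesgue. \<forall>\<tau>. \<bar>\<tau> - t\<bar> < d \<longrightarrow>
        ((\<lambda>\<tau>. U \<tau> x) has_vector_derivative W \<tau> x) (at \<tau>) \<and> cmod (W \<tau> x) \<le> cmod (H x)"
  shows "has_L2_derivative U (W t) t" and "W t \<in> L2"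
proof -
  define q where "q h x = (U (t + h) x - U t x) / complex_of_real h" for h x
  have qL: "q h \<in> L2" if "\<bar>h\<bar> < d" for h
  proof -
    have "(\<lambda>x. (1 / complex_of_real h) * (U (t + h) x - U t x)) \<in> L2"
      using that d by (intro L2_scale L2_diff UL) auto
    then show ?thesis by (simp add: q_def[abs_def])
  qed
  have qlim: "AE x in lebesgue. ((\<lambda>h. q h x) \<longlongrightarrow> W t x) (at 0)"
    using ae
  proof eventually_elim
    case (elim x)
    then have "((\<lambda>\<tau>. U \<tau> x) has_vector_derivative W t x) (at t)" using d by simp
    then have "((\<lambda>h. norm (U (t + h) x - U t x - h *\<^sub>R W t x) / norm h) \<longlongrightarrow> 0) (at 0)"
      unfolding has_vector_derivative_def has_derivative_at by simp
    moreover have "\<forall>\<^sub>F h in at 0. norm (U (t + h) x - U t x - h *\<^sub>R W t x) / norm h = norm (q h x - W t x)"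
      using eventually_neq_at_within[of 0]
    proof eventually_elim
      case (elim h)
      then have "q h x - W t x = (U (t + h) x - U t x - h *\<^sub>R W t x) / complex_of_real h"
        by (simp add: q_def scaleR_conv_of_real diff_divide_distrib)
      then show ?case by (simp add: norm_divide)
    qed
    ultimately have "((\<lambda>h. norm (q h x - W t x)) \<longlongrightarrow> 0) (at 0)"
      by (rule Lim_transform_eventually)
    then show ?case
      by (simp add: tendsto_norm_zero_iff flip: Lim_null)
  qed
  have qbound: "AE x in lebesgue. \<forall>h. \<bar>h\<bar> < d \<longrightarrow> cmod (q h x) \<le> cmod (H x)"
    using ae
  proof eventually_elim
    case (elim x)
    show ?case
    proof (intro allI impI)
      fix h :: real assume h: "\<bar>h\<bar> < d"
      have "norm (U (t + h) x - U t x) \<le> cmod (H x) * norm ((t + h) - t)"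
      proof (rule differentiable_bound)
        show "convex (ball t d)" by simp
        show "((\<lambda>\<tau>. U \<tau> x) has_derivative (\<lambda>y. y *\<^sub>R W \<tau> x)) (at \<tau> within ball t d)" if "\<tau> \<in> ball t d" for \<tau>
          using elim that
          by (auto simp: dist_real_def abs_minus_commute has_vector_derivative_def intro: has_derivative_at_withinI)
        show "onorm (\<lambda>y. y *\<^sub>R W \<tau> x) \<le> cmod (H x)" if "\<tau> \<in> ball t d" for \<tau>
        proof (rule onorm_bound)
          fix y :: real
          have "cmod (W \<tau> x) \<le> cmod (H x)" using elim that by (auto simp: dist_real_def abs_minus_commute)
          then show "norm (y *\<^sub>R W \<tau> x) \<le> cmod (H x) * norm y"
            by (simp add: mult.commute mult_left_mono)
        qed simp
      qed (use h d in \<open>auto simp: dist_real_def\<close>)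
      then show "cmod (q h x) \<le> cmod (H x)"
        by (cases "h = 0") (auto simp: q_def norm_divide divide_le_eq)
    qed
  qed
  \<comment> \<open>increments in the admissible range that tend to \<open>0\<close>\<close>
  define h where "h k = d / real (k + 2)" for k
  have h0: "h \<longlonglongrightarrow> 0"
    unfolding h_def[abs_def] using LIMSEQ_ignore_initial_segment[OF lim_const_over_n[of d], of 2] by simp
  have hd: "\<bar>h k\<bar> < d" "h k \<noteq> 0" for k
  proof -
    have "d * 1 < d * real (k + 2)" using d by (intro mult_strict_left_mono) auto
    then show "\<bar>h k\<bar> < d" using d by (simp add: h_def pos_divide_less_eq)
    show "h k \<noteq> 0" using d by (simp add: h_def)
  qed
  have m: "W t \<in> borel_measurable lebesgue"
  proof (rule borel_measurable_lebesgue_cong_AE)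
    have [measurable]: "q (h k) \<in> borel_measurable lebesgue" for k
      using qL[OF hd(1)] by (simp add: L2_def)
    show "(\<lambda>x. lim (\<lambda>k. q (h k) x)) \<in> borel_measurable lebesgue"
      by (rule borel_measurable_lim_metric) simp
    show "AE x in lebesgue. lim (\<lambda>k. q (h k) x) = W t x"
      using qlim
    proof eventually_elim
      case (elim x)
      then have "(\<lambda>k. q (h k) x) \<longlonglongrightarrow> W t x"
        by (rule filterlim_compose) (use h0 hd in \<open>auto simp: filterlim_at\<close>)
      then show ?case by (rule limI)
    qed
  qed
  show WL: "W t \<in> L2"
    by (rule L2_dominated(1)[OF H m, where C=1]) (use ae d in \<open>auto elim!: eventually_mono\<close>)
  have "((\<lambda>h. L2norm (\<lambda>x. q h x - W t x)) \<longlongrightarrow> 0) (at 0)"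
    unfolding tendsto_at_iff_sequentially
  proof (intro allI impI)
    fix X :: "nat \<Rightarrow> real" assume X0: "\<forall>i. X i \<in> UNIV - {0}" and X: "X \<longlonglongrightarrow> 0"
    have Xd: "\<forall>\<^sub>F k in sequentially. \<bar>X k\<bar> < d"
      using X d by (auto simp: tendsto_iff dist_real_def)
    \<comment> \<open>\<open>X\<close> is only eventually in the admissible range\<close>
    define Y where "Y k = (if \<bar>X k\<bar> < d then X k else d / 2)" for k
    have Y: "\<bar>Y k\<bar> < d" for k using d by (auto simp: Y_def)
    have XY: "\<forall>\<^sub>F k in sequentially. Y k = X k"
      using Xd by eventually_elim (simp add: Y_def)
    have "(\<lambda>k. L2norm (\<lambda>x. q (Y k) x - W t x)) \<longlonglongrightarrow> 0"
    proof (rule L2_dominated_convergence_eventually)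
      show "(\<lambda>x. q (Y k) x - W t x) \<in> borel_measurable lebesgue" for k
        using L2_diff(1)[OF qL[OF Y] WL] by (simp add: L2_def)
      show "(\<lambda>x. 2 * H x) \<in> L2" by (intro L2_scale H)
      have "AE x in lebesgue. cmod (q (Y k) x - W t x) \<le> cmod (2 * H x)" for k
        using qbound ae
      proof eventually_elim
        case (elim x)
        have "cmod (q (Y k) x) \<le> cmod (H x)" "cmod (W t x) \<le> cmod (H x)"
          using elim Y d by auto
        then show ?case
          using norm_triangle_ineq4[of "q (Y k) x" "W t x"] by (simp add: norm_mult)
      qed
      then show "\<forall>\<^sub>F k in sequentially. AE x in lebesgue. cmod (q (Y k) x - W t x) \<le> cmod (2 * H x)" by simp
      show "AE x in lebesgue. (\<lambda>k. q (Y k) x - W t x) \<longlonglongrightarrow> 0"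
        using qlim
      proof eventually_elim
        case (elim x)
        have "filterlim X (at 0) sequentially" using X X0 by (auto simp: filterlim_at)
        from filterlim_compose[OF elim this] have "(\<lambda>k. q (X k) x) \<longlonglongrightarrow> W t x" .
        then have "(\<lambda>k. q (Y k) x) \<longlonglongrightarrow> W t x"
          by (rule Lim_transform_eventually) (use XY in \<open>eventually_elim, simp\<close>)
        then show ?case by (simp flip: Lim_null)
      qed
    qed
    then have "(\<lambda>k. L2norm (\<lambda>x. q (X k) x - W t x)) \<longlonglongrightarrow> 0"
      by (rule Lim_transform_eventually) (use XY in \<open>eventually_elim, simp\<close>)
    then show "((\<lambda>h. L2norm (\<lambda>x. q h x - W t x)) \<circ> X) \<longlonglongrightarrow> 0" by (simp add: comp_def)
  qed
  moreover have "\<forall>\<^sub>F h in at 0. q h \<in> L2"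
    unfolding eventually_at using d qL by (intro exI[of _ d]) (auto simp: dist_real_def)
  moreover have "\<forall>\<^sub>F \<tau> in nhds t. U \<tau> \<in> L2"
    unfolding eventually_nhds_metric using d UL by (intro exI[of _ d]) (auto simp: dist_real_def)
  ultimately show "has_L2_derivative U (W t) t"
    using WL unfolding has_L2_derivative_def L2_tendsto_def q_def by auto
qed

text \<open>Plancherel's identity carries difference quotients and their limits from the frequency side to the
  space side. The choice made in \<open>D_t\<close> is immaterial because limits in \<open>L\<^sup>2\<close> are unique almost everywhere.\<close>

lemma has_L2_derivative_of_fourier:
  fixes U V :: "real \<Rightarrow> 'a::euclidean_space \<Rightarrow> complex"
  assumes ev: "\<forall>\<^sub>F \<tau> in nhds t. has_fourier (U \<tau>) (V \<tau>)" and V: "has_L2_derivative V V' t"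
  shows "L2_differentiable U t" and "has_fourier (D_t U t) V'"
proof -
  let ?c = "sqrt (2 * pi) ^ DIM('a)"
  have c: "?c > 0" by simp
  have V'L: "V' \<in> L2" using V by (auto simp: has_L2_derivative_def L2_tendsto_def)
  obtain U' where U': "has_fourier U' V'" using has_fourier_surj[OF V'L] ..
  have U'L: "U' \<in> L2" using U' by (rule has_fourier_L2)
  have t: "has_fourier (U t) (V t)" using ev by (rule eventually_nhds_x_imp_x)
  have "filterlim (\<lambda>h. t + h) (nhds (t + 0)) (at 0)" by (intro tendsto_intros)
  then have "\<forall>\<^sub>F h in at 0. has_fourier (U (t + h)) (V (t + h))"
    using eventually_compose_filterlim[OF ev] by simp
  then have quot: "\<forall>\<^sub>F h in at 0. has_fourier (\<lambda>x. (U (t + h) x - U t x) / complex_of_real h)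
       (\<lambda>\<xi>. (V (t + h) \<xi> - V t \<xi>) / complex_of_real h)"
  proof eventually_elim
    case (elim h)
    from has_fourier_scale[OF has_fourier_diff[OF elim t], of "1 / complex_of_real h"] show ?case by simp
  qed
  have "((\<lambda>h. L2norm (\<lambda>\<xi>. (V (t + h) \<xi> - V t \<xi>) / complex_of_real h - V' \<xi>) / ?c) \<longlongrightarrow> 0 / ?c) (at 0)"
    using V c by (intro tendsto_intros) (auto simp: has_L2_derivative_def L2_tendsto_def)
  then have "((\<lambda>h. L2norm (\<lambda>\<xi>. (V (t + h) \<xi> - V t \<xi>) / complex_of_real h - V' \<xi>) / ?c) \<longlongrightarrow> 0) (at 0)"
    by simp
  then have lim: "((\<lambda>h. L2norm (\<lambda>x. (U (t + h) x - U t x) / complex_of_real h - U' x)) \<longlongrightarrow> 0) (at 0)"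
    by (rule Lim_transform_eventually)
       (use quot in \<open>eventually_elim, simp add: plancherel[OF has_fourier_diff[OF _ U']]\<close>)
  have U'd: "has_L2_derivative U U' t"
    unfolding has_L2_derivative_def L2_tendsto_def
    using lim U'L quot ev by (auto elim!: eventually_mono dest: has_fourier_L2)
  then show "L2_differentiable U t" by (auto simp: L2_differentiable_def)
  have "has_L2_derivative U (D_t U t) t"
    unfolding D_t_def using someI[of "\<lambda>V. has_L2_derivative U V t", OF U'd] .
  then have "AE x in lebesgue. U' x = D_t U t x"
    using U'd L2_tendsto_unique[OF _ _ at_neq_bot] by (auto simp: has_L2_derivative_def)
  then show "has_fourier (D_t U t) V'" by (rule has_fourier_cong_function[OF U'])
qed

section \<open>Integrability of powers with exponential weights\<close>

text \<open>The volume of the \<open>k\<close>-th ball is a constant times \<open>R k ^ n\<close>; overlapping balls do no harm to an upper bound.\<close>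

lemma nn_integral_shells:
  fixes g :: "'a::euclidean_space \<Rightarrow> real"
  assumes R: "\<And>k. R k \<ge> 0" and M: "\<And>k. M k \<ge> 0" and sm: "summable (\<lambda>k. M k * R k ^ DIM('a))"
    and cover: "\<And>x. x \<in> S \<Longrightarrow> \<exists>k::nat. norm x \<le> R k \<and> g x \<le> M k"
  shows "(\<integral>\<^sup>+x. ennreal (g x) * indicator S x \<partial>lborel) < \<infinity>"
proof -
  have [measurable]: "cball (0::'a) r \<in> sets borel" for r by simp
  have "(\<integral>\<^sup>+x. ennreal (g x) * indicator S x \<partial>lborel)
      \<le> (\<integral>\<^sup>+x. (\<Sum>k. ennreal (M k) * indicator (cball 0 (R k)) x) \<partial>(lborel :: 'a measure))"
  proof (rule nn_integral_mono)
    fix x :: 'a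
    show "ennreal (g x) * indicator S x \<le> (\<Sum>k. ennreal (M k) * indicator (cball 0 (R k)) x)"
    proof (cases "x \<in> S")
      case True
      then obtain k where k: "norm x \<le> R k" "g x \<le> M k" using cover by blast
      define F where "F k = ennreal (M k) * indicator (cball 0 (R k)) x" for k
      have "ennreal (g x) * indicator S x \<le> F k"
        using k True by (simp add: ennreal_leI F_def)
      also have "\<dots> \<le> (\<Sum>k. F k)"
        using sum_le_suminf[of F "{k}"] by simp
      finally show ?thesis by (simp add: F_def)
    qed simp
  qed
  also have "(\<integral>\<^sup>+x. (\<Sum>k. ennreal (M k) * indicator (cball 0 (R k)) x) \<partial>(lborel :: 'a measure))
      = (\<Sum>k. ennreal (M k) * emeasure lborel (cball (0::'a) (R k)))"
    by (subst nn_integral_suminf) (auto simp: nn_integral_cmult_indicator)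
  also have "\<dots> = (\<Sum>k. ennreal (unit_ball_vol (real DIM('a)) * (M k * R k ^ DIM('a))))"
    using R M by (simp add: emeasure_cball ennreal_mult[symmetric] mult_ac)
  also have "\<dots> < \<infinity>"
    using M R by (subst suminf_ennreal2) (auto intro!: summable_mult sm)
  finally show ?thesis .
qed

text \<open>On the dyadic shell \<open>2^(-k-1) \<le> |x| \<le> 2^(-k)\<close> the integrand is comparable with its value at the outer
  radius; the factor \<open>2^|p|\<close> covers both signs of \<open>p\<close>.\<close>

lemma nn_integral_norm_powr_inner:
  assumes p: "p > - real DIM('a::euclidean_space)"
  shows "(\<integral>\<^sup>+x. ennreal (norm (x::'a) powr p) * indicator (cball 0 1) x \<partial>lborel) < \<infinity>"
proof -
  define R :: "nat \<Rightarrow> real" where "R k = 2 powr (- real k)" for k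
  have "(\<integral>\<^sup>+x. ennreal (norm (x::'a) powr p) * indicator (cball 0 1) x \<partial>lborel) < \<infinity>"
  proof (rule nn_integral_shells[where R=R and M="\<lambda>k. 2 powr \<bar>p\<bar> * R k powr p"])
    have eq: "2 powr \<bar>p\<bar> * R k powr p * R k ^ DIM('a) = 2 powr \<bar>p\<bar> * (2 powr (- (p + DIM('a)))) ^ k" for k
      by (simp add: R_def powr_powr powr_realpow[symmetric] powr_add[symmetric] algebra_simps)
    have "norm ((2::real) powr (- (p + DIM('a)))) < 1"
      using p powr_less_mono[of "- (p + DIM('a))" 0 2] by simp
    then show "summable (\<lambda>k. 2 powr \<bar>p\<bar> * R k powr p * R k ^ DIM('a))"
      unfolding eq by (intro summable_mult summable_geometric)
    fix x :: 'a assume x: "x \<in> cball 0 1"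
    show "\<exists>k. norm x \<le> R k \<and> norm x powr p \<le> 2 powr \<bar>p\<bar> * R k powr p"
    proof (cases "x = 0")
      case True
      then show ?thesis by (intro exI[of _ 0]) (auto simp: R_def)
    next
      case False
      \<comment> \<open>the shell that contains \<open>x\<close>\<close>
      define k where "k = nat \<lfloor>- log 2 (norm x)\<rfloor>"
      have l0: "- log 2 (norm x) \<ge> 0" using x False by (simp add: log_le_zero_cancel_iff)
      then have k: "real k \<le> - log 2 (norm x)" "- log 2 (norm x) < real k + 1"
        unfolding k_def by linarith+
      have nx: "norm x = 2 powr (log 2 (norm x))" using False by simp
      have le: "norm x \<le> R k"
        using k by (subst nx) (auto simp: R_def intro!: powr_mono)
      have ge: "R k / 2 \<le> norm x"
      proof -
        have "R k / 2 = 2 powr (- real k - 1)" by (simp add: R_def powr_diff)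
        also have "\<dots> \<le> norm x" using k by (subst nx) (intro powr_mono, auto)
        finally show ?thesis .
      qed
      have Rk: "R k > 0" by (simp add: R_def)
      have "norm x powr p \<le> 2 powr \<bar>p\<bar> * R k powr p"
      proof (cases "p \<ge> 0")
        case True
        have "norm x powr p \<le> R k powr p" using True le by (intro powr_mono2) auto
        also have "\<dots> \<le> 2 powr \<bar>p\<bar> * R k powr p"
          using mult_right_mono[OF ge_one_powr_ge_zero[of 2 "\<bar>p\<bar>"], of "R k powr p"] by simp
        finally show ?thesis .
      next
        case p: False
        have "norm x powr p \<le> (R k / 2) powr p" using p ge Rk False by (intro powr_mono2') auto
        also have "\<dots> = 2 powr \<bar>p\<bar> * R k powr p" using p Rk by (simp add: powr_divide powr_minus field_simps)
        finally show ?thesis .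
      qed
      with le show ?thesis by blast
    qed
  qed (auto simp: R_def)
  then show ?thesis .
qed

lemma nn_integral_norm_powr_outer:
  assumes p: "p < - real DIM('a::euclidean_space)"
  shows "(\<integral>\<^sup>+x. ennreal (norm (x::'a) powr p) * indicator {x. norm x \<ge> 1} x \<partial>lborel) < \<infinity>"
proof (rule nn_integral_shells[where R="\<lambda>k. 2 powr (real k + 1)" and M="\<lambda>k. 2 powr (real k * p)"])
  have eq: "2 powr (real k * p) * (2 powr (real k + 1)) ^ DIM('a) = 2 powr DIM('a) * (2 powr (p + DIM('a))) ^ k" for k
    by (simp add: powr_powr powr_realpow[symmetric] powr_add[symmetric] algebra_simps)
  have "norm ((2::real) powr (p + DIM('a))) < 1"
    using p powr_less_mono[of "p + DIM('a)" 0 2] by simp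
  then show "summable (\<lambda>k. 2 powr (real k * p) * (2 powr (real k + 1)) ^ DIM('a))"
    unfolding eq by (intro summable_mult summable_geometric)
  fix x :: 'a assume "x \<in> {x. norm x \<ge> 1}"
  then have x: "norm x \<ge> 1" by simp
  define k where "k = nat \<lfloor>log 2 (norm x)\<rfloor>"
  have l0: "log 2 (norm x) \<ge> 0" using x by (subst zero_le_log_cancel_iff) auto
  then have k: "real k \<le> log 2 (norm x)" "log 2 (norm x) < real k + 1"
    unfolding k_def by linarith+
  have "x \<noteq> 0" using x by auto
  then have nx: "norm x = 2 powr (log 2 (norm x))" by simp
  have "norm x \<le> 2 powr (real k + 1)"
    using k by (subst nx) (intro powr_mono, auto)
  moreover have "norm x powr p \<le> 2 powr (real k * p)"
  proof -
    have "norm x powr p = 2 powr (log 2 (norm x) * p)" by (subst nx) (simp only: powr_powr)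
    also have "\<dots> \<le> 2 powr (real k * p)"
      using k p by (intro powr_mono mult_right_mono_neg) auto
    finally show ?thesis .
  qed
  ultimately show "\<exists>k. norm x \<le> 2 powr (real k + 1) \<and> norm x powr p \<le> 2 powr (real k * p)" by blast
qed auto

text \<open>Raise \<open>y / m \<le> exp (y / m)\<close> to the power \<open>m\<close>.\<close>

lemma exp_minus_le_powr:
  assumes "y > 0" "m > (0::real)"
  shows "exp (- y) \<le> (m / y) powr m"
proof -
  have "y / m \<le> exp (y / m)" using exp_ge_add_one_self[of "y / m"] by linarith
  then have "(y / m) powr m \<le> exp (y / m) powr m" using assms by (intro powr_mono2) auto
  also have "\<dots> = exp y" using assms by (simp add: exp_powr_real)
  finally have "inverse (exp y) \<le> inverse ((y / m) powr m)" using assms by (intro le_imp_inverse_le) auto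
  then show ?thesis using assms by (simp add: exp_minus powr_divide)
qed

text \<open>Only the origin restricts the exponent: there the square behaves like \<open>|x|^(2p)\<close>, and at infinity the
  exponential beats every power.\<close>

lemma norm_powr_exp_L2:
  assumes p: "p > - real DIM('a::euclidean_space) / 2" and c: "c > 0" and q: "q > 0"
  shows "(\<lambda>x::'a. complex_of_real (norm x powr p * exp (- c * norm x powr q))) \<in> L2"
proof -
  define m where "m = (\<bar>2 * p\<bar> + real DIM('a) + 1) / q"
  have m: "m > 0" using q unfolding m_def by (intro divide_pos_pos) auto
  define C where "C = (m / (2 * c)) powr m"
  have C: "C \<ge> 0" by (simp add: C_def)
  let ?f = "\<lambda>x::'a. norm x powr p * exp (- c * norm x powr q)"
  have sq: "(?f x)\<^sup>2 = norm x powr (2 * p) * exp (- (2 * c * norm x powr q))" for x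
  proof -
    have "(norm x powr p)\<^sup>2 = norm x powr (2 * p)"
      by (simp add: power2_eq_square powr_add[symmetric])
    moreover have "(exp (- c * norm x powr q))\<^sup>2 = exp (- (2 * c * norm x powr q))"
      by (simp flip: exp_double)
    ultimately show ?thesis by (simp only: power_mult_distrib)
  qed
  have le: "ennreal ((?f x)\<^sup>2) \<le> ennreal (norm x powr (2 * p)) * indicator (cball 0 1) x
      + ennreal C * (ennreal (norm x powr (- (real DIM('a) + 1))) * indicator {x. norm x \<ge> 1} x)" for x
  proof (cases "norm x \<le> 1")
    case True
    have "exp (- (2 * c * norm x powr q)) \<le> 1" using c by simp
    then have "(?f x)\<^sup>2 \<le> norm x powr (2 * p)"
      unfolding sq by (intro mult_left_le) auto
    then show ?thesis using True by (auto intro!: add_increasing2 ennreal_leI)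
  next
    case False
    have x0: "x \<noteq> 0" using False by auto
    have "exp (- (2 * c * norm x powr q)) \<le> (m / (2 * c * norm x powr q)) powr m"
      using x0 c m by (intro exp_minus_le_powr mult_pos_pos) auto
    also have "\<dots> = C * norm x powr (- (\<bar>2 * p\<bar> + real DIM('a) + 1))"
    proof -
      have qm: "q * m = \<bar>2 * p\<bar> + real DIM('a) + 1" using q by (simp add: m_def)
      have "(m / (2 * c * norm x powr q)) powr m = C / (norm x powr q) powr m"
        using c m by (simp add: C_def powr_divide powr_mult)
      also have "\<dots> = C / norm x powr (\<bar>2 * p\<bar> + real DIM('a) + 1)"
        unfolding powr_powr qm ..
      finally show ?thesis by (simp only: powr_minus_divide times_divide_eq_right mult_1_right)
    qed
    finally have "(?f x)\<^sup>2 \<le> norm x powr (2 * p) * (C * norm x powr (- (\<bar>2 * p\<bar> + real DIM('a) + 1)))"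
      unfolding sq by (intro mult_left_mono) auto
    also have "\<dots> = C * norm x powr (2 * p - (\<bar>2 * p\<bar> + real DIM('a) + 1))"
      by (simp only: powr_diff powr_minus_divide) simp
    also have "\<dots> \<le> C * norm x powr (- (real DIM('a) + 1))"
      using False C by (intro mult_left_mono powr_mono) auto
    finally show ?thesis
      using False C by (simp add: ennreal_mult[symmetric] ennreal_leI)
  qed
  have [measurable]: "cball (0::'a) 1 \<in> sets borel" "{x::'a. norm x \<ge> 1} \<in> sets borel"
    by simp_all
  have "(\<integral>\<^sup>+x. ennreal ((?f x)\<^sup>2) \<partial>lborel) \<le> (\<integral>\<^sup>+x. ennreal (norm x powr (2 * p)) * indicator (cball 0 1) x
      + ennreal C * (ennreal (norm x powr (- (real DIM('a) + 1))) * indicator {x. norm x \<ge> 1} x) \<partial>(lborel :: 'a measure))"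
    by (intro nn_integral_mono le)
  also have "\<dots> = (\<integral>\<^sup>+x. ennreal (norm x powr (2 * p)) * indicator (cball 0 1) x \<partial>(lborel :: 'a measure))
      + ennreal C * (\<integral>\<^sup>+x. ennreal (norm x powr (- (real DIM('a) + 1))) * indicator {x. norm x \<ge> 1} x \<partial>(lborel :: 'a measure))"
    by (subst nn_integral_add) (auto simp: nn_integral_cmult)
  also have "\<dots> < \<infinity>"
    using nn_integral_norm_powr_inner[where 'a='a, of "2 * p"] nn_integral_norm_powr_outer[where 'a='a, of "- (real DIM('a) + 1)"] p
    by (auto simp: ennreal_mult_less_top)
  finally have fin: "(\<integral>\<^sup>+x. ennreal ((?f x)\<^sup>2) \<partial>lborel) < \<infinity>" .
  have "(\<lambda>x::'a. complex_of_real (?f x)) \<in> borel_measurable lebesgue"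
    by (rule borel_imp_lebesgue) measurable
  then show ?thesis
    unfolding L2_iff_nn_integral nn_integral_completion norm_of_real power2_abs using fin by simp
qed

section \<open>Dilations\<close>

lemma lebesgue_dilation_measurable [measurable]:
  "(\<lambda>x::'a::euclidean_space. c *\<^sub>R x) \<in> lebesgue \<rightarrow>\<^sub>M lebesgue"
  by (rule lebesgue_measurable_scaling)

lemma lebesgue_dilation:
  assumes c: "c > 0"
  shows "lebesgue = density (distr lebesgue lebesgue (\<lambda>x::'a::euclidean_space. c *\<^sub>R x)) (\<lambda>_. ennreal (c ^ DIM('a)))"
  using lebesgue_affine_euclidean[of "\<lambda>_::'a. c" 0] c
  unfolding scaleR_scaleR[symmetric] scaleR_sum_right[symmetric] euclidean_representation prod_constant by simp

lemma nn_integral_dilation: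
  fixes f :: "'a::euclidean_space \<Rightarrow> ennreal"
  assumes [measurable]: "f \<in> borel_measurable lebesgue" and c: "c > 0"
  shows "(\<integral>\<^sup>+x. f x \<partial>lebesgue) = ennreal (c ^ DIM('a)) * (\<integral>\<^sup>+x. f (c *\<^sub>R x) \<partial>lebesgue)"
proof -
  have "(\<integral>\<^sup>+x. f x \<partial>lebesgue) = (\<integral>\<^sup>+x. f x \<partial>density (distr lebesgue lebesgue (\<lambda>x::'a. c *\<^sub>R x)) (\<lambda>_. ennreal (c ^ DIM('a))))"
    by (subst lebesgue_dilation[OF c]) simp
  also have "\<dots> = ennreal (c ^ DIM('a)) * (\<integral>\<^sup>+x. f (c *\<^sub>R x) \<partial>lebesgue)"
    by (subst nn_integral_density) (auto simp: nn_integral_cmult nn_integral_distr)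
  finally show ?thesis .
qed

lemma AE_dilation:
  fixes P :: "'a::euclidean_space \<Rightarrow> bool"
  assumes P: "AE x in lebesgue. P x" and c: "c > 0"
  shows "AE x in lebesgue. P (c *\<^sub>R x)"
proof -
  have "AE x in density (distr lebesgue lebesgue (\<lambda>x::'a. c *\<^sub>R x)) (\<lambda>_. ennreal (c ^ DIM('a))). P x"
    using P by (subst (asm) lebesgue_dilation[OF c]) 
  then have "AE x in distr lebesgue lebesgue (\<lambda>x::'a. c *\<^sub>R x). P x"
    using c by (subst (asm) AE_density) auto
  then show ?thesis by (rule AE_distrD[rotated]) simp
qed

lemma L2norm_dilation:
  fixes f :: "'a::euclidean_space \<Rightarrow> complex"
  assumes [measurable]: "f \<in> borel_measurable lebesgue" and c: "c > 0"
  shows "L2norm f = c powr (DIM('a) / 2) * L2norm (\<lambda>x. f (c *\<^sub>R x))"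
proof -
  have norm_eq: "L2norm g = sqrt (enn2real (\<integral>\<^sup>+x. ennreal ((cmod (g x))\<^sup>2) \<partial>lebesgue))"
    if "g \<in> borel_measurable lebesgue" for g :: "'a \<Rightarrow> complex"
    unfolding L2norm_def using that by (subst integral_eq_nn_integral) auto
  have fc: "(\<lambda>x. f (c *\<^sub>R x)) \<in> borel_measurable lebesgue" by measurable
  have I: "(\<integral>\<^sup>+x. ennreal ((cmod (f x))\<^sup>2) \<partial>lebesgue)
      = ennreal (c ^ DIM('a)) * (\<integral>\<^sup>+x. ennreal ((cmod (f (c *\<^sub>R x)))\<^sup>2) \<partial>lebesgue)"
    by (rule nn_integral_dilation[OF _ c]) simp
  have "L2norm f = sqrt (c ^ DIM('a)) * L2norm (\<lambda>x. f (c *\<^sub>R x))"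
    unfolding norm_eq[OF assms(1)] norm_eq[OF fc] I using c by (simp add: enn2real_mult real_sqrt_mult)
  moreover have "sqrt (c ^ DIM('a)) = c powr (DIM('a) / 2)"
    using c by (simp add: powr_half_sqrt[symmetric] powr_realpow[symmetric] powr_powr)
  ultimately show ?thesis by simp
qed

section \<open>Frequency-side analysis of the equation\<close>

lemma filterlim_powr_at_top:
  assumes p: "p > (0::real)"
  shows "filterlim (\<lambda>x. x powr p) at_top at_top"
proof -
  have "filterlim (\<lambda>x::real. p * ln x) at_top at_top"
    by (rule filterlim_tendsto_pos_mult_at_top[OF tendsto_const p ln_at_top])
  from filterlim_compose[OF exp_at_top this]
  have "filterlim (\<lambda>x. exp (p * ln x)) at_top at_top" .
  moreover have "\<forall>\<^sub>F x in at_top. exp (p * ln x) = x powr p"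
    using eventually_gt_at_top[of 0] by eventually_elim (simp add: powr_def)
  ultimately show ?thesis
    using filterlim_cong[OF refl refl, of "\<lambda>x. exp (p * ln x)" "\<lambda>x. x powr p" at_top at_top] by blast
qed

text \<open>One half of the exponential absorbs the factor \<open>x\<close>, the other half is kept as a bound uniform in \<open>x\<close>.\<close>

lemma mult_exp_minus_le:
  assumes "y > 0" "x \<ge> (1::real)"
  shows "x * exp (- (y * x)) \<le> (2 / y) * exp (- (y / 2))"
proof -
  have "y * x / 2 \<le> exp (y * x / 2)" using exp_ge_add_one_self[of "y * x / 2"] by linarith
  then have "x \<le> (2 / y) * exp (y * x / 2)" using assms by (simp add: field_simps)
  then have "x * exp (- (y * x)) \<le> ((2 / y) * exp (y * x / 2)) * exp (- (y * x))"
    by (intro mult_right_mono) auto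
  also have "\<dots> = (2 / y) * exp (- (y * x / 2))"
    by (simp add: exp_add[symmetric] mult.assoc)
  also have "\<dots> \<le> (2 / y) * exp (- (y / 2))"
    using assms by (intro mult_left_mono) auto
  finally show ?thesis .
qed

text \<open>Here \<open>v t\<close> is the transform of the solution at time \<open>t\<close>, and \<open>z0\<close>, \<open>z1\<close> are the Fourier integrals of the
  initial data: bounded since the data are integrable, with the weights that express their Sobolev
  regularity, and \<open>z1\<close> has the limit \<open>P\<close> at the origin.\<close>

locale damped_frequencies =
  fixes \<sigma> \<delta>1 \<delta>2 s :: real and j :: nat and v v' :: "real \<Rightarrow> 'a::euclidean_space \<Rightarrow> complex"
    and z0 z1 :: "'a \<Rightarrow> complex" and B :: real and P :: complex
  assumes \<delta>1: "0 < \<delta>1" "\<delta>1 < \<sigma> / 2" and \<delta>2: "\<sigma> / 2 < \<delta>2" "\<delta>2 < \<sigma>"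
    and j: "j \<in> {0, 1}" and s: "s \<ge> 0" and dim: "real DIM('a) > 4 * \<delta>1"
    and v_L2: "t \<ge> 0 \<Longrightarrow> v t \<in> L2"
    and modes: "AE \<xi> in lebesgue. v 0 \<xi> = z0 \<xi> \<and> v' 0 \<xi> = z1 \<xi> \<and> (\<forall>t\<ge>0.
              ((\<lambda>t. v t \<xi>) has_vector_derivative v' t \<xi>) (at t within {0..}) \<and>
              (\<exists>v''. ((\<lambda>t. v' t \<xi>) has_vector_derivative v'') (at t within {0..}) \<and>
                 v'' + complex_of_real (norm \<xi> powr (2 * \<delta>1) + norm \<xi> powr (2 * \<delta>2)) * v' t \<xi>
                     + complex_of_real (norm \<xi> powr (2 * \<sigma>)) * v t \<xi> = 0))"
    and z0_le: "cmod (z0 \<xi>) \<le> B" and z1_le: "cmod (z1 \<xi>) \<le> B"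
    and z1_lim: "x \<longlonglongrightarrow> 0 \<Longrightarrow> (\<lambda>k. z1 (x k)) \<longlonglongrightarrow> P"
    and z0_weight: "(\<lambda>\<xi>. complex_of_real ((1 + (norm \<xi>)\<^sup>2) powr ((s + 2 * real j * \<delta>2) / 2)) * z0 \<xi>) \<in> L2"
    and z1_weight: "(\<lambda>\<xi>. complex_of_real ((1 + (norm \<xi>)\<^sup>2) powr (max (s + 2 * (real j - 1) * \<delta>2) 0 / 2)) * z1 \<xi>) \<in> L2"
begin

text \<open>The exponent of self-similarity: the profile lives at frequencies of size \<open>t^(-1/\<kappa>)\<close>.\<close>

definition \<kappa> :: real where "\<kappa> = 2 * (\<sigma> - \<delta>1)"

definition a :: "'a \<Rightarrow> real" where "a \<xi> = norm \<xi> powr (2 * \<sigma>)"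

definition b :: "'a \<Rightarrow> real" where "b \<xi> = norm \<xi> powr (2 * \<delta>1) + norm \<xi> powr (2 * \<delta>2)"

text \<open>Almost every frequency is of this kind; the origin is excluded because both coefficients vanish there.\<close>

definition good :: "'a \<Rightarrow> bool" where
  "good \<xi> \<longleftrightarrow> \<xi> \<noteq> 0 \<and> v 0 \<xi> = z0 \<xi> \<and> v' 0 \<xi> = z1 \<xi> \<and>
     (\<exists>z''. damped_oscillator (a \<xi>) (b \<xi>) (\<lambda>t. v t \<xi>) (\<lambda>t. v' t \<xi>) z'')"

text \<open>The derivative of order \<open>j\<close> in time of \<open>v\<close>.\<close>

definition mode_dt :: "real \<Rightarrow> 'a \<Rightarrow> complex" where
  "mode_dt t \<xi> = (if j = 0 then v t \<xi> else v' t \<xi>)"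

definition profile :: "real \<Rightarrow> 'a \<Rightarrow> real" where
  "profile t \<xi> = exp (- t * norm \<xi> powr \<kappa>) / norm \<xi> powr (2 * \<delta>1)"

text \<open>The derivative of order \<open>j\<close> in time of \<open>profile\<close>.\<close>

definition profile_dt :: "real \<Rightarrow> 'a \<Rightarrow> real" where
  "profile_dt t \<xi> = (if j = 0 then 1 else - (norm \<xi> powr \<kappa>)) * profile t \<xi>"

lemma \<kappa>_pos: "\<kappa> > 0" "\<kappa> - 2 * \<delta>1 > 0"
  using \<delta>1 \<delta>2 by (auto simp: \<kappa>_def)

lemma B_nonneg: "B \<ge> 0"
  using z0_le[of 0] norm_ge_zero order_trans by blast

lemma a_pos: "\<xi> \<noteq> 0 \<Longrightarrow> a \<xi> > 0" and b_pos: "\<xi> \<noteq> 0 \<Longrightarrow> b \<xi> > 0"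
  by (auto simp: a_def b_def add_pos_pos)

lemma b_lower: "norm \<xi> powr (2 * \<delta>1) \<le> b \<xi>" "norm \<xi> powr (2 * \<delta>2) \<le> b \<xi>"
  by (auto simp: b_def)

lemma b_upper_low:
  assumes "norm \<xi> \<le> 1"
  shows "b \<xi> \<le> 2 * norm \<xi> powr (2 * \<delta>1)"
proof -
  have "norm \<xi> powr (2 * \<delta>2) \<le> norm \<xi> powr (2 * \<delta>1)"
    using assms \<delta>1 \<delta>2 by (cases "\<xi> = 0") (auto intro!: powr_mono')
  then show ?thesis by (simp add: b_def)
qed

lemma b_upper_high:
  assumes "norm \<xi> \<ge> 1"
  shows "b \<xi> \<le> 2 * norm \<xi> powr (2 * \<delta>2)"
proof -
  have "norm \<xi> powr (2 * \<delta>1) \<le> norm \<xi> powr (2 * \<delta>2)"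
    using assms \<delta>1 \<delta>2 by (intro powr_mono) auto
  then show ?thesis by (simp add: b_def)
qed

text \<open>Below \<open>|\<xi>| = 1\<close> the first summand of \<open>b\<close> suffices, since \<open>\<delta>1 < \<sigma>/2\<close>, and above it the second one, since
  \<open>\<delta>2 > \<sigma>/2\<close>. This is the hypothesis under which the energy estimates hold.\<close>

lemma a_le_b_square: "a \<xi> \<le> (b \<xi>)\<^sup>2"
proof (cases "norm \<xi> \<le> 1")
  case True
  have "a \<xi> \<le> norm \<xi> powr (2 * \<delta>1 + 2 * \<delta>1)"
    unfolding a_def using True \<delta>1 by (cases "\<xi> = 0") (auto intro!: powr_mono')
  also have "\<dots> = (norm \<xi> powr (2 * \<delta>1))\<^sup>2" by (simp only: powr_add power2_eq_square)
  also have "\<dots> \<le> (b \<xi>)\<^sup>2" using b_lower by (intro power_mono) auto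
  finally show ?thesis .
next
  case False
  have "a \<xi> \<le> norm \<xi> powr (2 * \<delta>2 + 2 * \<delta>2)"
    unfolding a_def using False \<delta>2 by (intro powr_mono) auto
  also have "\<dots> = (norm \<xi> powr (2 * \<delta>2))\<^sup>2" by (simp only: powr_add power2_eq_square)
  also have "\<dots> \<le> (b \<xi>)\<^sup>2" using b_lower by (intro power_mono) auto
  finally show ?thesis .
qed

lemma rate_low:
  assumes "norm \<xi> \<le> 1" "\<xi> \<noteq> 0"
  shows "a \<xi> / b \<xi> \<ge> norm \<xi> powr \<kappa> / 2"
proof -
  have "norm \<xi> powr \<kappa> / 2 = a \<xi> / (2 * norm \<xi> powr (2 * \<delta>1))"
    by (simp add: a_def \<kappa>_def powr_diff right_diff_distrib)
  also have "\<dots> \<le> a \<xi> / b \<xi>"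
    using assms b_upper_low[of \<xi>] a_pos[of \<xi>] b_pos[of \<xi>] by (intro divide_left_mono) auto
  finally show ?thesis .
qed

lemma rate_high:
  assumes "norm \<xi> \<ge> 1"
  shows "a \<xi> / b \<xi> \<ge> 1 / 2"
proof -
  have x0: "\<xi> \<noteq> 0" using assms by auto
  have "norm \<xi> powr (2 * \<delta>2) \<le> a \<xi>"
    unfolding a_def using assms \<delta>2 by (intro powr_mono) auto
  then show ?thesis
    using b_upper_high[OF assms] b_pos[OF x0] by (simp add: field_simps)
qed

lemma AE_good: "AE \<xi> in lebesgue. good \<xi>"
proof -
  have "AE \<xi> in lebesgue. \<xi> \<noteq> (0::'a)"
    by (rule AE_completion) (rule AE_lborel_singleton)
  then show ?thesis
    using modes
  proof eventually_elim
    case (elim \<xi>)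
    then obtain z'' where z'': "\<And>t. t \<ge> 0 \<Longrightarrow> ((\<lambda>t. v' t \<xi>) has_vector_derivative z'' t) (at t within {0..}) \<and>
                 z'' t + complex_of_real (norm \<xi> powr (2 * \<delta>1) + norm \<xi> powr (2 * \<delta>2)) * v' t \<xi>
                     + complex_of_real (norm \<xi> powr (2 * \<sigma>)) * v t \<xi> = 0"
      by metis
    have "damped_oscillator (a \<xi>) (b \<xi>) (\<lambda>t. v t \<xi>) (\<lambda>t. v' t \<xi>) z''"
    proof
      fix t :: real assume t: "0 \<le> t"
      show "z'' t + b \<xi> *\<^sub>R v' t \<xi> + a \<xi> *\<^sub>R v t \<xi> = 0"
        using z''[OF t] by (simp add: a_def b_def scaleR_conv_of_real)
    qed (use elim z'' a_pos b_pos a_le_b_square in auto)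
    then show ?case
      using elim by (auto simp: good_def)
  qed
qed

lemma mode_bounds:
  assumes "good \<xi>"
  shows position: "t \<ge> 0 \<Longrightarrow> b \<xi> * cmod (v t \<xi>) \<le> 3 * (cmod (z1 \<xi>) + b \<xi> * cmod (z0 \<xi>)) * exp (- (a \<xi> / (4 * b \<xi>)) * t)"
    and velocity: "t \<ge> 0 \<Longrightarrow> cmod (v' t \<xi>) \<le> 2 * (cmod (z1 \<xi>) + b \<xi> * cmod (z0 \<xi>)) * exp (- (a \<xi> / (4 * b \<xi>)) * t)"
    and velocity_slow: "t \<ge> 0 \<Longrightarrow> cmod (v' t \<xi>) \<le> exp (- b \<xi> * t) * cmod (z1 \<xi>)
        + 4 * (a \<xi> / (b \<xi>)\<^sup>2) * (cmod (z1 \<xi>) + b \<xi> * cmod (z0 \<xi>)) * exp (- (a \<xi> / (4 * b \<xi>)) * t)"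
    and v_deriv: "t \<ge> 0 \<Longrightarrow> ((\<lambda>t. v t \<xi>) has_vector_derivative v' t \<xi>) (at t within {0..})"
proof -
  obtain z'' where osc: "damped_oscillator (a \<xi>) (b \<xi>) (\<lambda>t. v t \<xi>) (\<lambda>t. v' t \<xi>) z''"
    and init: "v 0 \<xi> = z0 \<xi>" "v' 0 \<xi> = z1 \<xi>"
    using assms by (auto simp: good_def)
  interpret damped_oscillator "a \<xi>" "b \<xi>" "\<lambda>t. v t \<xi>" "\<lambda>t. v' t \<xi>" z'' by (rule osc)
  note d = data_def[unfolded init]
  show "t \<ge> 0 \<Longrightarrow> b \<xi> * cmod (v t \<xi>) \<le> 3 * (cmod (z1 \<xi>) + b \<xi> * cmod (z0 \<xi>)) * exp (- (a \<xi> / (4 * b \<xi>)) * t)"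
    using position_bound[of t] unfolding d .
  show "t \<ge> 0 \<Longrightarrow> cmod (v' t \<xi>) \<le> 2 * (cmod (z1 \<xi>) + b \<xi> * cmod (z0 \<xi>)) * exp (- (a \<xi> / (4 * b \<xi>)) * t)"
    using velocity_bound[of t] unfolding d .
  show "t \<ge> 0 \<Longrightarrow> cmod (v' t \<xi>) \<le> exp (- b \<xi> * t) * cmod (z1 \<xi>)
        + 4 * (a \<xi> / (b \<xi>)\<^sup>2) * (cmod (z1 \<xi>) + b \<xi> * cmod (z0 \<xi>)) * exp (- (a \<xi> / (4 * b \<xi>)) * t)"
    using velocity_bound_slow[of t] unfolding d init .
  show "t \<ge> 0 \<Longrightarrow> ((\<lambda>t. v t \<xi>) has_vector_derivative v' t \<xi>) (at t within {0..})"
    using deriv[of t] .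
qed

section \<open>Low frequencies in self-similar variables\<close>

text \<open>A majorant, uniform in time, of the low-frequency modes in self-similar variables. The first term bounds the
  slow mode in \<open>v\<close>, the second the slow mode in the velocity, the third the fast mode in the velocity.\<close>

definition dominant :: "'a \<Rightarrow> real" where
  "dominant \<eta> = B * (9 * (norm \<eta> powr (- 2 * \<delta>1) * exp (- (1 / 8) * norm \<eta> powr \<kappa>))
     + 12 * (norm \<eta> powr (\<kappa> - 2 * \<delta>1) * exp (- (1 / 8) * norm \<eta> powr \<kappa>))
     + 2 * (norm \<eta> powr (- 2 * \<delta>1) * exp (- (1 / 2) * norm \<eta> powr (2 * \<delta>1))))"

text \<open>With \<open>t = L^\<kappa>\<close> and \<open>\<xi> = \<eta> / L\<close> the bounds for a single oscillator become independent of \<open>L\<close>: the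
  slow rate times \<open>t\<close> is comparable with \<open>|\<eta>|^\<kappa>\<close>, and the remaining powers of \<open>L\<close> cancel. The exception
  is the fast mode of the velocity, which keeps a growing power of \<open>L\<close>; its own decay absorbs it.\<close>

lemma low_frequency_bound:
  assumes L: "L \<ge> 1" and le: "norm \<eta> \<le> L" and good: "good ((1 / L) *\<^sub>R \<eta>)"
  shows "L powr (\<kappa> * real j - 2 * \<delta>1) * cmod (mode_dt (L powr \<kappa>) ((1 / L) *\<^sub>R \<eta>)) \<le> dominant \<eta>"
proof -
  define \<xi> where "\<xi> = (1 / L) *\<^sub>R \<eta>"
  define r where "r = norm \<xi>"
  define \<rho> where "\<rho> = norm \<eta>"
  let ?t = "L powr \<kappa>"
  have gx: "good \<xi>" and x0: "\<xi> \<noteq> 0" using good by (auto simp: \<xi>_def good_def)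
  have r0: "r > 0" using x0 by (simp add: r_def)
  have rL: "r = \<rho> / L" using L by (simp add: r_def \<xi>_def \<rho>_def)
  have \<rho>0: "\<rho> > 0" using r0 L by (simp add: rL zero_less_divide_iff)
  have r1: "r \<le> 1" using le L by (simp add: rL \<rho>_def)
  have Lr: "L powr p * r powr p = \<rho> powr p" for p
    using L \<rho>0 by (simp add: rL powr_divide)
  have Lr': "L powr (- p) * r powr (- p) = \<rho> powr (- p)" for p
    using Lr[of "- p"] .
  have b_le: "b \<xi> \<le> 2"
  proof -
    have "b \<xi> \<le> 2 * r powr (2 * \<delta>1)" using b_upper_low[of \<xi>] r1 by (simp add: r_def)
    also have "r powr (2 * \<delta>1) \<le> 1" using r0 r1 \<delta>1 by (intro powr_le1) auto
    finally show ?thesis by simp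
  qed
  have bp: "b \<xi> > 0" and ap: "a \<xi> > 0" using b_pos a_pos x0 by auto
  have b_ge: "r powr (2 * \<delta>1) \<le> b \<xi>" using b_lower by (simp add: r_def)
  have data: "cmod (z1 \<xi>) + b \<xi> * cmod (z0 \<xi>) \<le> 3 * B"
  proof -
    have "b \<xi> * cmod (z0 \<xi>) \<le> 2 * B" using b_le bp z0_le[of \<xi>] by (intro mult_mono) auto
    then show ?thesis using z1_le[of \<xi>] by linarith
  qed
  have decay: "exp (- (a \<xi> / (4 * b \<xi>)) * ?t) \<le> exp (- (1 / 8) * \<rho> powr \<kappa>)"
  proof -
    have "(1 / 8) * \<rho> powr \<kappa> = (r powr \<kappa> / 2) / 4 * ?t"
      using Lr[of \<kappa>] by (simp add: mult.commute)
    also have "\<dots> \<le> (a \<xi> / b \<xi>) / 4 * ?t"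
      using rate_low[of \<xi>] r1 x0 by (intro mult_right_mono divide_right_mono) (auto simp: r_def)
    finally show ?thesis by simp
  qed
  let ?E = "exp (- (1 / 8) * \<rho> powr \<kappa>)"
  have dE: "(cmod (z1 \<xi>) + b \<xi> * cmod (z0 \<xi>)) * exp (- (a \<xi> / (4 * b \<xi>)) * ?t) \<le> 3 * B * ?E"
    using data decay bp B_nonneg by (intro mult_mono) auto
  have "L powr (\<kappa> * real j - 2 * \<delta>1) * cmod (mode_dt ?t \<xi>) \<le> dominant \<eta>"
  proof (cases "j = 0")
    case True
    have "b \<xi> * cmod (v ?t \<xi>) \<le> 3 * ((cmod (z1 \<xi>) + b \<xi> * cmod (z0 \<xi>)) * exp (- (a \<xi> / (4 * b \<xi>)) * ?t))"
      using position[OF gx, of ?t] by (simp only: mult.assoc) simp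
    then have "b \<xi> * cmod (v ?t \<xi>) \<le> 3 * (3 * B * ?E)"
      using dE by linarith
    moreover have "r powr (2 * \<delta>1) * cmod (v ?t \<xi>) \<le> b \<xi> * cmod (v ?t \<xi>)"
      using b_ge by (intro mult_right_mono) auto
    ultimately have "r powr (2 * \<delta>1) * cmod (v ?t \<xi>) \<le> 9 * B * ?E" by simp
    then have "r powr (- (2 * \<delta>1)) * (r powr (2 * \<delta>1) * cmod (v ?t \<xi>)) \<le> r powr (- (2 * \<delta>1)) * (9 * B * ?E)"
      by (intro mult_left_mono) auto
    moreover have "r powr (- (2 * \<delta>1)) * (r powr (2 * \<delta>1) * cmod (v ?t \<xi>)) = cmod (v ?t \<xi>)"
      using r0 by (simp add: powr_minus)
    ultimately have "cmod (v ?t \<xi>) \<le> r powr (- (2 * \<delta>1)) * (9 * B * ?E)"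
      by (simp only:)
    then have "L powr (- (2 * \<delta>1)) * cmod (v ?t \<xi>) \<le> L powr (- (2 * \<delta>1)) * (r powr (- (2 * \<delta>1)) * (9 * B * ?E))"
      by (intro mult_left_mono) auto
    also have "\<dots> = B * (9 * (\<rho> powr (- 2 * \<delta>1) * ?E))"
      using Lr'[of "2 * \<delta>1"] by (simp add: mult_ac)
    also have "\<dots> \<le> dominant \<eta>"
      unfolding dominant_def \<rho>_def using B_nonneg by (intro mult_left_mono) auto
    finally show ?thesis using True unfolding mode_dt_def by simp
  next
    case False
    then have j1: "j = 1" using j by auto
    let ?x = "L powr (\<kappa> - 2 * \<delta>1)" and ?y = "\<rho> powr (2 * \<delta>1)"
    have x1: "?x \<ge> 1" using L \<kappa>_pos by (intro ge_one_powr_ge_zero) auto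
    have 1: "?x * exp (- b \<xi> * ?t) \<le> 2 * (\<rho> powr (- 2 * \<delta>1) * exp (- (1 / 2) * ?y))"
    proof -
      have "?y * ?x = r powr (2 * \<delta>1) * ?t"
        unfolding Lr[symmetric] using L by (simp add: powr_diff)
      also have "\<dots> \<le> b \<xi> * ?t" using b_ge by (intro mult_right_mono) auto
      finally have "?x * exp (- b \<xi> * ?t) \<le> ?x * exp (- (?y * ?x))"
        by (intro mult_left_mono) auto
      also have "\<dots> \<le> (2 / ?y) * exp (- (?y / 2))"
        using \<rho>0 x1 by (intro mult_exp_minus_le) auto
      also have "\<dots> = 2 * (\<rho> powr (- 2 * \<delta>1) * exp (- (1 / 2) * ?y))"
        using \<rho>0 by (simp add: powr_minus_divide)
      finally show ?thesis .
    qed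
    have 2: "?x * (a \<xi> / (b \<xi>)\<^sup>2) \<le> \<rho> powr (\<kappa> - 2 * \<delta>1)"
    proof -
      have "(r powr (2 * \<delta>1))\<^sup>2 \<le> (b \<xi>)\<^sup>2" using b_ge by (intro power_mono) auto
      then have "a \<xi> / (b \<xi>)\<^sup>2 \<le> a \<xi> / (r powr (2 * \<delta>1))\<^sup>2"
        using ap bp r0 by (intro divide_left_mono) auto
      also have "\<dots> = r powr (2 * \<sigma> - (2 * \<delta>1 + 2 * \<delta>1))"
        by (simp only: a_def r_def[symmetric] powr_diff powr_add power2_eq_square)
      also have "2 * \<sigma> - (2 * \<delta>1 + 2 * \<delta>1) = \<kappa> - 2 * \<delta>1" by (simp add: \<kappa>_def)
      finally have "?x * (a \<xi> / (b \<xi>)\<^sup>2) \<le> ?x * r powr (\<kappa> - 2 * \<delta>1)"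
        by (intro mult_left_mono) auto
      then show ?thesis unfolding Lr .
    qed
    have "?x * cmod (v' ?t \<xi>) \<le> ?x * (exp (- b \<xi> * ?t) * cmod (z1 \<xi>)
        + 4 * (a \<xi> / (b \<xi>)\<^sup>2) * (cmod (z1 \<xi>) + b \<xi> * cmod (z0 \<xi>)) * exp (- (a \<xi> / (4 * b \<xi>)) * ?t))"
      using velocity_slow[OF gx, of ?t] by (intro mult_left_mono) auto
    also have "\<dots> = (?x * exp (- b \<xi> * ?t)) * cmod (z1 \<xi>)
       + 4 * (?x * (a \<xi> / (b \<xi>)\<^sup>2)) * ((cmod (z1 \<xi>) + b \<xi> * cmod (z0 \<xi>)) * exp (- (a \<xi> / (4 * b \<xi>)) * ?t))"
      by (simp only: distrib_left mult_ac)
    also have "\<dots> \<le> (2 * (\<rho> powr (- 2 * \<delta>1) * exp (- (1 / 2) * ?y))) * B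
       + 4 * \<rho> powr (\<kappa> - 2 * \<delta>1) * (3 * B * ?E)"
    proof (rule add_mono)
      show "(?x * exp (- b \<xi> * ?t)) * cmod (z1 \<xi>) \<le> (2 * (\<rho> powr (- 2 * \<delta>1) * exp (- (1 / 2) * ?y))) * B"
        by (rule mult_mono[OF 1 z1_le]) auto
      have "4 * (?x * (a \<xi> / (b \<xi>)\<^sup>2)) \<le> 4 * \<rho> powr (\<kappa> - 2 * \<delta>1)" using 2 by simp
      from mult_mono[OF this dE] show "4 * (?x * (a \<xi> / (b \<xi>)\<^sup>2)) * ((cmod (z1 \<xi>) + b \<xi> * cmod (z0 \<xi>)) * exp (- (a \<xi> / (4 * b \<xi>)) * ?t))
         \<le> 4 * \<rho> powr (\<kappa> - 2 * \<delta>1) * (3 * B * ?E)"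
        using bp by simp
    qed
    also have "\<dots> = B * (12 * (\<rho> powr (\<kappa> - 2 * \<delta>1) * ?E) + 2 * (\<rho> powr (- 2 * \<delta>1) * exp (- (1 / 2) * ?y)))"
      by (simp add: algebra_simps)
    also have "\<dots> \<le> dominant \<eta>"
      unfolding dominant_def \<rho>_def using B_nonneg by (intro mult_left_mono) auto
    finally show ?thesis using j1 unfolding mode_dt_def by simp
  qed
  then show ?thesis by (simp add: \<xi>_def)
qed

text \<open>At a fixed \<open>\<eta>\<close> the frequencies \<open>\<eta> / L\<close> tend to \<open>0\<close>, so the transform of \<open>u1\<close> may be replaced by its limit
  \<open>P\<close>, and the oscillators enter the overdamped limit with \<open>\<tau> = |\<eta>|^\<kappa>\<close>.\<close>

lemma low_frequency_limit:
  assumes L: "filterlim L at_top sequentially" and L1: "\<And>k. L k \<ge> 1"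
    and good: "\<And>k. good ((1 / L k) *\<^sub>R \<eta>)"
  shows "(\<lambda>k. L k powr (\<kappa> * real j - 2 * \<delta>1) *\<^sub>R mode_dt (L k powr \<kappa>) ((1 / L k) *\<^sub>R \<eta>)) \<longlonglongrightarrow> profile_dt 1 \<eta> *\<^sub>R P"
proof -
  define \<xi> where "\<xi> k = (1 / L k) *\<^sub>R \<eta>" for k
  define r where "r k = norm (\<xi> k)" for k
  define \<rho> where "\<rho> = norm \<eta>"
  define m where "m k = 1 + r k powr (2 * (\<delta>2 - \<delta>1))" for k
  have L0: "L k > 0" for k using L1[of k] by linarith
  have eta0: "\<eta> \<noteq> 0" using good[of 0] by (auto simp: good_def)
  then have x0: "\<xi> k \<noteq> 0" for k using L0[of k] by (simp add: \<xi>_def)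
  have \<rho>0: "\<rho> > 0" using eta0 by (simp add: \<rho>_def)
  have r0: "r k > 0" for k using x0 by (simp add: r_def)
  have rL: "r k = \<rho> / L k" for k using L0[of k] by (simp add: r_def \<xi>_def \<rho>_def)
  have Lr: "L k powr p * r k powr p = \<rho> powr p" for p k
    using L0[of k] \<rho>0 by (simp add: rL powr_divide)
  have invL: "(\<lambda>k. 1 / L k) \<longlonglongrightarrow> 0"
    using tendsto_inverse_0_at_top[OF L] by (simp add: inverse_eq_divide)
  have xlim: "\<xi> \<longlonglongrightarrow> 0"
    using tendsto_scaleR[OF invL tendsto_const[of \<eta>]] by (simp add: \<xi>_def[abs_def])
  have rlim: "r \<longlonglongrightarrow> 0" using tendsto_norm[OF xlim] by (simp add: r_def[abs_def])
  have rp: "(\<lambda>k. r k powr p) \<longlonglongrightarrow> 0" if "p > 0" for p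
    using that less_imp_le[OF r0] by (intro tendsto_zero_powrI[OF rlim tendsto_const] always_eventually allI)
  have mlim: "m \<longlonglongrightarrow> 1"
    using tendsto_add[OF tendsto_const[of 1] rp[of "2 * (\<delta>2 - \<delta>1)"]] \<delta>1 \<delta>2 by (simp add: m_def[abs_def])
  have m1: "m k \<ge> 1" for k by (simp add: m_def)
  have bm: "b (\<xi> k) = r k powr (2 * \<delta>1) * m k" for k
    by (simp add: b_def m_def r_def[symmetric] distrib_left powr_add[symmetric] right_diff_distrib)
  have blim: "(\<lambda>k. b (\<xi> k)) \<longlonglongrightarrow> 0"
    unfolding bm using tendsto_mult[OF rp[of "2 * \<delta>1"] mlim] \<delta>1 by simp
  have ab2: "a (\<xi> k) / (b (\<xi> k))\<^sup>2 = r k powr (\<kappa> - 2 * \<delta>1) / (m k)\<^sup>2" for k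
  proof -
    have "a (\<xi> k) / (b (\<xi> k))\<^sup>2 = r k powr (2 * \<sigma> - (2 * \<delta>1 + 2 * \<delta>1)) / (m k)\<^sup>2"
      by (simp only: a_def bm r_def[symmetric] powr_diff powr_add power2_eq_square) simp
    then show ?thesis by (simp add: \<kappa>_def)
  qed
  have ab2lim: "(\<lambda>k. a (\<xi> k) / (b (\<xi> k))\<^sup>2) \<longlonglongrightarrow> 0"
    unfolding ab2 using tendsto_divide[OF rp[OF \<kappa>_pos(2)] tendsto_power[OF mlim, of 2]] by simp
  have slow: "a (\<xi> k) / b (\<xi> k) * L k powr \<kappa> = \<rho> powr \<kappa> / m k" for k
  proof -
    have "a (\<xi> k) / b (\<xi> k) = r k powr (2 * \<sigma> - 2 * \<delta>1) / m k"
      by (simp only: a_def bm r_def[symmetric] powr_diff) simp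
    then show ?thesis using Lr[of k \<kappa>] by (simp add: \<kappa>_def right_diff_distrib mult.commute)
  qed
  have slowlim: "(\<lambda>k. a (\<xi> k) / b (\<xi> k) * L k powr \<kappa>) \<longlonglongrightarrow> \<rho> powr \<kappa>"
    unfolding slow using tendsto_divide[OF tendsto_const mlim, of "\<rho> powr \<kappa>"] by simp
  have fast: "b (\<xi> k) * L k powr \<kappa> = \<rho> powr (2 * \<delta>1) * m k * L k powr (\<kappa> - 2 * \<delta>1)" for k
    unfolding bm Lr[of k "2 * \<delta>1", symmetric] using L0[of k] by (simp add: powr_diff)
  have fastlim: "filterlim (\<lambda>k. b (\<xi> k) * L k powr \<kappa>) at_top sequentially"
    unfolding fast
  proof (rule filterlim_tendsto_pos_mult_at_top)
    show "(\<lambda>k. \<rho> powr (2 * \<delta>1) * m k) \<longlonglongrightarrow> \<rho> powr (2 * \<delta>1) * 1"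
      by (intro tendsto_intros mlim)
    show "0 < \<rho> powr (2 * \<delta>1) * 1" using \<rho>0 by simp
    show "filterlim (\<lambda>k. L k powr (\<kappa> - 2 * \<delta>1)) at_top sequentially"
      by (rule filterlim_compose[OF filterlim_powr_at_top[OF \<kappa>_pos(2)] L])
  qed
  have osc: "\<forall>\<^sub>F k in sequentially. L k powr \<kappa> > 0 \<and> (\<exists>z z' z''. damped_oscillator (a (\<xi> k)) (b (\<xi> k)) z z' z'' \<and>
        z 0 = z0 (\<xi> k) \<and> z' 0 = z1 (\<xi> k) \<and> z (L k powr \<kappa>) = v (L k powr \<kappa>) (\<xi> k) \<and> z' (L k powr \<kappa>) = v' (L k powr \<kappa>) (\<xi> k))"
  proof (intro always_eventually allI conjI)
    fix k
    show "L k powr \<kappa> > 0" using L0[of k] by simp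
    have "good (\<xi> k)" using good by (simp add: \<xi>_def)
    then show "\<exists>z z' z''. damped_oscillator (a (\<xi> k)) (b (\<xi> k)) z z' z'' \<and>
        z 0 = z0 (\<xi> k) \<and> z' 0 = z1 (\<xi> k) \<and> z (L k powr \<kappa>) = v (L k powr \<kappa>) (\<xi> k) \<and> z' (L k powr \<kappa>) = v' (L k powr \<kappa>) (\<xi> k)"
      unfolding good_def by blast
  qed
  note lim = overdamped_limit[of "\<lambda>k. a (\<xi> k)" "\<lambda>k. b (\<xi> k)", OF a_pos[OF x0] b_pos[OF x0] osc blim ab2lim slowlim _ fastlim z0_le z1_lim[OF xlim]]
  have \<tau>: "0 < \<rho> powr \<kappa>" using \<rho>0 by simp
  have "(\<lambda>k. L k powr (\<kappa> * real j - 2 * \<delta>1) *\<^sub>R mode_dt (L k powr \<kappa>) (\<xi> k)) \<longlonglongrightarrow> profile_dt 1 \<eta> *\<^sub>R P"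
  proof (cases "j = 0")
    case True
    have mode_dt: "mode_dt t x = v t x" for t x using True unfolding mode_dt_def by simp
    have profile_dt: "profile_dt 1 \<eta> = 1 / (1 * \<rho> powr (2 * \<delta>1)) * exp (- (\<rho> powr \<kappa>))"
      using True unfolding profile_dt_def profile_def \<rho>_def by simp
    have e: "\<kappa> * real j - 2 * \<delta>1 = - 2 * \<delta>1" using True by simp
    have c: "(\<lambda>k. 1 / (m k * \<rho> powr (2 * \<delta>1))) \<longlonglongrightarrow> 1 / (1 * \<rho> powr (2 * \<delta>1))"
      using \<rho>0 by (intro tendsto_intros mlim) auto
    have L: "L k powr (- 2 * \<delta>1) = 1 / (m k * \<rho> powr (2 * \<delta>1)) * b (\<xi> k)" for k
      unfolding bm Lr[of k "2 * \<delta>1", symmetric] using L0[of k] m1[of k] r0[of k] by (simp add: powr_minus_divide)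
    have "(\<lambda>k. (1 / (m k * \<rho> powr (2 * \<delta>1))) *\<^sub>R (b (\<xi> k) *\<^sub>R v (L k powr \<kappa>) (\<xi> k)))
        \<longlonglongrightarrow> (1 / (1 * \<rho> powr (2 * \<delta>1))) *\<^sub>R (exp (- (\<rho> powr \<kappa>)) *\<^sub>R P)"
      by (rule tendsto_scaleR[OF c lim(1)[OF \<tau>]])
    then show ?thesis
      unfolding mode_dt profile_dt e L scaleR_scaleR .
  next
    case False
    then have j1: "j = 1" using j by auto
    have mode_dt: "mode_dt t x = v' t x" for t x using j1 unfolding mode_dt_def by simp
    have profile_dt: "profile_dt 1 \<eta> *\<^sub>R P = (\<rho> powr (\<kappa> - 2 * \<delta>1) / 1\<^sup>2) *\<^sub>R (- (exp (- (\<rho> powr \<kappa>)) *\<^sub>R P))"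
      unfolding profile_dt_def profile_def \<rho>_def[symmetric] using j1 by (simp add: powr_diff)
    have e: "\<kappa> * real j - 2 * \<delta>1 = \<kappa> - 2 * \<delta>1" using j1 by simp
    have c: "(\<lambda>k. \<rho> powr (\<kappa> - 2 * \<delta>1) / (m k)\<^sup>2) \<longlonglongrightarrow> \<rho> powr (\<kappa> - 2 * \<delta>1) / 1\<^sup>2"
      by (intro tendsto_intros mlim) auto
    have L: "L k powr (\<kappa> - 2 * \<delta>1) = \<rho> powr (\<kappa> - 2 * \<delta>1) / (m k)\<^sup>2 * ((b (\<xi> k))\<^sup>2 / a (\<xi> k))" for k
    proof -
      have "(b (\<xi> k))\<^sup>2 / a (\<xi> k) = (m k)\<^sup>2 / r k powr (\<kappa> - 2 * \<delta>1)"
        using arg_cong[OF ab2[of k], of inverse] by simp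
      then show ?thesis
        unfolding Lr[of k "\<kappa> - 2 * \<delta>1", symmetric] using m1[of k] r0[of k] by simp
    qed
    have "(\<lambda>k. (\<rho> powr (\<kappa> - 2 * \<delta>1) / (m k)\<^sup>2) *\<^sub>R (((b (\<xi> k))\<^sup>2 / a (\<xi> k)) *\<^sub>R v' (L k powr \<kappa>) (\<xi> k)))
        \<longlonglongrightarrow> (\<rho> powr (\<kappa> - 2 * \<delta>1) / 1\<^sup>2) *\<^sub>R (- (exp (- (\<rho> powr \<kappa>)) *\<^sub>R P))"
      by (rule tendsto_scaleR[OF c lim(2)[OF \<tau>]])
    then show ?thesis
      unfolding mode_dt profile_dt e L scaleR_scaleR[symmetric] by (simp only: scaleR_scaleR mult.assoc)
  qed
  then show ?thesis by (simp add: \<xi>_def)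
qed

end

section \<open>Sobolev weights\<close>

lemma L2_of_real_cmod:
  assumes "f \<in> L2"
  shows "(\<lambda>x. complex_of_real (cmod (f x))) \<in> L2"
proof (rule L2_dominated(1)[OF assms, where C=1])
  have [measurable]: "f \<in> borel_measurable lebesgue" using assms by (simp add: L2_def)
  show "(\<lambda>x. complex_of_real (cmod (f x))) \<in> borel_measurable lebesgue" by measurable
qed auto

lemma L2_of_real_add:
  "(\<lambda>x. complex_of_real (f x)) \<in> L2 \<Longrightarrow> (\<lambda>x. complex_of_real (weighted_data x)) \<in> L2 \<Longrightarrow> (\<lambda>x. complex_of_real (f x + weighted_data x)) \<in> L2"
  using L2_add(1) by fastforce

lemma L2_of_real_scale:
  "(\<lambda>x. complex_of_real (f x)) \<in> L2 \<Longrightarrow> (\<lambda>x. complex_of_real (c * f x)) \<in> L2"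
  using L2_scale[of "\<lambda>x. complex_of_real (f x)" "complex_of_real c"] by simp

lemma lebesgue_norm_measurable [measurable]:
  "(\<lambda>x::'a::euclidean_space. norm x) \<in> borel_measurable lebesgue"
  by (rule measurable_completion) simp

lemma not_AE_lebesgue_False: "\<not> (AE x in (lebesgue :: 'a::euclidean_space measure). False)"
proof
  assume "AE x in (lebesgue :: 'a measure). False"
  then have "AE x in (lborel :: 'a measure). False" by (simp add: AE_completion_iff)
  then have "emeasure (lborel :: 'a measure) UNIV = 0"
    by (subst (asm) AE_iff_measurable[of UNIV]) auto
  then show False by simp
qed

lemma norm_powr_le_weight:
  fixes \<xi> :: "'a::euclidean_space"
  assumes "x \<ge> 0"
  shows "norm \<xi> powr x \<le> (1 + (norm \<xi>)\<^sup>2) powr (x / 2)"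
proof (cases "\<xi> = 0")
  case False
  then have "norm \<xi> powr x = ((norm \<xi>)\<^sup>2) powr (x / 2)"
    by (simp add: powr_powr flip: powr_numeral)
  also have "\<dots> \<le> (1 + (norm \<xi>)\<^sup>2) powr (x / 2)"
    using assms by (intro powr_mono2) auto
  finally show ?thesis .
qed simp

lemma weight_mono:
  fixes \<xi> :: "'a::euclidean_space"
  assumes "x \<le> y"
  shows "(1 + (norm \<xi>)\<^sup>2) powr (x / 2) \<le> (1 + (norm \<xi>)\<^sup>2) powr (y / 2)"
  using assms by (intro powr_mono) auto

lemma norm_powr_le_weight_mono:
  fixes \<xi> :: "'a::euclidean_space"
  assumes "0 \<le> x" "x \<le> y"
  shows "norm \<xi> powr x \<le> (1 + (norm \<xi>)\<^sup>2) powr (y / 2)"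
  using norm_powr_le_weight[OF assms(1)] weight_mono[OF assms(2)] by (rule order_trans)

lemma weight_low:
  fixes \<xi> :: "'a::euclidean_space"
  assumes "norm \<xi> \<le> 1" "x \<ge> 0"
  shows "(1 + (norm \<xi>)\<^sup>2) powr (x / 2) \<le> 2 powr (x / 2)"
proof -
  have "(norm \<xi>)\<^sup>2 \<le> 1" using assms by (simp add: power_le_one)
  then show ?thesis using assms by (intro powr_mono2) auto
qed

lemma weight_high:
  fixes \<xi> :: "'a::euclidean_space"
  assumes "norm \<xi> \<ge> 1" "x \<ge> 0"
  shows "(1 + (norm \<xi>)\<^sup>2) powr (x / 2) \<le> 2 powr (x / 2) * norm \<xi> powr x"
proof -
  have x0: "\<xi> \<noteq> 0" using assms by auto
  have "1 \<le> (norm \<xi>)\<^sup>2" using assms by (simp add: one_le_power)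
  then have "(1 + (norm \<xi>)\<^sup>2) powr (x / 2) \<le> (2 * (norm \<xi>)\<^sup>2) powr (x / 2)"
    using assms by (intro powr_mono2) auto
  also have "\<dots> = 2 powr (x / 2) * norm \<xi> powr x"
    using x0 by (simp add: powr_mult powr_powr flip: powr_numeral)
  finally show ?thesis .
qed

section \<open>High frequencies and square integrability\<close>

context damped_frequencies
begin

text \<open>The data with the weights of their Sobolev spaces, as a single majorant.\<close>

definition weighted_data :: "'a \<Rightarrow> real" where
  "weighted_data \<xi> = (1 + (norm \<xi>)\<^sup>2) powr ((s + 2 * real j * \<delta>2) / 2) * cmod (z0 \<xi>)
      + (1 + (norm \<xi>)\<^sup>2) powr (max (s + 2 * (real j - 1) * \<delta>2) 0 / 2) * cmod (z1 \<xi>)"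

lemma weighted_data_nonneg: "weighted_data \<xi> \<ge> 0"
  unfolding weighted_data_def by (intro add_nonneg_nonneg mult_nonneg_nonneg) auto

lemma weighted_data_L2: "(\<lambda>\<xi>. complex_of_real (weighted_data \<xi>)) \<in> L2"
  using L2_of_real_add[OF L2_of_real_cmod[OF z0_weight] L2_of_real_cmod[OF z1_weight]]
  by (simp add: weighted_data_def[abs_def] norm_mult)

text \<open>At high frequencies \<open>1 / b\<close> gains \<open>2 \<delta>2\<close> derivatives on the second datum, which is why \<open>u1\<close> may have less
  regularity than \<open>u0\<close>.\<close>

lemma position_weight:
  assumes good: "good \<xi>" and r: "norm \<xi> \<ge> 1" and t: "t \<ge> 0"
  shows "norm \<xi> powr s * cmod (v t \<xi>) \<le> 3 * weighted_data \<xi> * exp (- (a \<xi> / (4 * b \<xi>)) * t)"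
proof -
  let ?E = "exp (- (a \<xi> / (4 * b \<xi>)) * t)"
  have x0: "\<xi> \<noteq> 0" using r by auto
  have bp: "b \<xi> > 0" using b_pos[OF x0] .
  have "cmod (v t \<xi>) \<le> 3 * (cmod (z1 \<xi>) / b \<xi> + cmod (z0 \<xi>)) * ?E"
  proof -
    have "b \<xi> * cmod (v t \<xi>) \<le> b \<xi> * (3 * (cmod (z1 \<xi>) / b \<xi> + cmod (z0 \<xi>)) * ?E)"
      using position[OF good t] bp by (simp add: algebra_simps)
    then show ?thesis using bp by simp
  qed
  also have "\<dots> \<le> 3 * (cmod (z1 \<xi>) / norm \<xi> powr (2 * \<delta>2) + cmod (z0 \<xi>)) * ?E"
    using b_lower[of \<xi>] bp x0 by (intro mult_right_mono mult_left_mono add_right_mono divide_left_mono) auto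
  finally have "norm \<xi> powr s * cmod (v t \<xi>)
      \<le> norm \<xi> powr s * (3 * (cmod (z1 \<xi>) / norm \<xi> powr (2 * \<delta>2) + cmod (z0 \<xi>)) * ?E)"
    by (intro mult_left_mono) auto
  also have "\<dots> = 3 * (norm \<xi> powr s * cmod (z0 \<xi>) + norm \<xi> powr (s - 2 * \<delta>2) * cmod (z1 \<xi>)) * ?E"
    by (simp add: powr_diff algebra_simps)
  also have "\<dots> \<le> 3 * weighted_data \<xi> * ?E"
  proof -
    have "s \<le> s + 2 * real j * \<delta>2" using \<delta>1 \<delta>2 by simp
    then have 1: "norm \<xi> powr s \<le> (1 + (norm \<xi>)\<^sup>2) powr ((s + 2 * real j * \<delta>2) / 2)"
      by (rule norm_powr_le_weight_mono[OF s])
    have "0 \<le> 2 * real j * \<delta>2" using \<delta>1 \<delta>2 by simp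
    then have "norm \<xi> powr (s - 2 * \<delta>2) \<le> norm \<xi> powr (max (s + 2 * (real j - 1) * \<delta>2) 0)"
      using r by (intro powr_mono) (auto simp: algebra_simps max_def)
    also have "\<dots> \<le> (1 + (norm \<xi>)\<^sup>2) powr (max (s + 2 * (real j - 1) * \<delta>2) 0 / 2)"
      by (rule norm_powr_le_weight) simp
    finally show ?thesis
      unfolding weighted_data_def using 1 by (intro mult_right_mono mult_left_mono add_mono) auto
  qed
  finally show ?thesis .
qed

text \<open>The factor \<open>b\<close> in front of the first datum costs up to \<open>2 \<delta>2\<close> derivatives, at every frequency.\<close>

lemma velocity_weight:
  assumes good: "good \<xi>" and j1: "j = 1" and t: "t \<ge> 0"
  shows "norm \<xi> powr s * cmod (v' t \<xi>) \<le> 4 * weighted_data \<xi> * exp (- (a \<xi> / (4 * b \<xi>)) * t)"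
proof -
  let ?E = "exp (- (a \<xi> / (4 * b \<xi>)) * t)"
  have sj: "max (s + 2 * (real j - 1) * \<delta>2) 0 = s" "s + 2 * real j * \<delta>2 = s + 2 * \<delta>2"
    using j1 s by auto
  have "norm \<xi> powr s * b \<xi> = norm \<xi> powr (s + 2 * \<delta>1) + norm \<xi> powr (s + 2 * \<delta>2)"
    by (simp add: b_def distrib_left powr_add)
  also have "\<dots> \<le> (1 + (norm \<xi>)\<^sup>2) powr ((s + 2 * \<delta>2) / 2) + (1 + (norm \<xi>)\<^sup>2) powr ((s + 2 * \<delta>2) / 2)"
    using s \<delta>1 \<delta>2 by (intro add_mono norm_powr_le_weight_mono) auto
  finally have 0: "norm \<xi> powr s * b \<xi> \<le> 2 * (1 + (norm \<xi>)\<^sup>2) powr ((s + 2 * \<delta>2) / 2)" by simp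
  have 1: "norm \<xi> powr s \<le> 2 * (1 + (norm \<xi>)\<^sup>2) powr (s / 2)"
    using norm_powr_le_weight[OF s, of \<xi>] powr_ge_zero[of "1 + (norm \<xi>)\<^sup>2" "s / 2"] by linarith
  have "norm \<xi> powr s * cmod (v' t \<xi>) \<le> norm \<xi> powr s * (2 * (cmod (z1 \<xi>) + b \<xi> * cmod (z0 \<xi>)) * ?E)"
    using velocity[OF good t] by (intro mult_left_mono) auto
  also have "\<dots> = 2 * ((norm \<xi> powr s * b \<xi>) * cmod (z0 \<xi>) + norm \<xi> powr s * cmod (z1 \<xi>)) * ?E"
    by (simp add: algebra_simps)
  also have "\<dots> \<le> 2 * ((2 * (1 + (norm \<xi>)\<^sup>2) powr ((s + 2 * \<delta>2) / 2)) * cmod (z0 \<xi>)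
        + (2 * (1 + (norm \<xi>)\<^sup>2) powr (s / 2)) * cmod (z1 \<xi>)) * ?E"
    using 0 1 by (intro mult_right_mono mult_left_mono add_mono) auto
  also have "\<dots> = 4 * weighted_data \<xi> * ?E"
    unfolding weighted_data_def sj by (simp add: algebra_simps)
  finally show ?thesis .
qed

lemma high_frequency_bound:
  assumes good: "good \<xi>" and r: "norm \<xi> \<ge> 1" and t: "t \<ge> 0"
  shows "norm \<xi> powr s * cmod (mode_dt t \<xi>) \<le> 4 * weighted_data \<xi> * exp (- t / 8)"
proof -
  let ?E = "exp (- (a \<xi> / (4 * b \<xi>)) * t)"
  have "norm \<xi> powr s * cmod (mode_dt t \<xi>) \<le> 4 * weighted_data \<xi> * ?E"
  proof (cases "j = 0")
    case True
    have "norm \<xi> powr s * cmod (v t \<xi>) \<le> 3 * weighted_data \<xi> * ?E"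
      by (rule position_weight[OF good r t])
    also have "\<dots> \<le> 4 * weighted_data \<xi> * ?E" using weighted_data_nonneg[of \<xi>] by (intro mult_right_mono) auto
    finally show ?thesis using True unfolding mode_dt_def by simp
  next
    case False
    then have j1: "j = 1" using j by auto
    show ?thesis using velocity_weight[OF good j1 t] False unfolding mode_dt_def by simp
  qed
  also have "\<dots> \<le> 4 * weighted_data \<xi> * exp (- t / 8)"
  proof -
    have "1 / 8 * t \<le> (a \<xi> / b \<xi>) / 4 * t"
    proof (rule mult_right_mono)
      show "1 / 8 \<le> (a \<xi> / b \<xi>) / 4" using divide_right_mono[OF rate_high[OF r], of 4] by simp
    qed (rule t)
    then show ?thesis using weighted_data_nonneg[of \<xi>] by (intro mult_left_mono) auto
  qed
  finally show ?thesis .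
qed

lemma profile_eq: "profile t \<xi> = norm \<xi> powr (- 2 * \<delta>1) * exp (- t * norm \<xi> powr \<kappa>)"
  by (simp add: profile_def powr_minus_divide)

lemma profile_nonneg: "profile t \<xi> \<ge> 0" by (simp add: profile_def)

lemma norm_powr_profile: "norm \<xi> powr p * profile t \<xi> = norm \<xi> powr (p - 2 * \<delta>1) * exp (- t * norm \<xi> powr \<kappa>)"
  by (simp add: profile_def powr_diff)

lemma profile_L2:
  assumes "t > 0" "p \<ge> 0"
  shows "(\<lambda>\<xi>. complex_of_real (norm \<xi> powr p * profile t \<xi>)) \<in> L2"
  unfolding norm_powr_profile
  using norm_powr_exp_L2[where 'a='a, of "p - 2 * \<delta>1" t \<kappa>] assms dim \<kappa>_pos by simp

lemma profile_L2': "t > 0 \<Longrightarrow> (\<lambda>\<xi>. complex_of_real (profile t \<xi>)) \<in> L2"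
  using norm_powr_exp_L2[where 'a='a, of "- 2 * \<delta>1" t \<kappa>] dim \<kappa>_pos by (simp only: profile_eq)

lemma v_measurable [measurable]: "t \<ge> 0 \<Longrightarrow> v t \<in> borel_measurable lebesgue"
  using v_L2[of t] by (simp add: L2_def)

text \<open>The number \<open>Q\<close> is kept free in order to treat the solution (\<open>Q = 0\<close>) and the remainder (\<open>Q = P\<close>) together.\<close>

lemma sobolev_weight_L2:
  assumes t: "t > 0"
  shows "(\<lambda>\<xi>. complex_of_real ((1 + (norm \<xi>)\<^sup>2) powr (s / 2)) * (v t \<xi> - Q * complex_of_real (profile t \<xi>))) \<in> L2"
proof -
  have [measurable]: "v t \<in> borel_measurable lebesgue" by (rule v_measurable) (use t in simp)
  have [measurable]: "(\<lambda>\<xi>. profile t \<xi>) \<in> borel_measurable lebesgue" unfolding profile_def[abs_def] by measurable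
  let ?H = "\<lambda>\<xi>. cmod (v t \<xi>) + 3 * weighted_data \<xi> + cmod Q * (profile t \<xi> + norm \<xi> powr s * profile t \<xi>)"
  have H: "(\<lambda>\<xi>. complex_of_real (?H \<xi>)) \<in> L2"
    using t s by (intro L2_of_real_add L2_of_real_scale L2_of_real_cmod v_L2 weighted_data_L2 profile_L2 profile_L2') auto
  show ?thesis
  proof (rule L2_dominated(1)[OF H, where C="2 powr (s / 2)"])
    show "AE \<xi> in lebesgue. cmod (complex_of_real ((1 + (norm \<xi>)\<^sup>2) powr (s / 2)) * (v t \<xi> - Q * complex_of_real (profile t \<xi>)))
        \<le> 2 powr (s / 2) * cmod (complex_of_real (?H \<xi>))"
      using AE_good
    proof eventually_elim
      case (elim \<xi>)
      let ?w = "(1 + (norm \<xi>)\<^sup>2) powr (s / 2)"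
      have tri: "cmod (v t \<xi> - Q * complex_of_real (profile t \<xi>)) \<le> cmod (v t \<xi>) + cmod Q * profile t \<xi>"
        using norm_triangle_ineq4[of "v t \<xi>" "Q * complex_of_real (profile t \<xi>)"] profile_nonneg[of t \<xi>] by (simp add: norm_mult)
      have nn: "?H \<xi> \<ge> 0" "0 \<le> 3 * weighted_data \<xi>" "0 \<le> norm \<xi> powr s * profile t \<xi>" "0 \<le> cmod Q * profile t \<xi>"
          "0 \<le> cmod Q * (norm \<xi> powr s * profile t \<xi>)"
        using weighted_data_nonneg[of \<xi>] profile_nonneg[of t \<xi>] by auto
      have "?w * (cmod (v t \<xi>) + cmod Q * profile t \<xi>) \<le> 2 powr (s / 2) * ?H \<xi>"
      proof (cases "norm \<xi> \<le> 1")
        case True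
        then show ?thesis
          using weight_low[OF True s] nn by (intro mult_mono) (auto simp: distrib_left)
      next
        case False
        then have r1: "norm \<xi> \<ge> 1" by simp
        have "?w * (cmod (v t \<xi>) + cmod Q * profile t \<xi>)
            \<le> (2 powr (s / 2) * norm \<xi> powr s) * (cmod (v t \<xi>) + cmod Q * profile t \<xi>)"
          using weight_high[OF r1 s] nn by (intro mult_right_mono) auto
        also have "\<dots> = 2 powr (s / 2) * (norm \<xi> powr s * cmod (v t \<xi>) + cmod Q * (norm \<xi> powr s * profile t \<xi>))"
          by (simp add: algebra_simps)
        also have "\<dots> \<le> 2 powr (s / 2) * ?H \<xi>"
        proof (intro mult_left_mono)
          have "norm \<xi> powr s * cmod (v t \<xi>) \<le> 3 * weighted_data \<xi> * exp (- (a \<xi> / (4 * b \<xi>)) * t)"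
            using position_weight[OF elim r1] t by simp
          also have "\<dots> \<le> 3 * weighted_data \<xi> * 1"
            using nn(2) t a_pos[of \<xi>] b_pos[of \<xi>] elim by (intro mult_left_mono) (auto simp: good_def)
          finally show "norm \<xi> powr s * cmod (v t \<xi>) + cmod Q * (norm \<xi> powr s * profile t \<xi>) \<le> ?H \<xi>"
            using nn by (simp add: distrib_left add_increasing)
        qed simp
        finally show ?thesis .
      qed
      moreover have "?w * cmod (v t \<xi> - Q * complex_of_real (profile t \<xi>)) \<le> ?w * (cmod (v t \<xi>) + cmod Q * profile t \<xi>)"
        using tri by (intro mult_left_mono) auto
      ultimately have "?w * cmod (v t \<xi> - Q * complex_of_real (profile t \<xi>)) \<le> 2 powr (s / 2) * ?H \<xi>"
        by linarith
      then show ?case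
        using nn(1) by (simp add: norm_mult del: of_real_add of_real_mult)
    qed
  qed measurable
qed

lemma weighted_L2:
  assumes t: "t > 0"
  shows "(\<lambda>\<xi>. complex_of_real (norm \<xi> powr s) * (v t \<xi> - Q * complex_of_real (profile t \<xi>))) \<in> L2"
proof (rule L2_dominated(1)[OF sobolev_weight_L2[OF t, of Q], where C=1])
  have [measurable]: "v t \<in> borel_measurable lebesgue" by (rule v_measurable) (use t in simp)
  have [measurable]: "(\<lambda>\<xi>. profile t \<xi>) \<in> borel_measurable lebesgue" unfolding profile_def[abs_def] by measurable
  show "(\<lambda>\<xi>. complex_of_real (norm \<xi> powr s) * (v t \<xi> - Q * complex_of_real (profile t \<xi>))) \<in> borel_measurable lebesgue"
    by measurable
  show "AE \<xi> in lebesgue. cmod (complex_of_real (norm \<xi> powr s) * (v t \<xi> - Q * complex_of_real (profile t \<xi>)))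
      \<le> 1 * cmod (complex_of_real ((1 + (norm \<xi>)\<^sup>2) powr (s / 2)) * (v t \<xi> - Q * complex_of_real (profile t \<xi>)))"
    using norm_powr_le_weight[OF s] by (auto simp: norm_mult intro!: AE_I2 mult_right_mono)
qed simp

text \<open>The velocity bound is uniform in time, so it dominates the difference quotients of \<open>v\<close>; for the profile,
  times above \<open>t / 2\<close> are dominated by the value at \<open>t / 2\<close>.\<close>

lemma weighted_derivative:
  assumes j1: "j = 1" and t: "t > 0"
  shows "has_L2_derivative (\<lambda>\<tau> \<xi>. complex_of_real (norm \<xi> powr s) * (v \<tau> \<xi> - Q * complex_of_real (profile \<tau> \<xi>)))
           (\<lambda>\<xi>. complex_of_real (norm \<xi> powr s) * (mode_dt t \<xi> - Q * complex_of_real (profile_dt t \<xi>))) t"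
    and "(\<lambda>\<xi>. complex_of_real (norm \<xi> powr s) * (mode_dt t \<xi> - Q * complex_of_real (profile_dt t \<xi>))) \<in> L2"
proof -
  let ?U = "\<lambda>\<tau> \<xi>. complex_of_real (norm \<xi> powr s) * (v \<tau> \<xi> - Q * complex_of_real (profile \<tau> \<xi>))"
  let ?V = "\<lambda>\<tau> \<xi>. complex_of_real (norm \<xi> powr s) * (mode_dt \<tau> \<xi> - Q * complex_of_real (profile_dt \<tau> \<xi>))"
  let ?H = "\<lambda>\<xi>. 4 * weighted_data \<xi> + cmod Q * (norm \<xi> powr (s + \<kappa>) * profile (t / 2) \<xi>)"
  have H: "(\<lambda>\<xi>. complex_of_real (?H \<xi>)) \<in> L2"
    using t s \<kappa>_pos by (intro L2_of_real_add L2_of_real_scale weighted_data_L2 profile_L2) auto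
  have ae: "AE \<xi> in lebesgue. \<forall>\<tau>. \<bar>\<tau> - t\<bar> < t / 2 \<longrightarrow>
      ((\<lambda>\<tau>. ?U \<tau> \<xi>) has_vector_derivative ?V \<tau> \<xi>) (at \<tau>) \<and> cmod (?V \<tau> \<xi>) \<le> cmod (complex_of_real (?H \<xi>))"
    using AE_good
  proof eventually_elim
    case (elim \<xi>)
    show ?case
    proof (intro allI impI conjI)
      fix \<tau> :: real assume "\<bar>\<tau> - t\<bar> < t / 2"
      then have \<tau>: "\<tau> > t / 2" "\<tau> > 0" using t by linarith+
      have "at \<tau> within {0..} = at \<tau>"
        using \<tau> by (intro at_within_interior) (auto simp: interior_Ici)
      then have dv: "((\<lambda>\<tau>. v \<tau> \<xi>) has_vector_derivative mode_dt \<tau> \<xi>) (at \<tau>)"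
        using v_deriv[OF elim, of \<tau>] \<tau> j1 unfolding mode_dt_def by simp
      have "((\<lambda>\<tau>. profile \<tau> \<xi>) has_real_derivative profile_dt \<tau> \<xi>) (at \<tau>)"
        using j1 elim unfolding profile_def profile_dt_def good_def by (auto intro!: derivative_eq_intros)
      then have dg: "((\<lambda>\<tau>. complex_of_real (profile \<tau> \<xi>)) has_vector_derivative complex_of_real (profile_dt \<tau> \<xi>)) (at \<tau>)"
        unfolding has_real_derivative_iff_has_vector_derivative
        by (rule bounded_linear.has_vector_derivative[OF bounded_linear_of_real])
      show "((\<lambda>\<tau>. ?U \<tau> \<xi>) has_vector_derivative ?V \<tau> \<xi>) (at \<tau>)"
        by (intro has_vector_derivative_mult_right has_vector_derivative_diff dv dg)
      have "norm \<xi> powr s * cmod (mode_dt \<tau> \<xi>) \<le> 4 * weighted_data \<xi> * exp (- (a \<xi> / (4 * b \<xi>)) * \<tau>)"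
        using velocity_weight[OF elim j1, of \<tau>] \<tau> j1 unfolding mode_dt_def by simp
      also have "\<dots> \<le> 4 * weighted_data \<xi> * 1"
        using weighted_data_nonneg[of \<xi>] \<tau> a_pos[of \<xi>] b_pos[of \<xi>] elim by (intro mult_left_mono) (auto simp: good_def)
      finally have 1: "norm \<xi> powr s * cmod (mode_dt \<tau> \<xi>) \<le> 4 * weighted_data \<xi>" by simp
      have 2: "norm \<xi> powr s * \<bar>profile_dt \<tau> \<xi>\<bar> \<le> norm \<xi> powr (s + \<kappa>) * profile (t / 2) \<xi>"
      proof -
        have "profile \<tau> \<xi> \<le> profile (t / 2) \<xi>"
        proof -
          have "t / 2 * norm \<xi> powr \<kappa> \<le> \<tau> * norm \<xi> powr \<kappa>" using \<tau> by (intro mult_right_mono) auto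
          then show ?thesis unfolding profile_def by (intro divide_right_mono) auto
        qed
        moreover have "norm \<xi> powr s * \<bar>profile_dt \<tau> \<xi>\<bar> = norm \<xi> powr (s + \<kappa>) * profile \<tau> \<xi>"
          unfolding profile_dt_def using j1 profile_nonneg[of \<tau> \<xi>] by (simp add: abs_mult powr_add)
        ultimately show ?thesis by (simp add: mult_left_mono)
      qed
      have "cmod (?V \<tau> \<xi>) = norm \<xi> powr s * cmod (mode_dt \<tau> \<xi> - Q * complex_of_real (profile_dt \<tau> \<xi>))"
        by (simp add: norm_mult)
      also have "\<dots> \<le> norm \<xi> powr s * (cmod (mode_dt \<tau> \<xi>) + cmod Q * \<bar>profile_dt \<tau> \<xi>\<bar>)"
        using norm_triangle_ineq4[of "mode_dt \<tau> \<xi>" "Q * complex_of_real (profile_dt \<tau> \<xi>)"]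
        by (intro mult_left_mono) (auto simp: norm_mult)
      also have "\<dots> = norm \<xi> powr s * cmod (mode_dt \<tau> \<xi>) + cmod Q * (norm \<xi> powr s * \<bar>profile_dt \<tau> \<xi>\<bar>)"
        by (simp add: algebra_simps)
      also have "\<dots> \<le> ?H \<xi>"
        using 1 2 by (intro add_mono mult_left_mono) auto
      also have "\<dots> \<le> cmod (complex_of_real (?H \<xi>))" by (simp only: norm_of_real abs_ge_self)
      finally show "cmod (?V \<tau> \<xi>) \<le> cmod (complex_of_real (?H \<xi>))" .
    qed
  qed
  have UL: "?U \<tau> \<in> L2" if "\<bar>\<tau> - t\<bar> < t / 2" for \<tau>
    using that by (intro weighted_L2) linarith
  have "t / 2 > 0" using t by simp
  note * = has_L2_derivative_dominated[OF this H UL ae]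
  show "has_L2_derivative ?U (?V t) t" "?V t \<in> L2" using * by auto
qed

definition remainder :: "real \<Rightarrow> 'a \<Rightarrow> complex" where
  "remainder t \<xi> = complex_of_real (norm \<xi> powr s) * (mode_dt t \<xi> - P * complex_of_real (profile_dt t \<xi>))"

lemma weighted_mode_L2:
  assumes t: "t > 0"
  shows "(\<lambda>\<xi>. complex_of_real (norm \<xi> powr s) * (mode_dt t \<xi> - Q * complex_of_real (profile_dt t \<xi>))) \<in> L2"
proof (cases "j = 0")
  case True
  then show ?thesis using weighted_L2[OF t, of Q] unfolding mode_dt_def profile_dt_def by simp
next
  case False
  then have "j = 1" using j by auto
  from weighted_derivative(2)[OF this t] show ?thesis .
qed

lemma remainder_L2: "t > 0 \<Longrightarrow> remainder t \<in> L2"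
  unfolding remainder_def[abs_def] by (rule weighted_mode_L2)

text \<open>For \<open>j = 1\<close> measurability of the velocity comes from its being the limit of difference quotients.\<close>

lemma mode_dt_measurable:
  assumes t: "t > 0"
  shows "mode_dt t \<in> borel_measurable lebesgue"
proof (rule borel_measurable_lebesgue_cong_AE)
  have [measurable]: "(\<lambda>\<xi>. complex_of_real (norm \<xi> powr s) * (mode_dt t \<xi> - 0 * complex_of_real (profile_dt t \<xi>))) \<in> borel_measurable lebesgue"
    using weighted_mode_L2[OF t, of 0] by (simp only: L2_def mem_Collect_eq)
  show "(\<lambda>\<xi>. complex_of_real (norm \<xi> powr (- s)) * (complex_of_real (norm \<xi> powr s) * (mode_dt t \<xi> - 0 * complex_of_real (profile_dt t \<xi>)))) \<in> borel_measurable lebesgue"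
    by measurable
  show "AE \<xi> in lebesgue. complex_of_real (norm \<xi> powr (- s)) * (complex_of_real (norm \<xi> powr s) * (mode_dt t \<xi> - 0 * complex_of_real (profile_dt t \<xi>))) = mode_dt t \<xi>"
    using AE_good
  proof eventually_elim
    case (elim \<xi>)
    then have "norm \<xi> powr (- s) * norm \<xi> powr s = 1"
      by (simp add: good_def powr_add[symmetric])
    then have "complex_of_real (norm \<xi> powr (- s)) * complex_of_real (norm \<xi> powr s) = 1"
      by (metis of_real_1 of_real_mult)
    then show ?case by (simp add: mult.assoc[symmetric] del: of_real_mult)
  qed
qed

text \<open>The profile is homogeneous under the parabolic scaling \<open>(t, \<xi>) \<mapsto> (L^\<kappa> t, \<xi> / L)\<close>.\<close>

lemma profile_dt_dilation:
  assumes L: "L > 0"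
  shows "profile_dt (L powr \<kappa>) ((1 / L) *\<^sub>R \<eta>) = L powr (2 * \<delta>1 - \<kappa> * real j) * profile_dt 1 \<eta>"
proof -
  have n: "norm ((1 / L) *\<^sub>R \<eta>) = norm \<eta> / L" using L by simp
  have k: "(norm \<eta> / L) powr p = norm \<eta> powr p / L powr p" for p
    using L by (simp add: powr_divide)
  have "profile (L powr \<kappa>) ((1 / L) *\<^sub>R \<eta>) = L powr (2 * \<delta>1) * profile 1 \<eta>"
    unfolding profile_def n k using L by simp
  then show ?thesis
    unfolding profile_dt_def n k using L j by (auto simp: powr_diff)
qed

section \<open>Decay of the remainder\<close>

text \<open>The remainder at time \<open>L^\<kappa>\<close> and frequency \<open>\<eta> / L\<close>, normalised so that the profile no longer depends on \<open>L\<close>, and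
  cut off at \<open>|\<xi>| = 1\<close>.\<close>

definition scaled :: "real \<Rightarrow> 'a \<Rightarrow> complex" where
  "scaled L \<eta> = complex_of_real (norm \<eta> powr s) *
     (if norm \<eta> \<le> L then L powr (\<kappa> * real j - 2 * \<delta>1) *\<^sub>R mode_dt (L powr \<kappa>) ((1 / L) *\<^sub>R \<eta>) - profile_dt 1 \<eta> *\<^sub>R P else 0)"

lemma profile_dt_1_L2: "(\<lambda>\<eta>. complex_of_real (norm \<eta> powr s * \<bar>profile_dt 1 \<eta>\<bar>)) \<in> L2"
proof (cases "j = 0")
  case True
  then show ?thesis using profile_L2[of 1 s] s profile_nonneg unfolding profile_dt_def by simp
next
  case False
  then have "norm \<eta> powr s * \<bar>profile_dt 1 \<eta>\<bar> = norm \<eta> powr (s + \<kappa>) * profile 1 \<eta>" for \<eta>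
    unfolding profile_dt_def using profile_nonneg[of 1 \<eta>] by (simp add: abs_mult powr_add)
  then show ?thesis using profile_L2[of 1 "s + \<kappa>"] s \<kappa>_pos by simp
qed

lemma dominant_L2: "(\<lambda>\<eta>. complex_of_real (norm \<eta> powr s * dominant \<eta>)) \<in> L2"
proof -
  have "norm \<eta> powr s * dominant \<eta> = B * (9 * (norm \<eta> powr (s - 2 * \<delta>1) * exp (- (1 / 8) * norm \<eta> powr \<kappa>))
     + 12 * (norm \<eta> powr (s + \<kappa> - 2 * \<delta>1) * exp (- (1 / 8) * norm \<eta> powr \<kappa>))
     + 2 * (norm \<eta> powr (s - 2 * \<delta>1) * exp (- (1 / 2) * norm \<eta> powr (2 * \<delta>1))))" for \<eta> :: 'a
    unfolding dominant_def by (simp add: powr_diff powr_add powr_minus_divide distrib_left mult_ac)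
  then show ?thesis
    using s \<delta>1 dim \<kappa>_pos by (simp only:) (intro L2_of_real_scale L2_of_real_add norm_powr_exp_L2; simp)
qed

text \<open>Each dilation moves the null set of exceptional frequencies. For a sequence of dilations the union of
  these sets is still null, so the limit is taken along sequences.\<close>

lemma scaled_tendsto: "((\<lambda>L. L2norm (scaled L)) \<longlongrightarrow> 0) at_top"
proof (rule tendsto_at_topI_sequentially)
  fix X :: "nat \<Rightarrow> real" assume X: "filterlim X at_top sequentially"
  define Y where "Y k = max 1 (X k)" for k
  have XY: "\<forall>\<^sub>F k in sequentially. Y k = X k"
  proof -
    have "\<forall>\<^sub>F k in sequentially. X k \<ge> 1" using X by (simp add: filterlim_at_top)
    then show ?thesis by eventually_elim (simp add: Y_def)
  qed
  have Y1: "Y k \<ge> 1" for k by (simp add: Y_def)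
  have Y: "filterlim Y at_top sequentially"
    using filterlim_cong[OF refl refl XY] X by simp
  have good: "AE \<eta> in lebesgue. \<forall>k. good ((1 / Y k) *\<^sub>R \<eta>)"
    unfolding AE_all_countable
  proof
    fix k
    have "1 / Y k > 0" using Y1[of k] by simp
    from AE_dilation[OF AE_good this] show "AE \<eta> in lebesgue. good ((1 / Y k) *\<^sub>R \<eta>)" .
  qed
  let ?H = "\<lambda>\<eta>. norm \<eta> powr s * dominant \<eta> + cmod P * (norm \<eta> powr s * \<bar>profile_dt 1 \<eta>\<bar>)"
  have "(\<lambda>k. L2norm (scaled (Y k))) \<longlonglongrightarrow> 0"
  proof (rule L2_dominated_convergence_eventually)
    fix k
    have "mode_dt (Y k powr \<kappa>) \<in> borel_measurable lebesgue"
      using Y1[of k] by (intro mode_dt_measurable) auto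
    from measurable_compose[OF lebesgue_dilation_measurable this]
    have [measurable]: "(\<lambda>\<eta>. mode_dt (Y k powr \<kappa>) ((1 / Y k) *\<^sub>R \<eta>)) \<in> borel_measurable lebesgue" .
    have [measurable]: "(\<lambda>\<eta>. profile_dt 1 \<eta>) \<in> borel_measurable lebesgue"
      unfolding profile_dt_def[abs_def] profile_def[abs_def] by measurable
    show "scaled (Y k) \<in> borel_measurable lebesgue"
      unfolding scaled_def[abs_def] by measurable
  next
    show "(\<lambda>\<eta>. complex_of_real (?H \<eta>)) \<in> L2"
      by (intro L2_of_real_add L2_of_real_scale dominant_L2 profile_dt_1_L2)
    have "AE \<eta> in lebesgue. cmod (scaled (Y k) \<eta>) \<le> cmod (complex_of_real (?H \<eta>))" for k
      using good
    proof eventually_elim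
      case (elim \<eta>)
      have nn: "0 \<le> dominant \<eta>" unfolding dominant_def using B_nonneg by auto
      show ?case
      proof (cases "norm \<eta> \<le> Y k")
        case True
        have "cmod (scaled (Y k) \<eta>) \<le> norm \<eta> powr s * (Y k powr (\<kappa> * real j - 2 * \<delta>1) * cmod (mode_dt (Y k powr \<kappa>) ((1 / Y k) *\<^sub>R \<eta>))
              + \<bar>profile_dt 1 \<eta>\<bar> * cmod P)"
          using True norm_triangle_ineq4[of "Y k powr (\<kappa> * real j - 2 * \<delta>1) *\<^sub>R mode_dt (Y k powr \<kappa>) ((1 / Y k) *\<^sub>R \<eta>)" "profile_dt 1 \<eta> *\<^sub>R P"]
          by (auto simp: scaled_def norm_mult intro!: mult_left_mono)
        also have "\<dots> \<le> norm \<eta> powr s * (dominant \<eta> + \<bar>profile_dt 1 \<eta>\<bar> * cmod P)"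
          using low_frequency_bound[OF Y1 True] elim by (intro mult_left_mono add_right_mono) auto
        also have "\<dots> = ?H \<eta>" by (simp add: algebra_simps)
        also have "\<dots> \<le> cmod (complex_of_real (?H \<eta>))" by (simp only: norm_of_real abs_ge_self)
        finally show ?thesis .
      qed (simp add: scaled_def)
    qed
    then show "\<forall>\<^sub>F k in sequentially. AE \<eta> in lebesgue. cmod (scaled (Y k) \<eta>) \<le> cmod (complex_of_real (?H \<eta>))"
      by simp
    show "AE \<eta> in lebesgue. (\<lambda>k. scaled (Y k) \<eta>) \<longlonglongrightarrow> 0"
      using good
    proof eventually_elim
      case (elim \<eta>)
      have "(\<lambda>k. Y k powr (\<kappa> * real j - 2 * \<delta>1) *\<^sub>R mode_dt (Y k powr \<kappa>) ((1 / Y k) *\<^sub>R \<eta>)) \<longlonglongrightarrow> profile_dt 1 \<eta> *\<^sub>R P"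
        using elim by (intro low_frequency_limit Y Y1) auto
      then have "(\<lambda>k. complex_of_real (norm \<eta> powr s) * (Y k powr (\<kappa> * real j - 2 * \<delta>1) *\<^sub>R mode_dt (Y k powr \<kappa>) ((1 / Y k) *\<^sub>R \<eta>) - profile_dt 1 \<eta> *\<^sub>R P))
          \<longlonglongrightarrow> complex_of_real (norm \<eta> powr s) * (profile_dt 1 \<eta> *\<^sub>R P - profile_dt 1 \<eta> *\<^sub>R P)"
        by (intro tendsto_mult tendsto_diff tendsto_const)
      then have *: "(\<lambda>k. complex_of_real (norm \<eta> powr s) * (Y k powr (\<kappa> * real j - 2 * \<delta>1) *\<^sub>R mode_dt (Y k powr \<kappa>) ((1 / Y k) *\<^sub>R \<eta>) - profile_dt 1 \<eta> *\<^sub>R P))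
          \<longlonglongrightarrow> 0" by simp
      have "\<forall>\<^sub>F k in sequentially. Y k \<ge> norm \<eta>" using Y by (simp add: filterlim_at_top)
      then have "\<forall>\<^sub>F k in sequentially. complex_of_real (norm \<eta> powr s) * (Y k powr (\<kappa> * real j - 2 * \<delta>1) *\<^sub>R mode_dt (Y k powr \<kappa>) ((1 / Y k) *\<^sub>R \<eta>) - profile_dt 1 \<eta> *\<^sub>R P) = scaled (Y k) \<eta>"
        by eventually_elim (simp add: scaled_def)
      with * show ?case by (rule Lim_transform_eventually)
    qed
  qed
  then show "(\<lambda>k. L2norm (scaled (X k))) \<longlonglongrightarrow> 0"
    by (rule Lim_transform_eventually) (use XY in \<open>eventually_elim, simp\<close>)
qed

definition rate :: real where
  "rate = - real DIM('a) / (4 * (\<sigma> - \<delta>1)) - s / (2 * (\<sigma> - \<delta>1)) - real j + \<delta>1 / (\<sigma> - \<delta>1)"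

text \<open>The three factors are the Jacobian of the dilation, the weight \<open>|\<xi>|^s\<close> and the homogeneity of the
  profile.\<close>

lemma rate_dilation:
  assumes L: "L > 0"
  shows "(1 / L) powr (real DIM('a) / 2) * (1 / L) powr s * L powr (2 * \<delta>1 - \<kappa> * real j) = (L powr \<kappa>) powr rate"
proof -
  have "\<kappa> * rate = - (real DIM('a) / 2) + - s + (2 * \<delta>1 - \<kappa> * real j)"
  proof -
    define d where "d = \<sigma> - \<delta>1"
    have "d > 0" using \<delta>1 \<delta>2 by (simp add: d_def)
    then show ?thesis
      unfolding rate_def \<kappa>_def d_def[symmetric] by (simp add: field_simps)
  qed
  moreover have "(1 / L) powr p = L powr (- p)" for p
    using L by (simp add: powr_divide powr_minus_divide)
  ultimately show ?thesis
    unfolding powr_powr by (simp only: powr_add)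
qed

lemma remainder_low:
  assumes L: "L \<ge> 1"
  shows "L2norm (\<lambda>\<xi>. if norm \<xi> \<le> 1 then remainder (L powr \<kappa>) \<xi> else 0) = (L powr \<kappa>) powr rate * L2norm (scaled L)"
proof -
  have L0: "L > 0" "L powr \<kappa> > 0" using L by auto
  have [measurable]: "remainder (L powr \<kappa>) \<in> borel_measurable lebesgue"
    using remainder_L2[OF L0(2)] by (simp add: L2_def)
  have eq: "(if norm ((1 / L) *\<^sub>R \<eta>) \<le> 1 then remainder (L powr \<kappa>) ((1 / L) *\<^sub>R \<eta>) else 0)
      = complex_of_real ((1 / L) powr s * L powr (2 * \<delta>1 - \<kappa> * real j)) * scaled L \<eta>" for \<eta> :: 'a
  proof -
    have n: "norm ((1 / L) *\<^sub>R \<eta>) = norm \<eta> / L" using L0 by simp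
    have le: "norm \<eta> / L \<le> 1 \<longleftrightarrow> norm \<eta> \<le> L" using L0 by (simp add: field_simps)
    have ns: "(norm \<eta> / L) powr s = (1 / L) powr s * norm \<eta> powr s" using L0 by (simp add: powr_divide)
    have c: "L powr (2 * \<delta>1 - \<kappa> * real j) * L powr (\<kappa> * real j - 2 * \<delta>1) = 1"
      using L0 by (simp add: powr_add[symmetric])
    let ?c = "L powr (2 * \<delta>1 - \<kappa> * real j)"
    have "mode_dt (L powr \<kappa>) ((1 / L) *\<^sub>R \<eta>) - P * complex_of_real (profile_dt (L powr \<kappa>) ((1 / L) *\<^sub>R \<eta>))
        = ?c *\<^sub>R (L powr (\<kappa> * real j - 2 * \<delta>1) *\<^sub>R mode_dt (L powr \<kappa>) ((1 / L) *\<^sub>R \<eta>) - profile_dt 1 \<eta> *\<^sub>R P)"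
      unfolding scaleR_diff_right scaleR_scaleR c profile_dt_dilation[OF L0(1)]
      by (simp add: scaleR_conv_of_real mult.commute)
    then show ?thesis
      unfolding remainder_def scaled_def n le ns by (simp add: scaleR_conv_of_real)
  qed
  have "L2norm (\<lambda>\<xi>. if norm \<xi> \<le> 1 then remainder (L powr \<kappa>) \<xi> else 0)
      = (1 / L) powr (real DIM('a) / 2) * L2norm (\<lambda>\<eta>. complex_of_real ((1 / L) powr s * L powr (2 * \<delta>1 - \<kappa> * real j)) * scaled L \<eta>)"
    unfolding eq[symmetric] by (rule L2norm_dilation) (use L0 in auto)
  also have "\<dots> = ((1 / L) powr (real DIM('a) / 2) * (1 / L) powr s * L powr (2 * \<delta>1 - \<kappa> * real j)) * L2norm (scaled L)"
    unfolding L2norm_scale norm_of_real by (simp add: mult.assoc abs_mult)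
  finally show ?thesis unfolding rate_dilation[OF L0(1)] .
qed

lemma profile_norm:
  assumes t: "t > 0"
  shows "L2norm (\<lambda>\<xi>. complex_of_real (norm \<xi> powr s * profile_dt t \<xi>)) = t powr rate * L2norm (\<lambda>\<eta>. complex_of_real (norm \<eta> powr s * profile_dt 1 \<eta>))"
proof -
  define L where "L = t powr (1 / \<kappa>)"
  have L0: "L > 0" using t by (simp add: L_def)
  have tL: "t = L powr \<kappa>" using t \<kappa>_pos by (simp add: L_def powr_powr)
  have eq: "complex_of_real (norm ((1 / L) *\<^sub>R \<eta>) powr s * profile_dt t ((1 / L) *\<^sub>R \<eta>))
      = complex_of_real ((1 / L) powr s * L powr (2 * \<delta>1 - \<kappa> * real j)) * complex_of_real (norm \<eta> powr s * profile_dt 1 \<eta>)" for \<eta> :: 'a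
  proof -
    have "norm ((1 / L) *\<^sub>R \<eta>) powr s = (1 / L) powr s * norm \<eta> powr s"
      using L0 by (simp add: powr_divide)
    then show ?thesis unfolding tL profile_dt_dilation[OF L0] by simp
  qed
  have m: "(\<lambda>\<xi>. complex_of_real (norm \<xi> powr s * profile_dt t \<xi>)) \<in> borel_measurable lebesgue"
    unfolding profile_dt_def[abs_def] profile_def[abs_def] by measurable
  have "L2norm (\<lambda>\<xi>. complex_of_real (norm \<xi> powr s * profile_dt t \<xi>))
      = (1 / L) powr (real DIM('a) / 2) * L2norm (\<lambda>\<eta>. complex_of_real ((1 / L) powr s * L powr (2 * \<delta>1 - \<kappa> * real j)) * complex_of_real (norm \<eta> powr s * profile_dt 1 \<eta>))"
    unfolding eq[symmetric] by (rule L2norm_dilation[OF m]) (use L0 in auto)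
  also have "\<dots> = ((1 / L) powr (real DIM('a) / 2) * (1 / L) powr s * L powr (2 * \<delta>1 - \<kappa> * real j)) * L2norm (\<lambda>\<eta>. complex_of_real (norm \<eta> powr s * profile_dt 1 \<eta>))"
    unfolding L2norm_scale norm_of_real by (simp add: mult.assoc abs_mult)
  finally show ?thesis unfolding rate_dilation[OF L0] tL[symmetric] .
qed

lemma profile_norm_pos: "L2norm (\<lambda>\<eta>::'a. complex_of_real (norm \<eta> powr s * profile_dt 1 \<eta>)) > 0"
proof (rule ccontr)
  assume "\<not> ?thesis"
  then have 0: "L2norm (\<lambda>\<eta>::'a. complex_of_real (norm \<eta> powr s * profile_dt 1 \<eta>)) = 0"
    using L2norm_nonneg by (metis less_eq_real_def)
  have "(\<lambda>\<eta>. complex_of_real (norm \<eta> powr s * profile_dt 1 \<eta>)) \<in> borel_measurable lebesgue"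
    unfolding profile_dt_def[abs_def] profile_def[abs_def] by measurable
  then have "(\<lambda>\<eta>. complex_of_real (norm \<eta> powr s * profile_dt 1 \<eta>)) \<in> L2"
    by (intro L2_dominated(1)[OF profile_dt_1_L2, where C=1]) (auto simp: norm_mult)
  from L2norm_eq_0[OF this 0] have "AE \<eta> in (lebesgue :: 'a measure). False"
    using AE_good
  proof eventually_elim
    case (elim \<eta>)
    then have "\<eta> \<noteq> 0" by (simp add: good_def)
    then have "norm \<eta> powr s * profile_dt 1 \<eta> \<noteq> 0" unfolding profile_dt_def profile_def by simp
    then show ?case using elim by simp
  qed
  then show False using not_AE_lebesgue_False by blast
qed

definition high_dominant :: "'a \<Rightarrow> real" where
  "high_dominant \<xi> = 4 * weighted_data \<xi> + cmod P * (norm \<xi> powr (s + \<kappa>) * profile 1 \<xi>)"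

lemma high_dominant_L2: "(\<lambda>\<xi>. complex_of_real (high_dominant \<xi>)) \<in> L2"
  unfolding high_dominant_def using s \<kappa>_pos by (intro L2_of_real_add L2_of_real_scale weighted_data_L2 profile_L2) auto

text \<open>Part of the exponent \<open>t |\<xi>|^\<kappa>\<close> is spent on decay in time, the rest on decay in \<open>\<xi>\<close>.\<close>

lemma remainder_high:
  assumes good: "good \<xi>" and r: "norm \<xi> \<ge> 1" and t: "t \<ge> 2"
  shows "cmod (remainder t \<xi>) \<le> exp (- t / 8) * high_dominant \<xi>"
proof -
  have rk: "norm \<xi> powr \<kappa> \<ge> 1" using r \<kappa>_pos by (intro ge_one_powr_ge_zero) auto
  have "\<bar>profile_dt t \<xi>\<bar> \<le> norm \<xi> powr \<kappa> * profile t \<xi>"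
  proof -
    have "1 * profile t \<xi> \<le> norm \<xi> powr \<kappa> * profile t \<xi>" using rk profile_nonneg by (intro mult_right_mono) auto
    then show ?thesis unfolding profile_dt_def using profile_nonneg[of t \<xi>] by (auto simp: abs_mult)
  qed
  also have "profile t \<xi> \<le> exp (- t / 8) * profile 1 \<xi>"
  proof -
    have "t / 2 * 1 \<le> t / 2 * norm \<xi> powr \<kappa>" using t rk by (intro mult_left_mono) auto
    moreover have "1 * norm \<xi> powr \<kappa> \<le> t / 2 * norm \<xi> powr \<kappa>" using t rk by (intro mult_right_mono) auto
    moreover have "t * norm \<xi> powr \<kappa> = t / 2 * norm \<xi> powr \<kappa> + t / 2 * norm \<xi> powr \<kappa>" by simp
    ultimately have "t / 8 + norm \<xi> powr \<kappa> \<le> t * norm \<xi> powr \<kappa>" using t by linarith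
    then have "exp (- t * norm \<xi> powr \<kappa>) \<le> exp (- t / 8) * exp (- 1 * norm \<xi> powr \<kappa>)"
      unfolding exp_add[symmetric] by simp
    from divide_right_mono[OF this, of "norm \<xi> powr (2 * \<delta>1)"] show ?thesis unfolding profile_def by simp
  qed
  finally have profile_dt: "\<bar>profile_dt t \<xi>\<bar> \<le> norm \<xi> powr \<kappa> * (exp (- t / 8) * profile 1 \<xi>)" by (simp add: mult_left_mono)
  have "cmod (remainder t \<xi>) \<le> norm \<xi> powr s * (cmod (mode_dt t \<xi>) + cmod P * \<bar>profile_dt t \<xi>\<bar>)"
    unfolding remainder_def
    using norm_triangle_ineq4[of "mode_dt t \<xi>" "P * complex_of_real (profile_dt t \<xi>)"]
    by (auto simp: norm_mult intro!: mult_left_mono)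
  also have "\<dots> = norm \<xi> powr s * cmod (mode_dt t \<xi>) + cmod P * (norm \<xi> powr s * \<bar>profile_dt t \<xi>\<bar>)"
    by (simp add: algebra_simps)
  also have "\<dots> \<le> 4 * weighted_data \<xi> * exp (- t / 8) + cmod P * (norm \<xi> powr s * (norm \<xi> powr \<kappa> * (exp (- t / 8) * profile 1 \<xi>)))"
    using high_frequency_bound[OF good r, of t] t profile_dt by (intro add_mono mult_left_mono) auto
  also have "\<dots> = exp (- t / 8) * high_dominant \<xi>"
    unfolding high_dominant_def by (simp add: powr_add algebra_simps)
  finally show ?thesis .
qed

lemma remainder_norm_bound:
  assumes t: "t \<ge> 2"
  shows "L2norm (remainder t) \<le> t powr rate * L2norm (scaled (t powr (1 / \<kappa>)))
      + exp (- t / 8) * L2norm (\<lambda>\<xi>. complex_of_real (high_dominant \<xi>))"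
proof -
  define L where "L = t powr (1 / \<kappa>)"
  have L1: "L \<ge> 1" unfolding L_def using t \<kappa>_pos by (intro ge_one_powr_ge_zero) auto
  have tL: "t = L powr \<kappa>" using t \<kappa>_pos by (simp add: L_def powr_powr)
  have RL: "remainder t \<in> L2" using t by (intro remainder_L2) auto
  then have [measurable]: "remainder t \<in> borel_measurable lebesgue" by (simp add: L2_def)
  let ?lo = "\<lambda>\<xi>. if norm \<xi> \<le> 1 then remainder t \<xi> else 0"
  let ?hi = "\<lambda>\<xi>. if norm \<xi> \<le> 1 then 0 else remainder t \<xi>"
  have lo: "?lo \<in> L2" by (rule L2_dominated(1)[OF RL, where C=1]) auto
  have hi: "?hi \<in> L2" "L2norm ?hi \<le> exp (- t / 8) * L2norm (\<lambda>\<xi>. complex_of_real (high_dominant \<xi>))"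
  proof -
    have m: "?hi \<in> borel_measurable lebesgue" by measurable
    have ae: "AE \<xi> in lebesgue. cmod (?hi \<xi>) \<le> exp (- t / 8) * cmod (complex_of_real (high_dominant \<xi>))"
      using AE_good
    proof eventually_elim
      case (elim \<xi>)
      have nn: "high_dominant \<xi> \<ge> 0"
        unfolding high_dominant_def using weighted_data_nonneg[of \<xi>] profile_nonneg[of 1 \<xi>] by auto
      show ?case
        using remainder_high[OF elim _ t] nn by auto
    qed
    show "?hi \<in> L2" "L2norm ?hi \<le> exp (- t / 8) * L2norm (\<lambda>\<xi>. complex_of_real (high_dominant \<xi>))"
      using L2_dominated[OF high_dominant_L2 m ae] by auto
  qed
  have "remainder t = (\<lambda>\<xi>. ?lo \<xi> + ?hi \<xi>)" by auto
  then have "L2norm (remainder t) \<le> L2norm ?lo + L2norm ?hi"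
    using L2_add(2)[OF lo hi(1)] by metis
  then show ?thesis
    using hi(2) remainder_low[OF L1] unfolding tL[symmetric] L_def[symmetric] by linarith
qed

lemma remainder_smallo: "(\<lambda>t. L2norm (remainder t)) \<in> o[at_top](\<lambda>t. t powr rate)"
proof (rule smalloI_tendsto)
  show "\<forall>\<^sub>F t in at_top. t powr rate \<noteq> (0::real)"
    using eventually_gt_at_top[of 0] by eventually_elim simp
  let ?K = "L2norm (\<lambda>\<xi>. complex_of_real (high_dominant \<xi>))"
  show "((\<lambda>t. L2norm (remainder t) / t powr rate) \<longlongrightarrow> 0) at_top"
  proof (rule Lim_null_comparison)
    show "\<forall>\<^sub>F t in at_top. norm (L2norm (remainder t) / t powr rate)
        \<le> L2norm (scaled (t powr (1 / \<kappa>))) + t powr (- rate) * exp (- t / 8) * ?K"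
      using eventually_ge_at_top[of 2]
    proof eventually_elim
      case (elim t)
      then have tp: "t powr rate > 0" by simp
      have "L2norm (remainder t) / t powr rate
          \<le> (t powr rate * L2norm (scaled (t powr (1 / \<kappa>))) + exp (- t / 8) * ?K) / t powr rate"
        using remainder_norm_bound[OF elim] tp by (intro divide_right_mono) auto
      also have "\<dots> = L2norm (scaled (t powr (1 / \<kappa>))) + t powr (- rate) * exp (- t / 8) * ?K"
        using tp by (simp add: add_divide_distrib powr_minus_divide)
      finally show ?case by simp
    qed
    have "((\<lambda>t. L2norm (scaled (t powr (1 / \<kappa>)))) \<longlongrightarrow> 0) at_top"
      by (rule filterlim_compose[OF scaled_tendsto filterlim_powr_at_top]) (use \<kappa>_pos in simp)
    moreover have "((\<lambda>t. t powr (- rate) * exp (- t / 8)) \<longlongrightarrow> 0) at_top"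
    proof (rule Lim_null_comparison)
      define m where "m = \<bar>rate\<bar> + 1"
      have m0: "m > 0" by (simp add: m_def)
      show "\<forall>\<^sub>F t in at_top. norm (t powr (- rate) * exp (- t / 8)) \<le> (8 * m) powr m * t powr (- 1)"
        using eventually_ge_at_top[of 1]
      proof eventually_elim
        case (elim t)
        have "exp (- (t / 8)) \<le> (m / (t / 8)) powr m" using elim m0 by (intro exp_minus_le_powr) auto
        also have "\<dots> = (8 * m) powr m * t powr (- m)"
          using elim m0 by (simp add: powr_divide powr_minus_divide mult.commute)
        finally have "t powr (- rate) * exp (- t / 8) \<le> t powr (- rate) * ((8 * m) powr m * t powr (- m))"
          by (intro mult_left_mono) auto
        also have "\<dots> = (8 * m) powr m * t powr (- rate - m)"
          by (simp add: powr_add[symmetric])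
        also have "\<dots> \<le> (8 * m) powr m * t powr (- 1)"
          using elim by (intro mult_left_mono powr_mono) (auto simp: m_def)
        finally show ?case by simp
      qed
      have "((\<lambda>t::real. (8 * m) powr m * inverse t) \<longlongrightarrow> (8 * m) powr m * 0) at_top"
        by (intro tendsto_mult tendsto_const tendsto_inverse_0_at_top filterlim_ident)
      moreover have "\<forall>\<^sub>F t in at_top. (8 * m) powr m * inverse t = (8 * m) powr m * t powr (- 1)"
        using eventually_gt_at_top[of 0] by eventually_elim (simp add: powr_minus)
      ultimately show "((\<lambda>t. (8 * m) powr m * t powr (- 1)) \<longlongrightarrow> 0) at_top"
        using Lim_transform_eventually by fastforce
    qed
    ultimately have "((\<lambda>t. L2norm (scaled (t powr (1 / \<kappa>))) + t powr (- rate) * exp (- t / 8) * ?K) \<longlongrightarrow> 0 + 0 * ?K) at_top"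
      by (intro tendsto_add tendsto_mult tendsto_const)
    then show "((\<lambda>t. L2norm (scaled (t powr (1 / \<kappa>))) + t powr (- rate) * exp (- t / 8) * ?K) \<longlongrightarrow> 0) at_top" by simp
  qed
qed

text \<open>The profile scales exactly and is not zero; the remainder is eventually at most half as large.\<close>

lemma two_sided_bounds:
  assumes P: "P \<noteq> 0"
  shows "\<exists>C1>0. \<exists>C2>0. \<forall>\<^sub>F t in at_top.
     C1 * t powr rate \<le> L2norm (\<lambda>\<xi>. complex_of_real (norm \<xi> powr s) * mode_dt t \<xi>) \<and>
     L2norm (\<lambda>\<xi>. complex_of_real (norm \<xi> powr s) * mode_dt t \<xi>) \<le> C2 * t powr rate"
proof -
  define K where "K = cmod P * L2norm (\<lambda>\<eta>::'a. complex_of_real (norm \<eta> powr s * profile_dt 1 \<eta>))"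
  have K: "K > 0" unfolding K_def using P profile_norm_pos by simp
  have "\<forall>\<^sub>F t in at_top. norm (L2norm (remainder t)) \<le> (K / 2) * norm (t powr rate)"
    using landau_o.smallD[OF remainder_smallo, of "K / 2"] K by simp
  then have "\<forall>\<^sub>F t in at_top. (K / 2) * t powr rate \<le> L2norm (\<lambda>\<xi>. complex_of_real (norm \<xi> powr s) * mode_dt t \<xi>) \<and>
     L2norm (\<lambda>\<xi>. complex_of_real (norm \<xi> powr s) * mode_dt t \<xi>) \<le> (3 * K / 2) * t powr rate"
    using eventually_gt_at_top[of 0]
  proof eventually_elim
    case (elim t)
    let ?A = "\<lambda>\<xi>. complex_of_real (norm \<xi> powr s) * mode_dt t \<xi>"
    let ?profile_dt = "\<lambda>\<xi>. P * complex_of_real (norm \<xi> powr s * profile_dt t \<xi>)"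
    have A: "?A \<in> L2" using weighted_mode_L2[OF elim(2), of 0] by simp
    have "(\<lambda>\<xi>. ?A \<xi> - remainder t \<xi>) \<in> L2"
      by (rule L2_diff(1)[OF A remainder_L2[OF elim(2)]])
    moreover have GA: "?A \<xi> - remainder t \<xi> = ?profile_dt \<xi>" "?A \<xi> - ?profile_dt \<xi> = remainder t \<xi>" for \<xi>
      by (simp_all add: remainder_def algebra_simps)
    ultimately have "?profile_dt \<in> L2" by simp
    from L2norm_diff_ineq[OF A this] have "\<bar>L2norm ?A - L2norm ?profile_dt\<bar> \<le> L2norm (remainder t)"
      unfolding GA(2) .
    moreover have "L2norm ?profile_dt = K * t powr rate"
      unfolding L2norm_scale profile_norm[OF elim(2)] K_def by simp
    moreover have "L2norm (remainder t) \<le> K / 2 * t powr rate" using elim by simp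
    ultimately show ?case by (simp add: abs_le_iff field_simps)
  qed
  then show ?thesis using K by (intro exI[of _ "K / 2"] exI[of _ "3 * K / 2"] conjI) auto
qed

end

section \<open>The asymptotic profile\<close>

theorem theorem1p3:
  fixes \<sigma> \<delta>1 \<delta>2 s :: real and j :: nat
    and u0 u1 :: "real ^ 'n \<Rightarrow> complex"
    and u :: "real \<Rightarrow> real ^ 'n \<Rightarrow> complex"
  assumes "\<sigma> \<ge> 1"
    and "0 < \<delta>1" and "\<delta>1 < \<sigma> / 2" and "\<sigma> / 2 < \<delta>2" and "\<delta>2 < \<sigma>"
    and "\<delta>1 + \<delta>2 > \<sigma>"
    and "j \<in> {0, 1}" and "s \<ge> 0"
    and "real CARD('n) > 4 * \<delta>1"
    and "integrable lebesgue u0" and "u0 \<in> sobolev (s + 2 * real j * \<delta>2)"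
    and "integrable lebesgue u1" and "u1 \<in> sobolev (max (s + 2 * (real j - 1) * \<delta>2) 0)"
    and "sobolev_solution \<sigma> \<delta>1 \<delta>2 u0 u1 u"
  shows "let P1 = (LINT x|lebesgue. u1 x);
             r = - real CARD('n) / (4 * (\<sigma> - \<delta>1)) - s / (2 * (\<sigma> - \<delta>1)) - real j
                 + \<delta>1 / (\<sigma> - \<delta>1);
             w = (\<lambda>t x. u t x - P1 * diffusion_profile \<sigma> \<delta>1 t x)
         in (\<forall>t>0. u t \<in> sobolev s \<and> w t \<in> sobolev s) \<and>
            (j = 1 \<longrightarrow> (\<forall>t>0. L2_differentiable (\<lambda>t. abs_D s (u t)) t \<and>
                              L2_differentiable (\<lambda>t. abs_D s (w t)) t)) \<and>
            (\<lambda>t. L2norm ((D_t ^^ j) (\<lambda>t. abs_D s (w t)) t)) \<in> o[at_top](\<lambda>t. t powr r) \<and>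
            (P1 \<noteq> 0 \<longrightarrow>
              (\<exists>C1>0. \<exists>C2>0. \<forall>\<^sub>F t in at_top.
                 C1 * t powr r \<le> L2norm ((D_t ^^ j) (\<lambda>t. abs_D s (u t)) t) \<and>
                 L2norm ((D_t ^^ j) (\<lambda>t. abs_D s (u t)) t) \<le> C2 * t powr r))"
proof -
  note params = assms(1-9) and u0 = assms(10,11) and u1 = assms(12,13) and sol = assms(14)
  define P where "P = (LINT x|lebesgue. u1 x)"
  define c where "c = sqrt (2 * pi) ^ DIM(real ^ 'n)"
  have c: "c > 0" by (simp add: c_def)
  obtain v v' where vt: "\<And>t. t \<ge> 0 \<Longrightarrow> has_fourier (u t) (v t)"
    and modes: "AE \<xi> in lebesgue.
           v 0 \<xi> = fourier u0 \<xi> \<and> v' 0 \<xi> = fourier u1 \<xi> \<and>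
           (\<forall>t\<ge>0.
              ((\<lambda>t. v t \<xi>) has_vector_derivative v' t \<xi>) (at t within {0..}) \<and>
              (\<exists>v''. ((\<lambda>t. v' t \<xi>) has_vector_derivative v'') (at t within {0..}) \<and>
                 v'' + complex_of_real (norm \<xi> powr (2 * \<delta>1) + norm \<xi> powr (2 * \<delta>2)) * v' t \<xi>
                     + complex_of_real (norm \<xi> powr (2 * \<sigma>)) * v t \<xi> = 0))"
    using sol unfolding sobolev_solution_def by blast
  have u0L: "u0 \<in> L2" and u1L: "u1 \<in> L2" using u0 u1 by (auto simp: sobolev_def)
  let ?z0 = "fourier_integral u0" and ?z1 = "fourier_integral u1"
  have z0: "has_fourier u0 ?z0" and z1: "has_fourier u1 ?z1"
    by (intro has_fourier_fourier_integral u0L u1L u0 u1)+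
  define B where "B = max (LINT x|lebesgue. cmod (u0 x)) (LINT x|lebesgue. cmod (u1 x))"
  interpret damped_frequencies \<sigma> \<delta>1 \<delta>2 s j v v' ?z0 ?z1 B P
  proof
    show "AE \<xi> in lebesgue. v 0 \<xi> = ?z0 \<xi> \<and> v' 0 \<xi> = ?z1 \<xi> \<and> (\<forall>t\<ge>0.
              ((\<lambda>t. v t \<xi>) has_vector_derivative v' t \<xi>) (at t within {0..}) \<and>
              (\<exists>v''. ((\<lambda>t. v' t \<xi>) has_vector_derivative v'') (at t within {0..}) \<and>
                 v'' + complex_of_real (norm \<xi> powr (2 * \<delta>1) + norm \<xi> powr (2 * \<delta>2)) * v' t \<xi>
                     + complex_of_real (norm \<xi> powr (2 * \<sigma>)) * v t \<xi> = 0))"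
      using modes fourier_eq_AE[OF z0] fourier_eq_AE[OF z1] by eventually_elim simp
    show "v t \<in> L2" if "0 \<le> t" for t using vt[OF that] by (rule has_fourier_L2)
    show "cmod (?z0 \<xi>) \<le> B" "cmod (?z1 \<xi>) \<le> B" for \<xi>
      using fourier_integral_bound[OF u0(1), of \<xi>] fourier_integral_bound[OF u1(1), of \<xi>]
      unfolding B_def by linarith+
    have "?z1 0 = P" by (simp add: fourier_integral_def P_def)
    then show "(\<lambda>k. ?z1 (x k)) \<longlonglongrightarrow> P" if "x \<longlonglongrightarrow> 0" for x
      using fourier_integral_tendsto[OF u1(1) that] by simp
    show "(\<lambda>\<xi>. complex_of_real ((1 + (norm \<xi>)\<^sup>2) powr ((s + 2 * real j * \<delta>2) / 2)) * ?z0 \<xi>) \<in> L2"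
      using u0(2) unfolding sobolev_iff[OF z0] .
    show "(\<lambda>\<xi>. complex_of_real ((1 + (norm \<xi>)\<^sup>2) powr (max (s + 2 * (real j - 1) * \<delta>2) 0 / 2)) * ?z1 \<xi>) \<in> L2"
      using u1(2) unfolding sobolev_iff[OF z1] .
  qed (use params in auto)
  define prof :: "real \<Rightarrow> real ^ 'n \<Rightarrow> complex" where "prof = diffusion_profile \<sigma> \<delta>1"
  have prof: "has_fourier (prof t) (\<lambda>\<xi>. complex_of_real (profile t \<xi>))" if "t > 0" for t
    unfolding prof_def diffusion_profile_def
    using has_fourier_inv_fourier[OF profile_L2'[OF that]] unfolding profile_def \<kappa>_def .
  \<comment> \<open>\<open>Q = P\<close> gives the remainder, \<open>Q = 0\<close> the solution itself\<close>
  have diff: "has_fourier (\<lambda>x. u t x - Q * prof t x) (\<lambda>\<xi>. v t \<xi> - Q * complex_of_real (profile t \<xi>))" if "t > 0" for t Q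
    using that by (intro has_fourier_diff has_fourier_scale vt prof) auto
  have sob: "(\<lambda>x. u t x - Q * prof t x) \<in> sobolev s" if "t > 0" for t Q
    unfolding sobolev_iff[OF diff[OF that]] by (rule sobolev_weight_L2[OF that])
  have absD: "has_fourier (abs_D s (\<lambda>x. u t x - Q * prof t x))
      (\<lambda>\<xi>. complex_of_real (norm \<xi> powr s) * (v t \<xi> - Q * complex_of_real (profile t \<xi>)))" if "t > 0" for t Q
    by (rule has_fourier_abs_D[OF diff[OF that] weighted_L2[OF that]])
  have ev: "\<forall>\<^sub>F \<tau> in nhds t. has_fourier (abs_D s (\<lambda>x. u \<tau> x - Q * prof \<tau> x))
      (\<lambda>\<xi>. complex_of_real (norm \<xi> powr s) * (v \<tau> \<xi> - Q * complex_of_real (profile \<tau> \<xi>)))" if "t > 0" for t Q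
    using eventually_nhds_in_open[of "{0<..}" t] that by (auto elim!: eventually_mono intro: absD)
  have differentiable: "L2_differentiable (\<lambda>t. abs_D s (\<lambda>x. u t x - Q * prof t x)) t" if "j = 1" "t > 0" for t Q
    by (rule has_L2_derivative_of_fourier(1)[OF ev[OF that(2)] weighted_derivative(1)[OF that]])
  have Dj: "has_fourier ((D_t ^^ j) (\<lambda>t. abs_D s (\<lambda>x. u t x - Q * prof t x)) t)
      (\<lambda>\<xi>. complex_of_real (norm \<xi> powr s) * (mode_dt t \<xi> - Q * complex_of_real (profile_dt t \<xi>)))" if "t > 0" for t Q
  proof (cases "j = 0")
    case True
    then show ?thesis using absD[OF that, of Q] unfolding mode_dt_def profile_dt_def by simp
  next
    case False
    then have j1: "j = 1" using j by auto
    have "(D_t ^^ j) U = D_t U" for U :: "real \<Rightarrow> real ^ 'n \<Rightarrow> complex" using j1 by simp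
    then show ?thesis
      using has_L2_derivative_of_fourier(2)[OF ev[OF that] weighted_derivative(1)[OF j1 that]] by simp
  qed
  have normj: "L2norm ((D_t ^^ j) (\<lambda>t. abs_D s (\<lambda>x. u t x - Q * prof t x)) t)
      = L2norm (\<lambda>\<xi>. complex_of_real (norm \<xi> powr s) * (mode_dt t \<xi> - Q * complex_of_real (profile_dt t \<xi>))) / c" if "t > 0" for t Q
    using plancherel[OF Dj[OF that, of Q]] c by (simp add: c_def)
  have rate: "rate = - real CARD('n) / (4 * (\<sigma> - \<delta>1)) - s / (2 * (\<sigma> - \<delta>1)) - real j + \<delta>1 / (\<sigma> - \<delta>1)"
    by (simp add: rate_def)
  let ?w = "\<lambda>t x. u t x - P * prof t x"
  have u_eq: "u t = (\<lambda>x. u t x - 0 * prof t x)" for t by simp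
  have 1: "\<forall>t>0. u t \<in> sobolev s \<and> ?w t \<in> sobolev s"
    using sob[of _ P] sob[of _ 0] by simp
  have 2: "j = 1 \<longrightarrow> (\<forall>t>0. L2_differentiable (\<lambda>t. abs_D s (u t)) t \<and> L2_differentiable (\<lambda>t. abs_D s (?w t)) t)"
    using differentiable[of _ P] differentiable[of _ 0] by simp
  have 3: "(\<lambda>t. L2norm ((D_t ^^ j) (\<lambda>t. abs_D s (?w t)) t)) \<in> o[at_top](\<lambda>t. t powr rate)"
  proof -
    have "(\<lambda>t. (1 / c) * L2norm (remainder t)) \<in> o[at_top](\<lambda>t. t powr rate)"
      using remainder_smallo c by simp
    moreover have "\<forall>\<^sub>F t in at_top. (1 / c) * L2norm (remainder t) = L2norm ((D_t ^^ j) (\<lambda>t. abs_D s (?w t)) t)"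
      using eventually_gt_at_top[of 0] by eventually_elim (simp add: normj remainder_def[abs_def])
    ultimately show ?thesis by (simp add: landau_o.small.in_cong)
  qed
  have 4: "\<exists>C1>0. \<exists>C2>0. \<forall>\<^sub>F t in at_top.
                 C1 * t powr rate \<le> L2norm ((D_t ^^ j) (\<lambda>t. abs_D s (u t)) t) \<and>
                 L2norm ((D_t ^^ j) (\<lambda>t. abs_D s (u t)) t) \<le> C2 * t powr rate" if P0: "P \<noteq> 0"
  proof -
    obtain C1 C2 where C: "C1 > 0" "C2 > 0" and bounds: "\<forall>\<^sub>F t in at_top.
     C1 * t powr rate \<le> L2norm (\<lambda>\<xi>. complex_of_real (norm \<xi> powr s) * mode_dt t \<xi>) \<and>
     L2norm (\<lambda>\<xi>. complex_of_real (norm \<xi> powr s) * mode_dt t \<xi>) \<le> C2 * t powr rate"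
      using two_sided_bounds[OF P0] by blast
    have "\<forall>\<^sub>F t in at_top.
                 (C1 / c) * t powr rate \<le> L2norm ((D_t ^^ j) (\<lambda>t. abs_D s (u t)) t) \<and>
                 L2norm ((D_t ^^ j) (\<lambda>t. abs_D s (u t)) t) \<le> (C2 / c) * t powr rate"
      using bounds eventually_gt_at_top[of 0]
    proof eventually_elim
      case (elim t)
      have "L2norm ((D_t ^^ j) (\<lambda>t. abs_D s (u t)) t) = L2norm (\<lambda>\<xi>. complex_of_real (norm \<xi> powr s) * mode_dt t \<xi>) / c"
        using normj[OF elim(2), of 0] by simp
      then show ?case using elim c by (simp add: divide_right_mono)
    qed
    then show ?thesis using C c by (intro exI[of _ "C1 / c"] exI[of _ "C2 / c"] conjI) auto
  qed
  show ?thesis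
    unfolding Let_def P_def[symmetric] prof_def[symmetric] rate[symmetric]
    using 1 2 3 4 by blast
qed

end
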